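(* There exists a functor $$(-)_{Leb}:\mathrm{Man}_{\mathrm{subm}}\rightarrow\mathrm{MblLoc},\qquad M\mapsto M_{Leb},$$ where $\mathrm{Man}_{\mathrm{subm}}$ is the category of large smooth manifolds with smooth submersions as maps between them, and $\mathrm{MblLoc}$ is the category of measurable locales.
   Context: A frame is a poset with arbitrary suprema and finite infima satisfying $V\wedge\bigvee_i U_i=\bigvee_i(V\wedge U_i)$; $\mathrm{Loc}$ (locales, continuous maps) is the opposite of the category of frames and frame homomorphisms; $\mathcal{O}(L)$ is the frame of $L$. A measure on $L$ is a monotone map $\nu:\mathcal{O}(L)\to[0,\infty]$ with $\nu(0)=0$, $\nu(U)+\nu(V)=\nu(U\vee V)+\nu(U\wedge V)$, and $\nu(\bigvee_iU_i)=\sup_i\nu(U_i)$ for directed families. It is locally finite if $1$ is a supremum of opens of finite measure, and faithful if whenever $U\le V$ and $\nu(U\wedge K)=\nu(V\wedge K)$ for all $K$ with $\nu(K)<\infty$, then $U=V$. A locale is Boolean if every open has a complement. A Boolean locale is measurable if one of the following equivalent conditions holds: (1) it admits a locally finite and faithful measure; (2) $1$ is the supremum of those opens $a$ that admit a finite faithful measure; (3) for every open $b\ne0$ there is a finite measure $\nu$ on the locale with $\nu(b)\neq0$. $\mathrm{MblLoc}$ is the full subcategory of $\mathrm{Loc}$ on measurable locales. A large smooth $n$-manifold is a Hausdorff space $M$ (not necessarily second countable) with a collection of $n$-dimensional charts $(U_i,\varphi_i)$ ($U_i\subset M$ open, $\varphi_i$ a homeomorphism onto an open subset of $\mathbb{R}^n$)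 covering $M$ with smooth transition functions. A submersion is a smooth map whose differential has full rank (is surjective) at each point. A compact subset $K\subset M$ is null if there are finitely many charts $(U_i,\varphi_i)$ and compact subsets $K_i\subset U_i$ with $K=\bigcup_iK_i$ and each $\varphi_i(K_i)\subset\mathbb{R}^n$ a null set for Lebesgue measure on $\mathbb{R}^n$. The compact null sets form an ideal $N$ of the lattice $\mathcal{K}(M)$ of compact subsets of $M$. $M^{\mathcal{K}}$ is the locale whose frame is the set of ideals (downward closed subsets containing $\emptyset$ and closed under finite unions) of $\mathcal{K}(M)$ ordered by inclusion. For a locale $L$ and an open $N$ of $L$, $b(N)$ denotes the sublocale of $L$ whose frame is $\{U\to N\mid U\in\mathcal{O}(L)\}\subset\mathcal{O}(L)$, with $\to$ the Heyting implication ($W\le(U\to N)$ iff $W\wedge U\le N$). The Lebesgue locale of $M$ is $M_{Leb}=b(N)\hookrightarrow M^{\mathcal{K}}$ for $N$ the ideal of compact null sets. *)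

theory Defs
  imports "HOL-Analysis.Analysis" "HOL-Algebra.Complete_Lattice"
begin

section \<open>Categories and functors\<close>

text \<open>
  Morphisms need not determine their source and target, so composition and the action of a
  functor on morphisms receive the objects as arguments: \<open>Comp C X Y Z g f\<close> is the composite
  of \<open>f : X \<rightarrow> Y\<close> and \<open>g : Y \<rightarrow> Z\<close>.
\<close>

record ('o, 'm) category =
  Ob :: "'o set"
  Hom :: "'o \<Rightarrow> 'o \<Rightarrow> 'm set"
  Idm :: "'o \<Rightarrow> 'm"
  Comp :: "'o \<Rightarrow> 'o \<Rightarrow> 'o \<Rightarrow> 'm \<Rightarrow> 'm \<Rightarrow> 'm"

locale category =
  fixes C :: "('o, 'm) category"
  assumes Id_in_Hom: "X \<in> Ob C \<Longrightarrow> Idm C X \<in> Hom C X X"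
    and Comp_in_Hom: "\<lbrakk>X \<in> Ob C; Y \<in> Ob C; Z \<in> Ob C; f \<in> Hom C X Y; g \<in> Hom C Y Z\<rbrakk>
      \<Longrightarrow> Comp C X Y Z g f \<in> Hom C X Z"
    and Comp_Id_right: "\<lbrakk>X \<in> Ob C; Y \<in> Ob C; f \<in> Hom C X Y\<rbrakk> \<Longrightarrow> Comp C X X Y f (Idm C X) = f"
    and Comp_Id_left: "\<lbrakk>X \<in> Ob C; Y \<in> Ob C; f \<in> Hom C X Y\<rbrakk> \<Longrightarrow> Comp C X Y Y (Idm C Y) f = f"
    and Comp_assoc: "\<lbrakk>W \<in> Ob C; X \<in> Ob C; Y \<in> Ob C; Z \<in> Ob C;
        f \<in> Hom C W X; g \<in> Hom C X Y; h \<in> Hom C Y Z\<rbrakk>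
      \<Longrightarrow> Comp C W X Z (Comp C X Y Z h g) f = Comp C W Y Z h (Comp C W X Y g f)"

locale cat_functor = source: category C + target: category D
  for C :: "('o, 'm) category" and D :: "('p, 'n) category"
    and Fo :: "'o \<Rightarrow> 'p" and Fm :: "'o \<Rightarrow> 'o \<Rightarrow> 'm \<Rightarrow> 'n" +
  assumes Fo_in_Ob: "X \<in> Ob C \<Longrightarrow> Fo X \<in> Ob D"
    and Fm_in_Hom: "\<lbrakk>X \<in> Ob C; Y \<in> Ob C; f \<in> Hom C X Y\<rbrakk> \<Longrightarrow> Fm X Y f \<in> Hom D (Fo X) (Fo Y)"
    and Fm_Id: "X \<in> Ob C \<Longrightarrow> Fm X X (Idm C X) = Idm D (Fo X)"
    and Fm_Comp: "\<lbrakk>X \<in> Ob C; Y \<in> Ob C; Z \<in> Ob C; f \<in> Hom C X Y; g \<in> Hom C Y Z\<rbrakk>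
      \<Longrightarrow> Fm X Z (Comp C X Y Z g f) = Comp D (Fo X) (Fo Y) (Fo Z) (Fm Y Z g) (Fm X Y f)"

definition full_subcategory :: "('o, 'm) category \<Rightarrow> ('o \<Rightarrow> bool) \<Rightarrow> ('o, 'm) category"
  where "full_subcategory C P = C\<lparr>Ob := {X \<in> Ob C. P X}\<rparr>"


section \<open>Frames and locales\<close>

text \<open>A locale is represented by its frame of opens.\<close>

locale frame = complete_lattice L for L (structure) +
  assumes meet_Sup_distrib: "\<lbrakk>V \<in> carrier L; A \<subseteq> carrier L\<rbrakk>
    \<Longrightarrow> V \<sqinter> \<Squnion>A = \<Squnion>((\<lambda>U. V \<sqinter> U) ` A)"

definition frame_hom :: "'a gorder \<Rightarrow> 'b gorder \<Rightarrow> ('a \<Rightarrow> 'b) set"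
  where "frame_hom A B = {h \<in> carrier A \<rightarrow>\<^sub>E carrier B.
     (\<forall>S \<subseteq> carrier A. h (\<Squnion>\<^bsub>A\<^esub>S) = \<Squnion>\<^bsub>B\<^esub>(h ` S)) \<and>
     h \<top>\<^bsub>A\<^esub> = \<top>\<^bsub>B\<^esub> \<and>
     (\<forall>U \<in> carrier A. \<forall>V \<in> carrier A. h (U \<sqinter>\<^bsub>A\<^esub> V) = h U \<sqinter>\<^bsub>B\<^esub> h V)}"

text \<open>The opposite of the category of frames: a map \<open>L \<rightarrow> L'\<close> is a frame homomorphism
  from the opens of \<open>L'\<close> to the opens of \<open>L\<close>.\<close>

definition Loc :: "('a gorder, 'a \<Rightarrow> 'a) category"
  where "Loc = \<lparr>
     Ob = {L. frame L},
     Hom = (\<lambda>L L'. frame_hom L' L),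
     Idm = (\<lambda>L. \<lambda>U\<in>carrier L. U),
     Comp = (\<lambda>L L' L'' g f. compose (carrier L'') f g)\<rparr>"

definition boolean_locale :: "'a gorder \<Rightarrow> bool"
  where "boolean_locale L \<longleftrightarrow> frame L \<and>
     (\<forall>U \<in> carrier L. \<exists>V \<in> carrier L. U \<sqinter>\<^bsub>L\<^esub> V = \<bottom>\<^bsub>L\<^esub> \<and> U \<squnion>\<^bsub>L\<^esub> V = \<top>\<^bsub>L\<^esub>)"

definition directed_in :: "'a gorder \<Rightarrow> 'a set \<Rightarrow> bool"
  where "directed_in L D \<longleftrightarrow> D \<subseteq> carrier L \<and> D \<noteq> {} \<and>
     (\<forall>U \<in> D. \<forall>V \<in> D. \<exists>W \<in> D. U \<sqsubseteq>\<^bsub>L\<^esub> W \<and> V \<sqsubseteq>\<^bsub>L\<^esub> W)"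

definition locale_measure :: "'a gorder \<Rightarrow> ('a \<Rightarrow> ennreal) \<Rightarrow> bool"
  where "locale_measure L \<nu> \<longleftrightarrow>
     (\<forall>U \<in> carrier L. \<forall>V \<in> carrier L. U \<sqsubseteq>\<^bsub>L\<^esub> V \<longrightarrow> \<nu> U \<le> \<nu> V) \<and>
     \<nu> \<bottom>\<^bsub>L\<^esub> = 0 \<and>
     (\<forall>U \<in> carrier L. \<forall>V \<in> carrier L. \<nu> U + \<nu> V = \<nu> (U \<squnion>\<^bsub>L\<^esub> V) + \<nu> (U \<sqinter>\<^bsub>L\<^esub> V)) \<and>
     (\<forall>D. directed_in L D \<longrightarrow> \<nu> (\<Squnion>\<^bsub>L\<^esub>D) = (SUP U\<in>D. \<nu> U))"

definition locally_finite_measure :: "'a gorder \<Rightarrow> ('a \<Rightarrow> ennreal) \<Rightarrow> bool"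
  where "locally_finite_measure L \<nu> \<longleftrightarrow>
     \<top>\<^bsub>L\<^esub> = \<Squnion>\<^bsub>L\<^esub>{U \<in> carrier L. \<nu> U < \<infinity>}"

definition faithful_measure :: "'a gorder \<Rightarrow> ('a \<Rightarrow> ennreal) \<Rightarrow> bool"
  where "faithful_measure L \<nu> \<longleftrightarrow>
     (\<forall>U \<in> carrier L. \<forall>V \<in> carrier L. U \<sqsubseteq>\<^bsub>L\<^esub> V \<longrightarrow>
        (\<forall>K \<in> carrier L. \<nu> K < \<infinity> \<longrightarrow> \<nu> (U \<sqinter>\<^bsub>L\<^esub> K) = \<nu> (V \<sqinter>\<^bsub>L\<^esub> K)) \<longrightarrow> U = V)"

definition measurable_locale :: "'a gorder \<Rightarrow> bool"
  where "measurable_locale L \<longleftrightarrow> boolean_locale L \<and>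
     (\<exists>\<nu>. locale_measure L \<nu> \<and> locally_finite_measure L \<nu> \<and> faithful_measure L \<nu>)"

definition MblLoc :: "('a gorder, 'a \<Rightarrow> 'a) category"
  where "MblLoc = full_subcategory Loc measurable_locale"

definition heyting_imp :: "'a gorder \<Rightarrow> 'a \<Rightarrow> 'a \<Rightarrow> 'a"
  where "heyting_imp L U N = (THE X. X \<in> carrier L \<and>
     (\<forall>W \<in> carrier L. W \<sqsubseteq>\<^bsub>L\<^esub> X \<longleftrightarrow> W \<sqinter>\<^bsub>L\<^esub> U \<sqsubseteq>\<^bsub>L\<^esub> N))"

definition b_sublocale :: "'a gorder \<Rightarrow> 'a \<Rightarrow> 'a gorder"
  where "b_sublocale L N = L\<lparr>carrier := (\<lambda>U. heyting_imp L U N) ` carrier L\<rparr>"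


section \<open>Smooth maps between open subsets of Euclidean spaces\<close>

text \<open>
  The dimension of a manifold varies over the objects of a single category, so it cannot be a
  type. A point of \<open>\<real>\<^sup>n\<close> is a function on \<open>{..<n}\<close>, extended by \<^const>\<open>undefined\<close>; this is the
  common carrier of the product topology and of the product measure.
\<close>

definition Rn :: "nat \<Rightarrow> (nat \<Rightarrow> real) topology"
  where "Rn n = product_topology (\<lambda>_. euclideanreal) {..<n}"

definition lebesgue_Rn :: "nat \<Rightarrow> (nat \<Rightarrow> real) measure"
  where "lebesgue_Rn n = completion (Pi\<^sub>M {..<n} (\<lambda>_. lborel))"

definition partial_deriv :: "nat \<Rightarrow> ((nat \<Rightarrow> real) \<Rightarrow> real) \<Rightarrow> (nat \<Rightarrow> real) \<Rightarrow> real"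
  where "partial_deriv j g x = deriv (\<lambda>t. g (x(j := t))) (x j)"

text \<open>\<open>Ck_on k n S g\<close>, for \<open>S\<close> open in \<open>\<real>\<^sup>n\<close>: all iterated partial derivatives of \<open>g\<close> of order
  at most \<open>k\<close> exist and are continuous on \<open>S\<close>.\<close>

primrec Ck_on :: "nat \<Rightarrow> nat \<Rightarrow> (nat \<Rightarrow> real) set \<Rightarrow> ((nat \<Rightarrow> real) \<Rightarrow> real) \<Rightarrow> bool" where
  "Ck_on 0 n S g \<longleftrightarrow> continuous_map (subtopology (Rn n) S) euclideanreal g"
| "Ck_on (Suc k) n S g \<longleftrightarrow> continuous_map (subtopology (Rn n) S) euclideanreal g \<and>
     (\<forall>j<n. (\<forall>x\<in>S. (\<lambda>t. g (x(j := t))) field_differentiable (at (x j))) \<and>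
            Ck_on k n S (partial_deriv j g))"

definition smooth_on :: "nat \<Rightarrow> nat \<Rightarrow> (nat \<Rightarrow> real) set \<Rightarrow> ((nat \<Rightarrow> real) \<Rightarrow> (nat \<Rightarrow> real)) \<Rightarrow> bool"
  where "smooth_on n m S g \<longleftrightarrow> (\<forall>i<m. \<forall>k. Ck_on k n S (\<lambda>x. g x i))"

definition differential_at ::
    "nat \<Rightarrow> nat \<Rightarrow> ((nat \<Rightarrow> real) \<Rightarrow> (nat \<Rightarrow> real)) \<Rightarrow> (nat \<Rightarrow> real) \<Rightarrow> (nat \<Rightarrow> real) \<Rightarrow> (nat \<Rightarrow> real)"
  where "differential_at n m g x v =
     (\<lambda>i\<in>{..<m}. \<Sum>j<n. partial_deriv j (\<lambda>y. g y i) x * v j)"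


section \<open>Large smooth manifolds and submersions\<close>

text \<open>A chart is a pair of its domain and its coordinate map; the values of the coordinate map
  outside the domain are irrelevant.\<close>

record 'a manifold =
  mdim :: nat
  mtop :: "'a topology"
  mcharts :: "('a set \<times> ('a \<Rightarrow> nat \<Rightarrow> real)) set"

definition large_smooth_manifold :: "'a manifold \<Rightarrow> bool"
  where "large_smooth_manifold M \<longleftrightarrow>
     Hausdorff_space (mtop M) \<and>
     (\<forall>(U, \<phi>) \<in> mcharts M. openin (mtop M) U \<and> openin (Rn (mdim M)) (\<phi> ` U) \<and>
        homeomorphic_map (subtopology (mtop M) U) (subtopology (Rn (mdim M)) (\<phi> ` U)) \<phi>) \<and>
     \<Union> (fst ` mcharts M) = topspace (mtop M) \<and>
     (\<forall>(U, \<phi>) \<in> mcharts M. \<forall>(V, \<psi>) \<in> mcharts M.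
        smooth_on (mdim M) (mdim M) (\<phi> ` (U \<inter> V)) (\<psi> \<circ> inv_into U \<phi>))"

definition smooth_map :: "'a manifold \<Rightarrow> 'b manifold \<Rightarrow> ('a \<Rightarrow> 'b) \<Rightarrow> bool"
  where "smooth_map M M' f \<longleftrightarrow>
     continuous_map (mtop M) (mtop M') f \<and>
     (\<forall>(U, \<phi>) \<in> mcharts M. \<forall>(V, \<psi>) \<in> mcharts M'.
        smooth_on (mdim M) (mdim M') (\<phi> ` (U \<inter> f -` V)) (\<psi> \<circ> f \<circ> inv_into U \<phi>))"

definition submersion :: "'a manifold \<Rightarrow> 'b manifold \<Rightarrow> ('a \<Rightarrow> 'b) \<Rightarrow> bool"
  where "submersion M M' f \<longleftrightarrow>
     smooth_map M M' f \<and>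
     (\<forall>(U, \<phi>) \<in> mcharts M. \<forall>(V, \<psi>) \<in> mcharts M'. \<forall>p \<in> U \<inter> f -` V.
        differential_at (mdim M) (mdim M') (\<psi> \<circ> f \<circ> inv_into U \<phi>) (\<phi> p)
          ` topspace (Rn (mdim M)) = topspace (Rn (mdim M')))"

definition Man_subm :: "('a manifold, 'a \<Rightarrow> 'a) category"
  where "Man_subm = \<lparr>
     Ob = {M. large_smooth_manifold M},
     Hom = (\<lambda>M M'. {f \<in> topspace (mtop M) \<rightarrow>\<^sub>E topspace (mtop M'). submersion M M' f}),
     Idm = (\<lambda>M. \<lambda>x\<in>topspace (mtop M). x),
     Comp = (\<lambda>M M' M'' g f. compose (topspace (mtop M)) g f)\<rparr>"


section \<open>The Lebesgue locale\<close>

definition compacts :: "'a topology \<Rightarrow> 'a set set"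
  where "compacts X = {K. compactin X K}"

definition compact_ideals :: "'a topology \<Rightarrow> 'a set set set"
  where "compact_ideals X = {I. I \<subseteq> compacts X \<and> {} \<in> I \<and>
     (\<forall>K \<in> I. \<forall>K' \<in> compacts X. K' \<subseteq> K \<longrightarrow> K' \<in> I) \<and>
     (\<forall>K \<in> I. \<forall>K' \<in> I. K \<union> K' \<in> I)}"

definition compact_locale :: "'a topology \<Rightarrow> 'a set set gorder"
  where "compact_locale X = \<lparr>carrier = compact_ideals X, eq = (=), le = (\<subseteq>)\<rparr>"

definition compact_null :: "'a manifold \<Rightarrow> 'a set \<Rightarrow> bool"
  where "compact_null M K \<longleftrightarrow> compactin (mtop M) K \<and>
     (\<exists>P. finite P \<and>
        (\<forall>((U, \<phi>), C) \<in> P. (U, \<phi>) \<in> mcharts M \<and> compactin (mtop M) C \<and> C \<subseteq> U \<and>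
           \<phi> ` C \<in> null_sets (lebesgue_Rn (mdim M))) \<and>
        K = \<Union> (snd ` P))"

definition null_ideal :: "'a manifold \<Rightarrow> 'a set set"
  where "null_ideal M = {K. compact_null M K}"

definition lebesgue_locale :: "'a manifold \<Rightarrow> 'a set set gorder"
  where "lebesgue_locale M = b_sublocale (compact_locale (mtop M)) (null_ideal M)"

end

theory Submission
  imports Defs
begin

text \<open>
  The functor exists because, for the ideal \<open>N\<close> of compact null sets, passing from an ideal of
  compact sets to its closure in \<open>b(N)\<close> amounts to a countable exhaustion in measure, and
  submersions respect such exhaustions.

  For a Hausdorff space, \<open>U \<rightarrow> N\<close> is the set \<open>perp U\<close> of the compact sets that meet every member of
  \<open>U\<close> in a member of \<open>N\<close>. So the opens of \<open>b(N)\<close> are the fixed points of the double \<open>perp\<close> of the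
  symmetric relation \<open>K \<inter> K' \<in> N\<close>, and that they form a Boolean frame is formal: meets are
  intersections, joins are double \<open>perp\<close>s of unions, complements are \<open>perp\<close>s.

  What a manifold contributes is \<open>exhaustion\<close>: if a compact set \<open>D\<close> inside a chart belongs to
  the double \<open>perp\<close> of an ideal \<open>I\<close>, then countably many members of \<open>I\<close> cover \<open>D\<close> up to a null set.
  Choose members of \<open>I\<close> inside \<open>D\<close> whose volumes approach the largest possible value. If the
  remainder had positive measure, it would contain a compact set \<open>Q\<close> of positive measure; by
  maximality \<open>Q\<close> meets every member of \<open>I\<close> in a null set, so \<open>Q \<in> perp I\<close>, and then
  \<open>Q = D \<inter> Q\<close> is null after all. This has two consequences.

  First, for a compact set \<open>C\<close> inside a chart, the supremum over \<open>K \<in> I\<close> of the volume of \<open>K \<inter> C\<close>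
  does not change when \<open>I\<close> is replaced by its double \<open>perp\<close>. Hence it defines a measure on the
  Lebesgue locale (\<open>locale_measure_of_content\<close>), and the sum of these measures over a maximal family
  of almost disjoint sets \<open>C\<close> is locally finite and faithful (\<open>measurable_of_local_contents\<close>).

  Second, let \<open>f\<close> be a submersion, and suppose that \<open>f(S)\<close> lies in the double \<open>perp\<close> of the ideal of
  those \<open>T\<close> for which \<open>S \<inter> f\<inverse>(T)\<close> is null. Exhausting \<open>f(S)\<close> by such \<open>T\<close> leaves a null set, whose
  preimage is null, so \<open>S\<close> is null (\<open>null_of_null_preimages\<close>). This says that the frame
  homomorphism sending an ideal \<open>J\<close> to the ideal of those \<open>K\<close> with \<open>f(K) \<in> J\<close> is compatible with double
  \<open>perp\<close>s, so it descends to the Lebesgue locales, functorially in \<open>f\<close>.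

  The analytic input is that preimages of null sets under submersions are null
  (\<open>null_preimage_submersion\<close>). Let \<open>B\<close> be a right inverse of the differential of \<open>g\<close> at a point.
  Near it, each map \<open>v \<mapsto> g(x + B v)\<close> is close to the identity, so it shrinks distances by at most a
  factor of two, and comparing dyadic cells shows that it pulls null sets back to null sets. By Fubini
  there is a single small \<open>v\<close> for which the set of all \<open>x\<close> with \<open>g(x + B v) \<in> E\<close> is null, and
  translating by \<open>B v\<close> finishes the argument. Applied to coordinate changes, the same statement shows
  that nullity of a compact set can be tested in any chart.
\<close>


section \<open>Calculus in the model of Euclidean space\<close>

definition cube :: "nat \<Rightarrow> (nat \<Rightarrow> real) \<Rightarrow> real \<Rightarrow> (nat \<Rightarrow> real) set"
  where "cube n p d = {x \<in> topspace (Rn n). \<forall>i<n. \<bar>x i - p i\<bar> < d}"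

lemma topspace_Rn: "topspace (Rn n) = extensional {..<n}"
  by (auto simp: Rn_def PiE_def extensional_def)

lemma cube_eq_PiE: "cube n p d = PiE {..<n} (\<lambda>i. ball (p i) d)"
  by (auto simp: cube_def topspace_Rn PiE_def dist_real_def abs_minus_commute)

lemma openin_cube: "openin (Rn n) (cube n p d)"
  unfolding cube_eq_PiE Rn_def by (subst openin_PiE_gen) auto

lemma open_Rn_subset: "openin (Rn n) S \<Longrightarrow> x \<in> S \<Longrightarrow> x \<in> topspace (Rn n)"
  using openin_subset by blast

lemma cube_mono: "d \<le> e \<Longrightarrow> cube n p d \<subseteq> cube n p e"
  by (force simp: cube_def)

lemma centre_in_cube: "p \<in> topspace (Rn n) \<Longrightarrow> d > 0 \<Longrightarrow> p \<in> cube n p d"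
  by (auto simp: cube_def)

lemma cube_upd: "x \<in> cube n p d \<Longrightarrow> j < n \<Longrightarrow> \<bar>t - p j\<bar> < d \<Longrightarrow> x(j := t) \<in> cube n p d"
  by (auto simp: cube_def topspace_Rn extensional_def)

lemma open_Rn_contains_cube:
  assumes "openin (Rn n) S" "p \<in> S"
  obtains d where "d > 0" "cube n p d \<subseteq> S"
proof -
  have "\<exists>U. (\<forall>i\<in>{..<n}. open (U i)) \<and> p \<in> PiE {..<n} U \<and> PiE {..<n} U \<subseteq> S"
    using assms by (simp add: Rn_def openin_product_topology_alt)
  then obtain U where U: "\<And>i. i < n \<Longrightarrow> open (U i)" "p \<in> PiE {..<n} U" "PiE {..<n} U \<subseteq> S"
    by (metis lessThan_iff)
  have "\<exists>d>0. ball (p i) d \<subseteq> U i" if "i < n" for i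
  proof -
    have "p i \<in> U i" using U(2) that by auto
    then show ?thesis using U(1)[OF that] open_contains_ball_eq by blast
  qed
  then obtain r where r: "\<And>i. i < n \<Longrightarrow> r i > 0 \<and> ball (p i) (r i) \<subseteq> U i" by metis
  define d where "d = Min (insert 1 (r ` {..<n}))"
  have d: "d > 0" "\<And>i. i < n \<Longrightarrow> d \<le> r i"
    using r unfolding d_def by (auto simp: Min_gr_iff intro: Min_le)
  have "cube n p d \<subseteq> PiE {..<n} U"
    unfolding cube_eq_PiE
  proof (rule PiE_mono)
    fix i assume "i \<in> {..<n}"
    then show "ball (p i) d \<subseteq> U i" using d(2)[of i] r[of i] by force
  qed
  then show ?thesis using that d(1) U(3) by blast
qed

text \<open>Cubes form a neighbourhood basis of the product topology because the index set is finite. This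
  epsilon-delta form of continuity makes it plainly local.\<close>

lemma continuous_map_Rn_real_iff:
  assumes S: "openin (Rn n) S"
  shows "continuous_map (subtopology (Rn n) S) euclideanreal g \<longleftrightarrow>
    (\<forall>p\<in>S. \<forall>e>0. \<exists>d>0. cube n p d \<subseteq> S \<and> (\<forall>x\<in>cube n p d. \<bar>g x - g p\<bar> < e))"
proof
  assume L: "continuous_map (subtopology (Rn n) S) euclideanreal g"
  show "\<forall>p\<in>S. \<forall>e>0. \<exists>d>0. cube n p d \<subseteq> S \<and> (\<forall>x\<in>cube n p d. \<bar>g x - g p\<bar> < e)"
  proof (intro ballI allI impI)
    fix p and e :: real assume p: "p \<in> S" and e: "e > 0"
    let ?V = "{x \<in> topspace (subtopology (Rn n) S). g x \<in> ball (g p) e}"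
    have "openin (subtopology (Rn n) S) ?V"
      by (rule openin_continuous_map_preimage[OF L]) auto
    then have "openin (Rn n) ?V" using S openin_open_subtopology by blast
    moreover have "p \<in> ?V" using p e S openin_subset by fastforce
    ultimately obtain d where "d > 0" "cube n p d \<subseteq> ?V" by (rule open_Rn_contains_cube)
    then show "\<exists>d>0. cube n p d \<subseteq> S \<and> (\<forall>x\<in>cube n p d. \<bar>g x - g p\<bar> < e)"
      by (intro exI[of _ d]) (auto simp: dist_real_def abs_minus_commute)
  qed
next
  assume R: "\<forall>p\<in>S. \<forall>e>0. \<exists>d>0. cube n p d \<subseteq> S \<and> (\<forall>x\<in>cube n p d. \<bar>g x - g p\<bar> < e)"
  have "openin (subtopology (Rn n) S) {x \<in> topspace (subtopology (Rn n) S). g x \<in> U}" if "open U" for U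
  proof -
    have ts: "topspace (subtopology (Rn n) S) = S" using S openin_subset by fastforce
    have "openin (Rn n) {x \<in> S. g x \<in> U}"
    proof (subst openin_subopen, intro ballI)
      fix p assume p: "p \<in> {x \<in> S. g x \<in> U}"
      then obtain e where e: "e > 0" "ball (g p) e \<subseteq> U" using \<open>open U\<close> open_contains_ball_eq by blast
      then obtain d where d: "d > 0" "cube n p d \<subseteq> S" "\<forall>x\<in>cube n p d. \<bar>g x - g p\<bar> < e"
        using R p by blast
      have "p \<in> cube n p d" using p d open_Rn_subset[OF S] by (intro centre_in_cube) auto
      moreover have "cube n p d \<subseteq> {x \<in> S. g x \<in> U}"
        using d e by (auto simp: subset_iff dist_real_def abs_minus_commute)
      ultimately show "\<exists>T. openin (Rn n) T \<and> p \<in> T \<and> T \<subseteq> {x \<in> S. g x \<in> U}"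
        using openin_cube by blast
    qed
    then show ?thesis unfolding ts using S openin_open_subtopology by blast
  qed
  then show "continuous_map (subtopology (Rn n) S) euclideanreal g"
    by (auto simp: continuous_map_def)
qed

lemma eventually_upd_mem:
  assumes "openin (Rn n) S" "x \<in> S" "j < n"
  shows "\<forall>\<^sub>F t in nhds (x j). x(j := t) \<in> S"
proof -
  obtain d where d: "d > 0" "cube n x d \<subseteq> S" using open_Rn_contains_cube assms by blast
  have "x \<in> cube n x d" using d open_Rn_subset[OF assms(1,2)] by (intro centre_in_cube)
  then have "x(j := t) \<in> S" if "t \<in> ball (x j) d" for t
    using that cube_upd[of x n x d j t] d assms by (auto simp: dist_real_def abs_minus_commute)
  then show ?thesis
    using d(1) by (auto simp: eventually_nhds intro!: exI[of _ "ball (x j) d"])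
qed

lemma Ck_on_continuous: "Ck_on k n S g \<Longrightarrow> continuous_map (subtopology (Rn n) S) euclideanreal g"
  by (cases k) auto

lemma Ck_on_Suc_D: "Ck_on (Suc k) n S g \<Longrightarrow> Ck_on k n S g"
  by (induction k arbitrary: g) auto

lemma Ck_on_subset: "Ck_on k n S g \<Longrightarrow> T \<subseteq> S \<Longrightarrow> Ck_on k n T g"
  by (induction k arbitrary: g) (auto intro: continuous_map_from_subtopology_mono)

lemma partial_deriv_cong:
  assumes "openin (Rn n) S" "\<And>x. x \<in> S \<Longrightarrow> g x = h x" "x \<in> S" "j < n"
  shows "partial_deriv j g x = partial_deriv j h x"
proof -
  have "\<forall>\<^sub>F t in nhds (x j). g (x(j := t)) = h (x(j := t))"
    using eventually_upd_mem[OF assms(1,3,4)] by eventually_elim (rule assms)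
  then show ?thesis unfolding partial_deriv_def by (rule deriv_cong_ev) simp
qed

lemma Ck_on_cong:
  assumes "openin (Rn n) S" "\<And>x. x \<in> S \<Longrightarrow> g x = h x" "Ck_on k n S g"
  shows "Ck_on k n S h"
  using assms(2,3)
proof (induction k arbitrary: g h)
  case 0
  then show ?case by (auto elim!: continuous_map_eq)
next
  case (Suc k)
  have "(\<lambda>t. h (x(j := t))) field_differentiable at (x j)" if "j < n" "x \<in> S" for j x
  proof -
    have "(\<lambda>t. g (x(j := t))) field_differentiable at (x j)" using Suc.prems that by auto
    moreover have "\<forall>\<^sub>F t in nhds (x j). g (x(j := t)) = h (x(j := t))"
      using eventually_upd_mem[OF assms(1) that(2,1)] by eventually_elim (rule Suc.prems)
    ultimately show ?thesis
      using DERIV_cong_ev[of "x j" "x j" "\<lambda>t. g (x(j := t))" "\<lambda>t. h (x(j := t))"]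
      unfolding field_differentiable_def by blast
  qed
  moreover have "Ck_on k n S (partial_deriv j h)" if "j < n" for j
    using Suc.IH[of "partial_deriv j g" "partial_deriv j h"] partial_deriv_cong[OF assms(1) Suc.prems(1)]
      Suc.prems(2) that by auto
  moreover have "continuous_map (subtopology (Rn n) S) euclideanreal h"
    using Suc.prems by (auto elim!: continuous_map_eq)
  ultimately show ?case by simp
qed

lemma Ck_on_locally:
  assumes "openin (Rn n) S" "\<And>p. p \<in> S \<Longrightarrow> \<exists>T. openin (Rn n) T \<and> p \<in> T \<and> T \<subseteq> S \<and> Ck_on k n T g"
  shows "Ck_on k n S g"
  using assms(2)
proof (induction k arbitrary: g)
  case (0 g)
  show ?case
    unfolding Ck_on.simps continuous_map_Rn_real_iff[OF assms(1)]
  proof (intro ballI allI impI)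
    fix p and e :: real assume p: "p \<in> S" and e: "e > 0"
    obtain T where T: "openin (Rn n) T" "p \<in> T" "T \<subseteq> S" "continuous_map (subtopology (Rn n) T) euclideanreal g"
      using 0[OF p] by auto
    then obtain d where "d > 0" "cube n p d \<subseteq> T" "\<forall>x\<in>cube n p d. \<bar>g x - g p\<bar> < e"
      using continuous_map_Rn_real_iff[OF T(1), of g] e by blast
    then show "\<exists>d>0. cube n p d \<subseteq> S \<and> (\<forall>x\<in>cube n p d. \<bar>g x - g p\<bar> < e)" using T(3) by blast
  qed
next
  case (Suc k)
  have "Ck_on k n S g"
  proof (rule Suc.IH)
    fix p assume "p \<in> S"
    from Suc.prems[OF this] obtain T where "openin (Rn n) T" "p \<in> T" "T \<subseteq> S" "Ck_on (Suc k) n T g" by blast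
    then show "\<exists>T. openin (Rn n) T \<and> p \<in> T \<and> T \<subseteq> S \<and> Ck_on k n T g"
      using Ck_on_Suc_D[of k n T g] by (intro exI[of _ T]) simp
  qed
  then have "continuous_map (subtopology (Rn n) S) euclideanreal g" by (rule Ck_on_continuous)
  moreover have "(\<lambda>t. g (x(j := t))) field_differentiable at (x j)" if "j < n" "x \<in> S" for j x
    using Suc.prems[OF that(2)] that(1) by auto
  moreover have "Ck_on k n S (partial_deriv j g)" if "j < n" for j
  proof (rule Suc.IH)
    fix p assume "p \<in> S"
    from Suc.prems[OF this] obtain T where "openin (Rn n) T" "p \<in> T" "T \<subseteq> S" "Ck_on (Suc k) n T g" by blast
    then show "\<exists>T. openin (Rn n) T \<and> p \<in> T \<and> T \<subseteq> S \<and> Ck_on k n T (partial_deriv j g)"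
      using that by (intro exI[of _ T]) simp
  qed
  ultimately show ?case by simp
qed

lemma has_partial_deriv:
  assumes "Ck_on (Suc k) n S g" "x \<in> S" "j < n"
  shows "((\<lambda>t. g (x(j := t))) has_real_derivative partial_deriv j g x) (at (x j))"
  using assms unfolding partial_deriv_def by (simp add: DERIV_deriv_iff_field_differentiable)

lemma Ck_on_const: "Ck_on k n S (\<lambda>x. c)"
proof (induction k arbitrary: c)
  case (Suc k)
  have "partial_deriv j (\<lambda>x. c) = (\<lambda>x. 0)" for j by (auto simp: partial_deriv_def fun_eq_iff)
  then show ?case using Suc by simp
qed simp

lemma Ck_on_add:
  assumes "openin (Rn n) S" "Ck_on k n S g" "Ck_on k n S h"
  shows "Ck_on k n S (\<lambda>x. g x + h x)"
  using assms(2,3)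
proof (induction k arbitrary: g h)
  case (Suc k)
  have pd: "partial_deriv j (\<lambda>x. g x + h x) x = partial_deriv j g x + partial_deriv j h x"
    if "x \<in> S" "j < n" for x j
    using DERIV_add[OF has_partial_deriv[OF Suc.prems(1) that] has_partial_deriv[OF Suc.prems(2) that]]
    by (subst partial_deriv_def) (rule DERIV_imp_deriv)
  have "Ck_on k n S (partial_deriv j (\<lambda>x. g x + h x))" if "j < n" for j
    by (rule Ck_on_cong[OF assms(1) _ Suc.IH[of "partial_deriv j g" "partial_deriv j h"]])
      (use pd that Suc.prems in auto)
  then show ?case
    using Suc.prems by (auto intro!: continuous_map_add field_differentiable_add)
qed (auto intro: continuous_map_add)

lemma Ck_on_mult:
  assumes "openin (Rn n) S" "Ck_on k n S g" "Ck_on k n S h"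
  shows "Ck_on k n S (\<lambda>x. g x * h x)"
  using assms(2,3)
proof (induction k arbitrary: g h)
  case (Suc k)
  have pd: "partial_deriv j (\<lambda>x. g x * h x) x = partial_deriv j g x * h x + partial_deriv j h x * g x"
    if "x \<in> S" "j < n" for x j
    using DERIV_mult[OF has_partial_deriv[OF Suc.prems(1) that] has_partial_deriv[OF Suc.prems(2) that]]
    by (subst partial_deriv_def) (rule DERIV_imp_deriv, simp only: fun_upd_triv)
  have "Ck_on k n S (partial_deriv j (\<lambda>x. g x * h x))" if "j < n" for j
    by (rule Ck_on_cong[OF assms(1) _ Ck_on_add[OF assms(1)
          Suc.IH[of "partial_deriv j g" h] Suc.IH[of "partial_deriv j h" g]]])
      (use pd that Suc.prems Ck_on_Suc_D in auto)
  then show ?case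
    using Suc.prems by (auto intro!: continuous_map_real_mult field_differentiable_mult)
qed (auto intro: continuous_map_real_mult)

lemma Ck_on_sum:
  assumes "openin (Rn n) S" "finite I" "\<And>i. i \<in> I \<Longrightarrow> Ck_on k n S (g i)"
  shows "Ck_on k n S (\<lambda>x. \<Sum>i\<in>I. g i x)"
  using assms(2,3)
  by (induction I) (auto simp: Ck_on_const intro!: Ck_on_add[OF assms(1)])

text \<open>Only one coordinate moves here, so this is the mean value theorem for a function of one variable;
  the intermediate point stays in the cube because cubes are convex.\<close>

lemma mean_value_one_variable:
  assumes g: "Ck_on (Suc k) n S g" and S: "cube n p d \<subseteq> S"
    and u: "u \<in> cube n p d" and j: "j < n" and t: "\<bar>t - p j\<bar> < d"
  obtains s where "s \<in> closed_segment (u j) t" "u(j := s) \<in> cube n p d"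
    "g (u(j := t)) - g u = partial_deriv j g (u(j := s)) * (t - u j)"
proof -
  have uj: "\<bar>u j - p j\<bar> < d" using u j by (auto simp: cube_def)
  have seg: "\<bar>s - p j\<bar> < d" if "s \<in> closed_segment (u j) t" for s
    using that uj t by (auto simp: closed_segment_eq_real_ivl split: if_splits)
  have mem: "u(j := s) \<in> cube n p d" if "s \<in> closed_segment (u j) t" for s
    using cube_upd[OF u j seg[OF that]] .
  have D: "((\<lambda>r. g (u(j := r))) has_real_derivative partial_deriv j g (u(j := s))) (at s)"
    if "s \<in> closed_segment (u j) t" for s
    using has_partial_deriv[OF g _ j, of "u(j := s)"] mem[OF that] S by auto
  consider "u j < t" | "t < u j" | "t = u j" by linarith
  then show ?thesis
  proof cases
    case 1
    then obtain s where "u j < s" "s < t" "g (u(j := t)) - g (u(j := u j)) = (t - u j) * partial_deriv j g (u(j := s))"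
      using MVT2[of "u j" t "\<lambda>r. g (u(j := r))" "\<lambda>s. partial_deriv j g (u(j := s))"] D
      by (auto simp: closed_segment_eq_real_ivl)
    then show ?thesis using that[of s] mem[of s] 1 by (auto simp: closed_segment_eq_real_ivl)
  next
    case 2
    then obtain s where "t < s" "s < u j" "g (u(j := u j)) - g (u(j := t)) = (u j - t) * partial_deriv j g (u(j := s))"
      using MVT2[of t "u j" "\<lambda>r. g (u(j := r))" "\<lambda>s. partial_deriv j g (u(j := s))"] D
      by (auto simp: closed_segment_eq_real_ivl)
    then show ?thesis using that[of s] mem[of s] 2 by (auto simp: closed_segment_eq_real_ivl algebra_simps)
  next
    case 3
    then show ?thesis using that[of t] u by (simp add: fun_upd_idem)
  qed
qed

text \<open>Move from \<open>x\<close> to \<open>y\<close> one coordinate at a time and telescope. Each intermediate point is located coordinatewise between \<open>x\<close> and \<open>y\<close>,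
  which lets the partial derivatives at it be controlled by continuity.\<close>

lemma mean_value:
  assumes g: "Ck_on (Suc k) n S g" and S: "cube n p d \<subseteq> S"
    and x: "x \<in> cube n p d" and y: "y \<in> cube n p d"
  obtains \<xi> where "\<And>j. j < n \<Longrightarrow> \<xi> j \<in> cube n p d"
    "\<And>i j. j < n \<Longrightarrow> i < n \<Longrightarrow> \<xi> j i \<in> closed_segment (x i) (y i)"
    "g y - g x = (\<Sum>j<n. partial_deriv j g (\<xi> j) * (y j - x j))"
proof -
  \<comment> \<open>the point after the first \<open>k\<close> coordinates have been moved\<close>
  define z where "z k = (\<lambda>i. if i < k then y i else x i)" for k :: nat
  have z0: "z 0 = x" by (auto simp: z_def)
  have zn: "z n = y" using x y by (auto simp: z_def cube_def topspace_Rn extensional_def fun_eq_iff)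
  have zS: "z (Suc k) = (z k)(k := y k)" for k by (auto simp: z_def fun_eq_iff less_Suc_eq)
  have zc: "z k \<in> cube n p d" if "k \<le> n" for k
    using x y that by (auto simp: z_def cube_def topspace_Rn extensional_def)
  have "\<exists>s. s \<in> closed_segment (x j) (y j) \<and> (z j)(j := s) \<in> cube n p d \<and>
      g (z (Suc j)) - g (z j) = partial_deriv j g ((z j)(j := s)) * (y j - x j)" if j: "j < n" for j
  proof -
    have "\<bar>y j - p j\<bar> < d" using y j by (auto simp: cube_def)
    from mean_value_one_variable[OF g S zc j this] j
    obtain s where "s \<in> closed_segment (z j j) (y j)" "(z j)(j := s) \<in> cube n p d"
      "g ((z j)(j := y j)) - g (z j) = partial_deriv j g ((z j)(j := s)) * (y j - z j j)"
      by (metis less_imp_le)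
    then show ?thesis by (auto simp: zS) (auto simp: z_def)
  qed
  then obtain s where s: "\<And>j. j < n \<Longrightarrow> s j \<in> closed_segment (x j) (y j)"
    "\<And>j. j < n \<Longrightarrow> (z j)(j := s j) \<in> cube n p d"
    "\<And>j. j < n \<Longrightarrow> g (z (Suc j)) - g (z j) = partial_deriv j g ((z j)(j := s j)) * (y j - x j)"
    by metis
  show ?thesis
  proof (rule that[of "\<lambda>j. (z j)(j := s j)"])
    show "((z j)(j := s j)) i \<in> closed_segment (x i) (y i)" if "j < n" "i < n" for i j
      using s(1)[of j] that by (auto simp: z_def)
    have "g y - g x = (\<Sum>j<n. g (z (Suc j)) - g (z j))"
      using sum_lessThan_telescope[of "\<lambda>j. g (z j)" n] by (simp add: z0 zn)
    also have "\<dots> = (\<Sum>j<n. partial_deriv j g ((z j)(j := s j)) * (y j - x j))"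
      using s(3) by (intro sum.cong) auto
    finally show "g y - g x = (\<Sum>j<n. partial_deriv j g ((z j)(j := s j)) * (y j - x j))" .
  qed (use s(2) in auto)
qed

text \<open>By the mean value formula, the difference quotient of \<open>g \<circ> c\<close> is a sum of products of partial
  derivatives of \<open>g\<close> at points squeezed towards \<open>c t0\<close> and difference quotients of the components of \<open>c\<close>.\<close>

lemma chain_rule_along_curve:
  assumes T: "openin (Rn m) T" and g: "Ck_on (Suc 0) m T g" and c0: "c t0 \<in> T"
    and c: "\<And>i. i < m \<Longrightarrow> ((\<lambda>t. c t i) has_real_derivative c' i) (at t0)"
    and cT: "\<forall>\<^sub>F t in at t0. c t \<in> T"
  shows "((\<lambda>t. g (c t)) has_real_derivative (\<Sum>i<m. partial_deriv i g (c t0) * c' i)) (at t0)"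
proof -
  obtain d where d: "d > 0" "cube m (c t0) d \<subseteq> T" using open_Rn_contains_cube[OF T c0] .
  have cont: "((\<lambda>t. c t i) \<longlongrightarrow> c t0 i) (at t0)" if "i < m" for i
    using DERIV_isCont[OF c[OF that]] by (simp add: isCont_def)
  have near: "\<forall>\<^sub>F t in at t0. c t \<in> cube m (c t0) e" if "e > 0" for e
  proof -
    have "\<forall>\<^sub>F t in at t0. \<forall>i\<in>{..<m}. \<bar>c t i - c t0 i\<bar> < e"
      using tendstoD[OF cont that] by (intro eventually_ball_finite) (auto simp: dist_real_def)
    then show ?thesis using cT
      by eventually_elim (use open_Rn_subset[OF T] in \<open>auto simp: cube_def\<close>)
  qed
  have c0d: "c t0 \<in> cube m (c t0) d" using d(1) open_Rn_subset[OF T c0] by (intro centre_in_cube)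
  define P where "P t \<xi> \<longleftrightarrow> (\<forall>j<m. \<forall>i<m. \<xi> j i \<in> closed_segment (c t0 i) (c t i)) \<and> (\<forall>j<m. \<xi> j \<in> topspace (Rn m)) \<and>
    g (c t) - g (c t0) = (\<Sum>j<m. partial_deriv j g (\<xi> j) * (c t j - c t0 j))" for t \<xi>
  have ex: "\<exists>\<xi>. P t \<xi>" if ct: "c t \<in> cube m (c t0) d" for t
  proof -
    obtain \<xi> where "\<And>j. j < m \<Longrightarrow> \<xi> j \<in> cube m (c t0) d"
      "\<And>i j. j < m \<Longrightarrow> i < m \<Longrightarrow> \<xi> j i \<in> closed_segment (c t0 i) (c t i)"
      "g (c t) - g (c t0) = (\<Sum>j<m. partial_deriv j g (\<xi> j) * (c t j - c t0 j))"
      using mean_value[OF g d(2) c0d ct] by blast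
    then show ?thesis unfolding P_def by (intro exI[of _ \<xi>]) (auto simp: cube_def)
  qed
  define \<xi> where "\<xi> t = (SOME \<xi>. P t \<xi>)" for t
  have \<xi>: "P t (\<xi> t)" if "c t \<in> cube m (c t0) d" for t
    unfolding \<xi>_def using ex[OF that] by (rule someI_ex)
  have lim: "((\<lambda>t. partial_deriv j g (\<xi> t j)) \<longlongrightarrow> partial_deriv j g (c t0)) (at t0)" if j: "j < m" for j
  proof (rule tendstoI)
    fix e :: real assume "e > 0"
    moreover have "continuous_map (subtopology (Rn m) T) euclideanreal (partial_deriv j g)"
      using g j by simp
    ultimately obtain r where r: "r > 0" "\<And>x. x \<in> cube m (c t0) r \<Longrightarrow> \<bar>partial_deriv j g x - partial_deriv j g (c t0)\<bar> < e"
      using continuous_map_Rn_real_iff[OF T, of "partial_deriv j g"] c0 by blast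
    show "\<forall>\<^sub>F t in at t0. dist (partial_deriv j g (\<xi> t j)) (partial_deriv j g (c t0)) < e"
      using near[OF d(1)] near[OF r(1)]
    proof eventually_elim
      case (elim t)
      have "\<bar>\<xi> t j i - c t0 i\<bar> < r" if "i < m" for i
      proof -
        have "\<xi> t j i \<in> closed_segment (c t0 i) (c t i)" using \<xi>[OF elim(1)] j that by (auto simp: P_def)
        moreover have "\<bar>c t i - c t0 i\<bar> < r" using elim(2) that by (auto simp: cube_def)
        ultimately show ?thesis by (auto simp: closed_segment_eq_real_ivl split: if_splits)
      qed
      then have "\<xi> t j \<in> cube m (c t0) r" using \<xi>[OF elim(1)] j by (auto simp: P_def cube_def)
      then show ?case using r(2) by (simp add: dist_real_def)
    qed
  qed
  have "((\<lambda>t. \<Sum>j<m. partial_deriv j g (\<xi> t j) * ((c t j - c t0 j) / (t - t0)))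
      \<longlongrightarrow> (\<Sum>i<m. partial_deriv i g (c t0) * c' i)) (at t0)"
    using lim c by (intro tendsto_sum tendsto_mult) (auto simp: has_field_derivative_iff)
  moreover have "\<forall>\<^sub>F t in at t0. (\<Sum>j<m. partial_deriv j g (\<xi> t j) * ((c t j - c t0 j) / (t - t0)))
      = (g (c t) - g (c t0)) / (t - t0)"
    using near[OF d(1)]
    by eventually_elim (use \<xi> in \<open>auto simp: P_def sum_divide_distrib\<close>)
  ultimately show ?thesis
    unfolding has_field_derivative_iff by (rule Lim_transform_eventually)
qed

lemma continuous_map_into_Rn:
  assumes "\<And>x. x \<in> topspace X \<Longrightarrow> f x \<in> topspace (Rn m)"
    and "\<And>i. i < m \<Longrightarrow> continuous_map X euclideanreal (\<lambda>x. f x i)"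
  shows "continuous_map X (Rn m) f"
  using assms unfolding topspace_Rn unfolding Rn_def continuous_map_componentwise by auto

text \<open>A partial derivative of a composite is a derivative along the curve \<open>t \<mapsto> f (x(j := t))\<close>.\<close>

lemma chain_rule:
  assumes S: "openin (Rn n) S" and T: "openin (Rn m) T" and fT: "f ` S \<subseteq> T"
    and f: "\<And>i. i < m \<Longrightarrow> Ck_on (Suc 0) n S (\<lambda>x. f x i)" and g: "Ck_on (Suc 0) m T g"
    and x: "x \<in> S" and j: "j < n"
  shows "((\<lambda>t. g (f (x(j := t)))) has_real_derivative
      (\<Sum>i<m. partial_deriv i g (f x) * partial_deriv j (\<lambda>y. f y i) x)) (at (x j))"
proof -
  have "((\<lambda>t. g (f (x(j := t)))) has_real_derivative
      (\<Sum>i<m. partial_deriv i g (f (x(j := x j))) * partial_deriv j (\<lambda>y. f y i) x)) (at (x j))"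
  proof (rule chain_rule_along_curve[OF T g])
    show "f (x(j := x j)) \<in> T" using x fT by auto
    show "((\<lambda>t. f (x(j := t)) i) has_real_derivative partial_deriv j (\<lambda>y. f y i) x) (at (x j))" if "i < m" for i
      using has_partial_deriv[OF f[OF that] x j] .
    have "\<forall>\<^sub>F t in nhds (x j). f (x(j := t)) \<in> T"
      using eventually_upd_mem[OF S x j] by eventually_elim (use fT in auto)
    then show "\<forall>\<^sub>F t in at (x j). f (x(j := t)) \<in> T"
      using eventually_nhds_conv_at by blast
  qed
  then show ?thesis by simp
qed

lemma partial_deriv_compose:
  assumes "openin (Rn n) S" "openin (Rn m) T" "f ` S \<subseteq> T"
    "\<And>i. i < m \<Longrightarrow> Ck_on (Suc 0) n S (\<lambda>x. f x i)" "Ck_on (Suc 0) m T g" "x \<in> S" "j < n"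
  shows "partial_deriv j (\<lambda>x. g (f x)) x = (\<Sum>i<m. partial_deriv i g (f x) * partial_deriv j (\<lambda>y. f y i) x)"
  unfolding partial_deriv_def[of j "\<lambda>x. g (f x)"] by (rule DERIV_imp_deriv[OF chain_rule[OF assms]])

text \<open>The chain rule writes each partial derivative of \<open>g \<circ> f\<close> as a sum of products of a partial derivative
  of \<open>g\<close>, composed with \<open>f\<close>, and a partial derivative of \<open>f\<close>. The induction is on the order, for all
  smooth \<open>g\<close> at once.\<close>

lemma Ck_on_compose:
  assumes S: "openin (Rn n) S" and T: "openin (Rn m) T" and fT: "f ` S \<subseteq> T"
    and f: "\<And>i k. i < m \<Longrightarrow> Ck_on k n S (\<lambda>x. f x i)" and g: "\<And>k. Ck_on k m T g"
  shows "Ck_on k n S (\<lambda>x. g (f x))"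
  using g
proof (induction k arbitrary: g)
  have fS: "continuous_map (subtopology (Rn n) S) (subtopology (Rn m) T) f"
    using fT open_Rn_subset[OF T] f[of _ 0]
    by (intro continuous_map_into_subtopology continuous_map_into_Rn) (auto simp: image_subset_iff)
  {
    case 0
    from continuous_map_compose[OF fS Ck_on_continuous[OF this[of 0]]] show ?case
      by (simp add: comp_def)
  next
    case (Suc k)
    have "continuous_map (subtopology (Rn n) S) euclideanreal (\<lambda>x. g (f x))"
      using continuous_map_compose[OF fS Ck_on_continuous[OF Suc.prems[of 0]]] by (simp add: comp_def)
    moreover have "(\<lambda>t. g (f (x(j := t)))) field_differentiable at (x j)" if "x \<in> S" "j < n" for x j
      using chain_rule[OF S T fT f Suc.prems that] unfolding field_differentiable_def by blast
    moreover have "Ck_on k n S (partial_deriv j (\<lambda>x. g (f x)))" if j: "j < n" for j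
    proof (rule Ck_on_cong[OF S])
      show "(\<Sum>i<m. partial_deriv i g (f x) * partial_deriv j (\<lambda>y. f y i) x) = partial_deriv j (\<lambda>x. g (f x)) x"
        if "x \<in> S" for x
        using partial_deriv_compose[OF S T fT f Suc.prems that j] by simp
      have "Ck_on k n S (partial_deriv j (\<lambda>y. f y i))" if "i < m" for i
        using f[of i "Suc k"] that j by simp
      moreover have "Ck_on k n S (\<lambda>x. partial_deriv i g (f x))" if "i < m" for i
      proof (rule Suc.IH)
        show "Ck_on l m T (partial_deriv i g)" for l using Suc.prems[of "Suc l"] that by simp
      qed
      ultimately show "Ck_on k n S (\<lambda>x. \<Sum>i<m. partial_deriv i g (f x) * partial_deriv j (\<lambda>y. f y i) x)"
        by (intro Ck_on_sum[OF S] Ck_on_mult[OF S]) auto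
    qed
    ultimately show ?case by simp
  }
qed

lemma smooth_on_subset: "smooth_on n m S f \<Longrightarrow> T \<subseteq> S \<Longrightarrow> smooth_on n m T f"
  by (auto simp: smooth_on_def intro: Ck_on_subset)

lemma smooth_on_cong:
  assumes "openin (Rn n) S" "\<And>x. x \<in> S \<Longrightarrow> f x = g x" "smooth_on n m S f"
  shows "smooth_on n m S g"
  unfolding smooth_on_def
proof (intro allI impI)
  fix i k assume "i < m"
  then have "Ck_on k n S (\<lambda>x. f x i)" using assms(3) by (simp add: smooth_on_def)
  then show "Ck_on k n S (\<lambda>x. g x i)"
    using Ck_on_cong[OF assms(1), of "\<lambda>x. f x i" "\<lambda>x. g x i" k] assms(2) by simp
qed

lemma smooth_on_locally:
  assumes "openin (Rn n) S" "\<And>p. p \<in> S \<Longrightarrow> \<exists>T. openin (Rn n) T \<and> p \<in> T \<and> T \<subseteq> S \<and> smooth_on n m T f"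
  shows "smooth_on n m S f"
  unfolding smooth_on_def
proof (intro allI impI)
  fix i k assume i: "i < m"
  show "Ck_on k n S (\<lambda>x. f x i)"
  proof (rule Ck_on_locally[OF assms(1)])
    fix p assume "p \<in> S"
    from assms(2)[OF this] obtain T where "openin (Rn n) T" "p \<in> T" "T \<subseteq> S" "smooth_on n m T f" by blast
    then show "\<exists>T. openin (Rn n) T \<and> p \<in> T \<and> T \<subseteq> S \<and> Ck_on k n T (\<lambda>x. f x i)"
      using i by (intro exI[of _ T]) (simp add: smooth_on_def)
  qed
qed

lemma smooth_on_compose:
  assumes "openin (Rn n) S" "openin (Rn m) T" "f ` S \<subseteq> T" "smooth_on n m S f" "smooth_on m l T g"
  shows "smooth_on n l S (\<lambda>x. g (f x))"
  unfolding smooth_on_def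
proof (intro allI impI)
  fix i k assume "i < l"
  with assms(4,5) show "Ck_on k n S (\<lambda>x. g (f x) i)"
    by (intro Ck_on_compose[OF assms(1-3), of "\<lambda>x. g x i"]) (simp_all add: smooth_on_def del: Ck_on.simps)
qed

lemma smooth_on_continuous_map:
  assumes "smooth_on n m S f" "f ` S \<subseteq> topspace (Rn m)"
  shows "continuous_map (subtopology (Rn n) S) (Rn m) f"
  using assms by (intro continuous_map_into_Rn) (auto simp: smooth_on_def intro: Ck_on_continuous[of 0])

lemma differential_at_cong:
  assumes "openin (Rn n) S" "\<And>x. x \<in> S \<Longrightarrow> f x = g x" "x \<in> S"
  shows "differential_at n m f x = differential_at n m g x"
proof -
  have "partial_deriv j (\<lambda>y. f y i) x = partial_deriv j (\<lambda>y. g y i) x" if "j < n" for i j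
    by (rule partial_deriv_cong[OF assms(1) _ assms(3) that]) (simp add: assms(2))
  then show ?thesis by (auto simp: differential_at_def fun_eq_iff)
qed

lemma differential_at_compose:
  assumes "openin (Rn n) S" "openin (Rn m) T" "f ` S \<subseteq> T" "smooth_on n m S f" "smooth_on m l T g" "x \<in> S"
  shows "differential_at n l (\<lambda>x. g (f x)) x v = differential_at m l g (f x) (differential_at n m f x v)"
proof -
  have "(\<Sum>j<n. partial_deriv j (\<lambda>x. g (f x) k) x * v j) =
      (\<Sum>i<m. partial_deriv i (\<lambda>y. g y k) (f x) * (\<Sum>j<n. partial_deriv j (\<lambda>y. f y i) x * v j))" if "k < l" for k
  proof -
    have "partial_deriv j (\<lambda>x. g (f x) k) x = (\<Sum>i<m. partial_deriv i (\<lambda>y. g y k) (f x) * partial_deriv j (\<lambda>y. f y i) x)"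
      if "j < n" for j
      using assms(4-6) \<open>k < l\<close> that
      by (intro partial_deriv_compose[OF assms(1-3), of "\<lambda>y. g y k"]) (simp_all add: smooth_on_def del: Ck_on.simps)
    then have "(\<Sum>j<n. partial_deriv j (\<lambda>x. g (f x) k) x * v j) =
        (\<Sum>j<n. \<Sum>i<m. partial_deriv i (\<lambda>y. g y k) (f x) * partial_deriv j (\<lambda>y. f y i) x * v j)"
      by (simp add: sum_distrib_right)
    also have "\<dots> = (\<Sum>i<m. \<Sum>j<n. partial_deriv i (\<lambda>y. g y k) (f x) * partial_deriv j (\<lambda>y. f y i) x * v j)"
      by (rule sum.swap)
    finally show ?thesis by (simp add: sum_distrib_left mult.assoc)
  qed
  then show ?thesis by (auto simp: differential_at_def fun_eq_iff)
qed

lemma differential_at_id: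
  assumes "v \<in> topspace (Rn n)"
  shows "differential_at n n (\<lambda>x. x) x v = v"
proof -
  have "partial_deriv j (\<lambda>y. y i) x = (if i = j then 1 else 0)" for i j
    by (auto simp: partial_deriv_def)
  then show ?thesis
    using assms by (auto simp: differential_at_def topspace_Rn extensional_def fun_eq_iff if_distrib[of "\<lambda>c. c * _"] cong: if_cong)
qed

lemma differential_at_mem: "differential_at n m f x v \<in> topspace (Rn m)"
  by (simp add: differential_at_def topspace_Rn)


section \<open>Lebesgue null sets\<close>

abbreviation lborel_Rn :: "nat \<Rightarrow> (nat \<Rightarrow> real) measure"
  where "lborel_Rn n \<equiv> Pi\<^sub>M {..<n} (\<lambda>_. lborel)"

abbreviation "leb n \<equiv> emeasure (lborel_Rn n)"
abbreviation "null_Rn n \<equiv> null_sets (lborel_Rn n)"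
abbreviation "borel_Rn n \<equiv> sets (lborel_Rn n)"

interpretation lborel_product: product_sigma_finite "\<lambda>_::nat. lborel :: real measure"
  by unfold_locales

lemma sigma_finite_lborel_Rn: "sigma_finite_measure (lborel_Rn n)"
  by (rule lborel_product.sigma_finite) simp

lemma space_lborel_Rn: "space (lborel_Rn n) = topspace (Rn n)"
  by (simp add: space_PiM Rn_def)

text \<open>The points of \<open>Rn n\<close>, extended by an unspecified value, do not make up a whole type. Extending
  them by zero instead embeds \<open>Rn n\<close> as a closed subspace of the Polish space of all real
  sequences, with restriction to \<open>{..<n}\<close> as a continuous left inverse; regularity of Borel measures
  is imported from there.\<close>

definition zero_extend :: "nat \<Rightarrow> (nat \<Rightarrow> real) \<Rightarrow> (nat \<Rightarrow> real)"
  where "zero_extend n x = (\<lambda>i. if i < n then x i else 0)"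

lemma restrict_zero_extend: "x \<in> topspace (Rn n) \<Longrightarrow> restrict (zero_extend n x) {..<n} = x"
  by (auto simp: zero_extend_def topspace_Rn extensional_def fun_eq_iff)

lemma continuous_map_restrict_Rn: "continuous_map euclidean (Rn n) (\<lambda>x. restrict x {..<n})"
proof (rule continuous_map_into_Rn)
  show "continuous_map euclidean euclideanreal (\<lambda>x. restrict x {..<n} i)" if "i < n" for i
    using that by (simp add: continuous_on_product_coordinates)
qed (simp add: topspace_Rn)

lemma continuous_map_zero_extend: "continuous_map (Rn n) euclidean (zero_extend n)"
proof -
  have "continuous_map (Rn n) (product_topology (\<lambda>_. euclideanreal) UNIV) (zero_extend n)"
    unfolding continuous_map_componentwise_UNIV
  proof
    show "continuous_map (Rn n) euclideanreal (\<lambda>x. zero_extend n x i)" for i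
      by (cases "i < n") (auto simp: zero_extend_def Rn_def intro: continuous_map_product_projection)
  qed
  then show ?thesis by (simp add: euclidean_product_topology)
qed

lemma measurable_zero_extend [measurable]: "zero_extend n \<in> borel_measurable (lborel_Rn n)"
proof (rule measurable_coordinatewise_then_product)
  show "(\<lambda>x. zero_extend n x i) \<in> borel_measurable (lborel_Rn n)" for i
    by (cases "i < n") (simp_all add: zero_extend_def)
qed

lemma measurable_restrict_Rn: "(\<lambda>x. restrict x {..<n}) \<in> measurable borel (lborel_Rn n)"
  by (rule measurable_restrict) simp

lemma sets_lborel_Rn_open:
  assumes "openin (Rn n) S" shows "S \<in> borel_Rn n"
proof -
  have "open {x. restrict x {..<n} \<in> S}"
    using openin_continuous_map_preimage[OF continuous_map_restrict_Rn assms] by simp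
  then have "zero_extend n -` {x. restrict x {..<n} \<in> S} \<inter> space (lborel_Rn n) \<in> borel_Rn n"
    by (intro measurable_sets[OF measurable_zero_extend]) auto
  also have "zero_extend n -` {x. restrict x {..<n} \<in> S} \<inter> space (lborel_Rn n) = S"
    using open_Rn_subset[OF assms] by (auto simp: space_lborel_Rn restrict_zero_extend)
  finally show ?thesis .
qed

lemma sets_lborel_Rn_compact:
  assumes "compactin (Rn n) K" shows "K \<in> borel_Rn n"
proof -
  have "Hausdorff_space (Rn n)" by (simp add: Rn_def Hausdorff_space_product_topology)
  then have "closedin (Rn n) K" using assms by (rule compactin_imp_closedin)
  then have "openin (Rn n) (topspace (Rn n) - K)" and K: "K \<subseteq> topspace (Rn n)"
    by (auto simp: closedin_def)
  then have "space (lborel_Rn n) - (topspace (Rn n) - K) \<in> borel_Rn n"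
    by (intro sets.compl_sets sets_lborel_Rn_open)
  moreover have "space (lborel_Rn n) - (topspace (Rn n) - K) = K"
    using K by (auto simp: space_lborel_Rn)
  ultimately show ?thesis by simp
qed

text \<open>Lebesgue measure is cut down to a set \<open>B\<close> of finite measure since regularity on Polish spaces is a
  statement about finite measures.\<close>

lemma lborel_Rn_as_borel_measure:
  assumes B: "B \<in> borel_Rn n" "leb n B < \<infinity>"
  defines "M \<equiv> distr (density (lborel_Rn n) (indicator B)) borel (zero_extend n)"
  shows "sets M = sets borel" "emeasure M (space M) \<noteq> \<infinity>"
    "\<And>A. A \<in> sets borel \<Longrightarrow> emeasure M A = leb n (B \<inter> {x \<in> space (lborel_Rn n). zero_extend n x \<in> A})"
proof -
  show "sets M = sets borel" by (simp add: M_def)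
  show *: "emeasure M A = leb n (B \<inter> {x \<in> space (lborel_Rn n). zero_extend n x \<in> A})"
    if A: "A \<in> sets borel" for A
  proof -
    have "zero_extend n -` A \<inter> space (lborel_Rn n) \<in> borel_Rn n"
      by (rule measurable_sets[OF measurable_zero_extend A])
    moreover have "zero_extend n -` A \<inter> space (lborel_Rn n) = {x \<in> space (lborel_Rn n). zero_extend n x \<in> A}" by auto
    ultimately show ?thesis
      unfolding M_def using A B
      by (simp add: emeasure_distr emeasure_density Int_commute flip: indicator_inter_arith)
  qed
  have "emeasure M (space M) \<le> leb n B"
    unfolding M_def using *[of UNIV] B by (auto simp: M_def intro!: emeasure_mono)
  then show "emeasure M (space M) \<noteq> \<infinity>" using B by (metis leD)
qed

lemma inner_regular_lborel_Rn:
  assumes E: "E \<in> borel_Rn n" and fin: "leb n E < \<infinity>" and pos: "leb n E > 0"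
  obtains K where "compactin (Rn n) K" "K \<subseteq> E" "leb n K > 0"
proof -
  define M where "M = distr (density (lborel_Rn n) (indicator E)) borel (zero_extend n)"
  note M = lborel_Rn_as_borel_measure[OF E fin, folded M_def]
  define E' where "E' = {x. restrict x {..<n} \<in> E}"
  have E': "E' \<in> sets borel"
    using measurable_sets[OF measurable_restrict_Rn E] by (simp add: E'_def vimage_def)
  have "E \<inter> {x \<in> space (lborel_Rn n). zero_extend n x \<in> E'} = E"
    using sets.sets_into_space[OF E] by (auto simp: E'_def space_lborel_Rn restrict_zero_extend)
  then have "emeasure M E' > 0" using M(3)[OF E'] pos by simp
  then obtain K where K: "K \<subseteq> E'" "compact K" "emeasure M K > 0"
    unfolding inner_regular[OF M(1,2) E'] less_SUP_iff by auto
  \<comment> \<open>the closed image of the embedding; a compact set of sequences need not lie inside it\<close>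
  let ?Z = "(\<Inter>i\<in>{n..}. {y :: nat \<Rightarrow> real. y i = 0})"
  have "closed ?Z"
    by (intro closed_INT ballI closed_Collect_eq continuous_on_product_coordinates continuous_on_const)
  then have "compact (K \<inter> ?Z)" using K(2) by (simp add: compact_Int_closed)
  then have c: "compactin (Rn n) ((\<lambda>x. restrict x {..<n}) ` (K \<inter> ?Z))"
    by (intro image_compactin[OF _ continuous_map_restrict_Rn]) simp
  have "E \<inter> {x \<in> space (lborel_Rn n). zero_extend n x \<in> K} \<subseteq> (\<lambda>x. restrict x {..<n}) ` (K \<inter> ?Z)"
  proof
    fix x assume x: "x \<in> E \<inter> {x \<in> space (lborel_Rn n). zero_extend n x \<in> K}"
    then have "x = restrict (zero_extend n x) {..<n}" by (simp add: space_lborel_Rn restrict_zero_extend)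
    moreover have "zero_extend n x \<in> K \<inter> ?Z" using x by (auto simp: zero_extend_def)
    ultimately show "x \<in> (\<lambda>x. restrict x {..<n}) ` (K \<inter> ?Z)" by (rule image_eqI)
  qed
  then have "emeasure M K \<le> leb n ((\<lambda>x. restrict x {..<n}) ` (K \<inter> ?Z))"
    using M(3)[of K] K(2) sets_lborel_Rn_compact[OF c] by (auto intro!: emeasure_mono simp: borel_compact)
  moreover have "(\<lambda>x. restrict x {..<n}) ` (K \<inter> ?Z) \<subseteq> E" using K(1) by (auto simp: E'_def)
  ultimately show ?thesis using that[OF c] K(3) by auto
qed

lemma outer_regular_lborel_Rn:
  assumes B: "openin (Rn n) B" "leb n B < \<infinity>"
    and E: "E \<in> borel_Rn n" "E \<subseteq> B" "leb n E < e"
  obtains O' where "openin (Rn n) O'" "E \<subseteq> O'" "leb n O' < e"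
proof -
  define M where "M = distr (density (lborel_Rn n) (indicator B)) borel (zero_extend n)"
  note M = lborel_Rn_as_borel_measure[OF sets_lborel_Rn_open[OF B(1)] B(2), folded M_def]
  define E' where "E' = {x. restrict x {..<n} \<in> E}"
  have E': "E' \<in> sets borel"
    using measurable_sets[OF measurable_restrict_Rn E(1)] by (simp add: E'_def vimage_def)
  have "B \<inter> {x \<in> space (lborel_Rn n). zero_extend n x \<in> E'} = E"
    using sets.sets_into_space[OF E(1)] E(2) by (auto simp: E'_def space_lborel_Rn restrict_zero_extend)
  then have "emeasure M E' < e" using M(3)[OF E'] E(3) by simp
  then obtain U where U: "E' \<subseteq> U" "open U" "emeasure M U < e"
    unfolding outer_regular[OF M(1,2) E'] INF_less_iff by auto
  have "openin (Rn n) {x \<in> topspace (Rn n). zero_extend n x \<in> U}"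
    using U(2) by (intro openin_continuous_map_preimage[OF continuous_map_zero_extend]) simp
  then have "openin (Rn n) (B \<inter> {x \<in> space (lborel_Rn n). zero_extend n x \<in> U})"
    using B(1) by (simp add: space_lborel_Rn openin_Int)
  moreover have "E \<subseteq> B \<inter> {x \<in> space (lborel_Rn n). zero_extend n x \<in> U}"
  proof
    fix x assume x: "x \<in> E"
    then have xt: "x \<in> topspace (Rn n)" using sets.sets_into_space[OF E(1)] by (auto simp: space_lborel_Rn)
    then have "zero_extend n x \<in> E'" using x by (simp add: E'_def restrict_zero_extend)
    then show "x \<in> B \<inter> {x \<in> space (lborel_Rn n). zero_extend n x \<in> U}"
      using x xt U(1) E(2) by (auto simp: space_lborel_Rn)
  qed
  moreover have "leb n (B \<inter> {x \<in> space (lborel_Rn n). zero_extend n x \<in> U}) < e"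
    using M(3)[of U] U(2,3) by simp
  ultimately show ?thesis by (rule that)
qed

lemma emeasure_cube: "d > 0 \<Longrightarrow> leb n (cube n p d) = ennreal ((2 * d) ^ n)"
proof -
  assume "d > 0"
  have "ball (p i) d = {p i - d<..<p i + d}" for i by (rule ball_eq_greaterThanLessThan)
  then have "leb n (cube n p d) = (\<Prod>i<n. ennreal (2 * d))"
    unfolding cube_eq_PiE using \<open>d > 0\<close> by (subst lborel_product.emeasure_PiM) auto
  then show ?thesis using \<open>d > 0\<close> by (simp add: ennreal_power)
qed

definition dyadic_cell :: "nat \<Rightarrow> nat \<Rightarrow> (nat \<Rightarrow> int) \<Rightarrow> (nat \<Rightarrow> real) set"
  where "dyadic_cell n k z = {y \<in> topspace (Rn n). \<forall>i<n. \<lfloor>2 ^ k * y i\<rfloor> = z i}"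

lemma dyadic_cell_eq_PiE:
  "dyadic_cell n k z = PiE {..<n} (\<lambda>i. {of_int (z i) / 2 ^ k ..< (of_int (z i) + 1) / 2 ^ k})"
  by (auto simp: dyadic_cell_def topspace_Rn PiE_def extensional_def floor_eq_iff field_simps Pi_def)

lemma sets_dyadic_cell: "dyadic_cell n k z \<in> borel_Rn n"
  unfolding dyadic_cell_eq_PiE by (intro sets_PiM_I_finite) auto

lemma emeasure_dyadic_cell: "leb n (dyadic_cell n k z) = ennreal ((1 / 2 ^ k) ^ n)"
proof -
  have "leb n (dyadic_cell n k z) = (\<Prod>i<n. ennreal (1 / 2 ^ k))"
    unfolding dyadic_cell_eq_PiE
    by (subst lborel_product.emeasure_PiM) (auto intro!: prod.cong simp: divide_right_mono simp flip: diff_divide_distrib)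
  then show ?thesis by (simp add: ennreal_power)
qed

text \<open>Every point of an open set has a small dyadic cell inside the set, and cells of consecutive levels are
  nested. So an open set is the increasing union, over the levels, of countable disjoint unions of cells.\<close>

lemma dyadic_exhaustion:
  assumes O': "openin (Rn n) O'"
  defines "Z k \<equiv> {z \<in> PiE {..<n} (\<lambda>_. UNIV). dyadic_cell n k z \<subseteq> O'}"
  shows "O' = (\<Union>k. \<Union>z\<in>Z k. dyadic_cell n k z)" "incseq (\<lambda>k. \<Union>z\<in>Z k. dyadic_cell n k z)"
    "\<And>k. countable (Z k)" "\<And>k. disjoint_family_on (dyadic_cell n k) (Z k)"
proof -
  define cell where "cell k x = dyadic_cell n k (\<lambda>i\<in>{..<n}. \<lfloor>2 ^ k * x i\<rfloor>)" for k and x :: "nat \<Rightarrow> real"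
  have mem: "x \<in> cell k x" if "x \<in> topspace (Rn n)" for k x
    using that by (auto simp: cell_def dyadic_cell_def)
  have U: "(\<Union>z\<in>Z k. dyadic_cell n k z) = {x \<in> topspace (Rn n). cell k x \<subseteq> O'}" for k
  proof (intro equalityI subsetI)
    fix x assume "x \<in> (\<Union>z\<in>Z k. dyadic_cell n k z)"
    then obtain z where z: "z \<in> PiE {..<n} (\<lambda>_. UNIV)" "dyadic_cell n k z \<subseteq> O'" "x \<in> dyadic_cell n k z" by (auto simp: Z_def)
    then have "cell k x = dyadic_cell n k z" by (auto simp: cell_def dyadic_cell_def)
    then show "x \<in> {x \<in> topspace (Rn n). cell k x \<subseteq> O'}" using z by (auto simp: dyadic_cell_def)
  next
    fix x assume "x \<in> {x \<in> topspace (Rn n). cell k x \<subseteq> O'}"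
    then show "x \<in> (\<Union>z\<in>Z k. dyadic_cell n k z)"
      using mem[of x k] by (intro UN_I[of "\<lambda>i\<in>{..<n}. \<lfloor>2 ^ k * x i\<rfloor>"]) (auto simp: Z_def cell_def)
  qed
  have Suc: "cell (Suc k) x \<subseteq> cell k x" for k x
  proof -
    have *: "\<lfloor>2 ^ k * t\<rfloor> = \<lfloor>2 ^ Suc k * t\<rfloor> div 2" for t :: real
      using floor_divide_real_eq_div[of 2 "2 ^ Suc k * t"] by simp
    show ?thesis by (auto simp: cell_def dyadic_cell_def *)
  qed
  show "O' = (\<Union>k. \<Union>z\<in>Z k. dyadic_cell n k z)"
  proof (intro equalityI subsetI)
    fix x assume x: "x \<in> O'"
    then obtain d where d: "d > 0" "cube n x d \<subseteq> O'" using open_Rn_contains_cube[OF O'] by blast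
    obtain k where k: "(1 / 2) ^ k < d" using real_arch_pow_inv[OF d(1), of "1/2"] by auto
    have "cell k x \<subseteq> cube n x d"
    proof
      fix y assume y: "y \<in> cell k x"
      have "\<bar>y i - x i\<bar> < d" if "i < n" for i
      proof -
        have "\<lfloor>2 ^ k * y i\<rfloor> = \<lfloor>2 ^ k * x i\<rfloor>" using y that by (auto simp: cell_def dyadic_cell_def)
        then have "\<bar>2 ^ k * y i - 2 ^ k * x i\<bar> < 1" by linarith
        then have "2 ^ k * \<bar>y i - x i\<bar> < 1" by (simp add: abs_mult flip: right_diff_distrib)
        then have "\<bar>y i - x i\<bar> < (1 / 2) ^ k" by (simp add: field_simps power_divide)
        then show ?thesis using k by simp
      qed
      then show "y \<in> cube n x d" using y by (auto simp: cube_def cell_def dyadic_cell_def)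
    qed
    then show "x \<in> (\<Union>k. \<Union>z\<in>Z k. dyadic_cell n k z)" unfolding U using d x open_Rn_subset[OF O'] by blast
  qed (auto simp: Z_def)
  show "incseq (\<lambda>k. \<Union>z\<in>Z k. dyadic_cell n k z)"
    unfolding U by (rule incseq_SucI) (use Suc in blast)
  have "countable (PiE {..<n} (\<lambda>_. UNIV :: int set))" by (intro countable_PiE) auto
  then show "countable (Z k)" for k by (rule countable_subset[rotated]) (auto simp: Z_def)
  show "disjoint_family_on (dyadic_cell n k) (Z k)" for k
    unfolding disjoint_family_on_def
  proof (intro ballI impI)
    fix z w assume zw: "z \<in> Z k" "w \<in> Z k" "z \<noteq> w"
    then obtain i where "z i \<noteq> w i" by auto
    then have "i < n" using zw by (metis (no_types, lifting) PiE_arb Z_def lessThan_iff mem_Collect_eq)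
    then show "dyadic_cell n k z \<inter> dyadic_cell n k w = {}"
      using \<open>z i \<noteq> w i\<close> by (auto simp: dyadic_cell_def)
  qed
qed

text \<open>If \<open>G\<close> shrinks distances at most \<open>c\<close>-fold, the preimage of a dyadic cell lies in a cube whose
  side is \<open>2 * c\<close> times that of the cell. Hence the measure of the preimage is at most \<open>(2 * c) ^ n\<close> times
  the measure of the cell, then the same holds for open sets by exhaustion, and outer regularity settles
  null sets.\<close>

lemma null_preimage_of_expanding_map:
  assumes W: "W \<subseteq> topspace (Rn n)" and G: "\<And>A. A \<in> borel_Rn n \<Longrightarrow> {x \<in> W. G x \<in> A} \<in> borel_Rn n"
    and c: "c > 0" and expand: "\<And>v w s. v \<in> W \<Longrightarrow> w \<in> W \<Longrightarrow> (\<And>k. k < n \<Longrightarrow> \<bar>G v k - G w k\<bar> \<le> s) \<Longrightarrow>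
      (\<And>k. k < n \<Longrightarrow> \<bar>v k - w k\<bar> \<le> c * s)"
    and E: "E \<in> null_Rn n"
  shows "{x \<in> W. G x \<in> E} \<in> null_Rn n"
proof -
  define P where "P A = {x \<in> W. G x \<in> A}" for A
  let ?C = "ennreal ((2 * c) ^ n)"
  have cell: "leb n (P (dyadic_cell n k z)) \<le> ?C * leb n (dyadic_cell n k z)" for k z
  proof (cases "P (dyadic_cell n k z) = {}")
    case False
    then obtain x0 where x0: "x0 \<in> W" "G x0 \<in> dyadic_cell n k z" by (auto simp: P_def)
    have "P (dyadic_cell n k z) \<subseteq> PiE {..<n} (\<lambda>i. {x0 i - c * (1 / 2 ^ k) .. x0 i + c * (1 / 2 ^ k)})"
    proof
      fix x assume x: "x \<in> P (dyadic_cell n k z)"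
      have "\<bar>G x i - G x0 i\<bar> \<le> 1 / 2 ^ k" if "i < n" for i
      proof -
        have "\<lfloor>2 ^ k * G x i\<rfloor> = \<lfloor>2 ^ k * G x0 i\<rfloor>" using x x0 that by (auto simp: P_def dyadic_cell_def)
        then have "\<bar>2 ^ k * G x i - 2 ^ k * G x0 i\<bar> \<le> 1" by linarith
        then have "2 ^ k * \<bar>G x i - G x0 i\<bar> \<le> 1" by (simp add: abs_mult flip: right_diff_distrib)
        then show ?thesis by (simp add: field_simps)
      qed
      then have *: "\<bar>x i - x0 i\<bar> \<le> c * (1 / 2 ^ k)" if "i < n" for i
        using expand[of x x0 "1 / 2 ^ k" i] x x0 that by (auto simp: P_def)
      have "x \<in> topspace (Rn n)" using x W by (auto simp: P_def)
      then show "x \<in> PiE {..<n} (\<lambda>i. {x0 i - c * (1 / 2 ^ k) .. x0 i + c * (1 / 2 ^ k)})"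
        using * by (simp add: topspace_Rn PiE_def Pi_def abs_le_iff algebra_simps)
    qed
    then have "leb n (P (dyadic_cell n k z))
        \<le> leb n (PiE {..<n} (\<lambda>i. {x0 i - c * (1 / 2 ^ k) .. x0 i + c * (1 / 2 ^ k)}))"
      by (intro emeasure_mono sets_PiM_I_finite) auto
    also have "\<dots> = (\<Prod>i<n. ennreal (2 * c * (1 / 2 ^ k)))"
      using c by (subst lborel_product.emeasure_PiM) (auto intro!: prod.cong)
    also have "\<dots> = ?C * leb n (dyadic_cell n k z)"
      using c by (simp add: emeasure_dyadic_cell ennreal_power power_mult_distrib power_divide flip: ennreal_mult)
    finally show ?thesis .
  qed simp
  have opens: "leb n (P O') \<le> ?C * leb n O'" if O': "openin (Rn n) O'" for O'
  proof -
    define Z where "Z k = {z \<in> PiE {..<n} (\<lambda>_. UNIV). dyadic_cell n k z \<subseteq> O'}" for k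
    define A where "A k = (\<Union>z\<in>Z k. dyadic_cell n k z)" for k
    note D = dyadic_exhaustion[OF O', folded Z_def, folded A_def]
    have As: "A k \<in> borel_Rn n" for k
      unfolding A_def using D(3) sets_dyadic_cell by (intro sets.countable_UN') auto
    have lvl: "leb n (P (A k)) \<le> ?C * leb n (A k)" for k
    proof -
      have "P (A k) = (\<Union>z\<in>Z k. P (dyadic_cell n k z))" by (auto simp: P_def A_def)
      moreover have "disjoint_family_on (\<lambda>z. P (dyadic_cell n k z)) (Z k)"
        using D(4)[of k] by (auto simp: disjoint_family_on_def P_def)
      moreover have "P (dyadic_cell n k z) \<in> borel_Rn n" for z
        unfolding P_def by (rule G[OF sets_dyadic_cell])
      ultimately have "leb n (P (A k)) = (\<integral>\<^sup>+ z. leb n (P (dyadic_cell n k z)) \<partial>count_space (Z k))"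
        using D(3) by (simp add: emeasure_UN_countable)
      also have "\<dots> \<le> (\<integral>\<^sup>+ z. ?C * leb n (dyadic_cell n k z) \<partial>count_space (Z k))"
        by (intro nn_integral_mono cell)
      also have "\<dots> = ?C * (\<integral>\<^sup>+ z. leb n (dyadic_cell n k z) \<partial>count_space (Z k))"
        by (rule nn_integral_cmult) simp
      also have "(\<integral>\<^sup>+ z. leb n (dyadic_cell n k z) \<partial>count_space (Z k)) = leb n (A k)"
        unfolding A_def using D(3,4) sets_dyadic_cell by (simp add: emeasure_UN_countable)
      finally show ?thesis .
    qed
    have "leb n (P O') = leb n (\<Union>k. P (A k))"
      by (subst D(1)) (auto simp: P_def intro!: arg_cong2[of _ _ _ _ emeasure])
    also have "\<dots> = (SUP k. leb n (P (A k)))"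
    proof (rule SUP_emeasure_incseq[symmetric])
      show "range (\<lambda>k. P (A k)) \<subseteq> borel_Rn n" using G[OF As] by (auto simp: P_def)
      show "incseq (\<lambda>k. P (A k))" using D(2) by (auto simp: incseq_def P_def)
    qed
    also have "\<dots> \<le> ?C * leb n O'"
    proof (rule SUP_least)
      fix k
      have "A k \<subseteq> O'" using D(1) by auto
      then have "leb n (A k) \<le> leb n O'"
        by (intro emeasure_mono sets_lborel_Rn_open[OF O'])
      then show "leb n (P (A k)) \<le> ?C * leb n O'"
        using lvl[of k] by (meson mult_left_mono order_trans zero_le)
    qed
    finally show ?thesis .
  qed
  \<comment> \<open>outer regularity needs finite measure, so the null set is cut into bounded pieces\<close>
  define B where "B l = cube n (\<lambda>_. 0) (real (Suc l))" for l
  have bounded: "P (E \<inter> B l) \<in> null_Rn n" for l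
  proof -
    have Bl: "openin (Rn n) (B l)" "leb n (B l) < \<infinity>"
      by (simp_all add: B_def openin_cube emeasure_cube)
    have EB: "E \<inter> B l \<in> null_Rn n"
      using E sets_lborel_Rn_open[OF Bl(1)] by (rule null_set_Int2)
    have eps: "leb n (P (E \<inter> B l)) \<le> 0 + ennreal e" if e: "e > 0" for e
    proof -
      define e' where "e' = e / (2 * c) ^ n"
      have e': "e' > 0" using e c by (simp add: e'_def)
      obtain O' where O': "openin (Rn n) O'" "E \<inter> B l \<subseteq> O'" "leb n O' < ennreal e'"
        using outer_regular_lborel_Rn[OF Bl, of "E \<inter> B l" "ennreal e'"] EB e' by (auto simp: null_sets_def)
      have "leb n (P (E \<inter> B l)) \<le> leb n (P O')"
        using O' G[OF sets_lborel_Rn_open[OF O'(1)]] by (intro emeasure_mono) (auto simp: P_def)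
      also have "\<dots> \<le> ?C * leb n O'" by (rule opens[OF O'(1)])
      also have "\<dots> \<le> ?C * ennreal e'" using O'(3) by (intro mult_left_mono) auto
      also have "\<dots> = ennreal e" using c e' by (simp add: e'_def flip: ennreal_mult)
      finally show ?thesis by simp
    qed
    have "leb n (P (E \<inter> B l)) \<le> 0"
      by (rule ennreal_le_epsilon) (erule eps)
    moreover have "P (E \<inter> B l) \<in> borel_Rn n"
      unfolding P_def by (rule G) (use EB in auto)
    ultimately show ?thesis by (simp add: null_sets_def)
  qed
  have "E = (\<Union>l. E \<inter> B l)"
  proof (intro equalityI subsetI)
    fix x assume x: "x \<in> E"
    then have xt: "x \<in> topspace (Rn n)" using E sets.sets_into_space space_lborel_Rn by (metis null_setsD2 subsetD)
    obtain l :: nat where l: "(\<Sum>i<n. \<bar>x i\<bar>) \<le> real l" using real_arch_simple by blast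
    have "\<bar>x i\<bar> < real (Suc l)" if "i < n" for i
      using member_le_sum[of i "{..<n}" "\<lambda>i. \<bar>x i\<bar>"] that l by auto
    then show "x \<in> (\<Union>l. E \<inter> B l)" using x xt by (auto simp: B_def cube_def)
  qed auto
  then have "P E = (\<Union>l. P (E \<inter> B l))" by (auto simp: P_def)
  also have "\<dots> \<in> null_Rn n" by (intro null_sets_UN bounded)
  finally show ?thesis by (simp add: P_def)
qed

lemma sets_preimage_Rn:
  assumes S: "openin (Rn n) S" and g: "continuous_map (subtopology (Rn n) S) (Rn m) g"
    and E: "E \<in> borel_Rn m"
  shows "{x \<in> S. g x \<in> E} \<in> borel_Rn n"
proof -
  have ts: "topspace (subtopology (Rn n) S) = S" using open_Rn_subset[OF S] by auto
  have gt: "g x \<in> topspace (Rn m)" if "x \<in> S" for x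
    using continuous_map_funspace[OF g] that unfolding ts by auto
  have Ss: "S \<in> borel_Rn n" by (rule sets_lborel_Rn_open[OF S])
  have "(\<lambda>x. g x i) \<in> borel_measurable (restrict_space (lborel_Rn n) S)" if i: "i < m" for i
  proof (rule borel_measurableI)
    fix U :: "real set" assume "open U"
    have "continuous_map (subtopology (Rn n) S) euclideanreal (\<lambda>x. g x i)"
      using g i unfolding Rn_def continuous_map_componentwise by auto
    from openin_continuous_map_preimage[OF this, of U] \<open>open U\<close>
    have "openin (subtopology (Rn n) S) {x \<in> S. g x i \<in> U}" unfolding ts by simp
    then have "openin (Rn n) {x \<in> S. g x i \<in> U}" using S openin_open_subtopology by blast
    then have "{x \<in> S. g x i \<in> U} \<in> sets (restrict_space (lborel_Rn n) S)"
      using sets_lborel_Rn_open Ss by (subst sets_restrict_space_iff) (auto dest: sets.sets_into_space)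
    moreover have "(\<lambda>x. g x i) -` U \<inter> space (restrict_space (lborel_Rn n) S) = {x \<in> S. g x i \<in> U}"
      using Ss sets.sets_into_space by (fastforce simp: space_restrict_space)
    ultimately show "(\<lambda>x. g x i) -` U \<inter> space (restrict_space (lborel_Rn n) S) \<in> sets (restrict_space (lborel_Rn n) S)"
      by simp
  qed
  then have "g \<in> measurable (restrict_space (lborel_Rn n) S) (lborel_Rn m)"
    using gt by (intro measurable_PiM_single') (auto simp: space_restrict_space topspace_Rn PiE_def)
  from measurable_sets[OF this E]
  have "g -` E \<inter> space (restrict_space (lborel_Rn n) S) \<in> sets (restrict_space (lborel_Rn n) S)" .
  moreover have "g -` E \<inter> space (restrict_space (lborel_Rn n) S) = {x \<in> S. g x \<in> E}"
    using Ss sets.sets_into_space by (fastforce simp: space_restrict_space)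
  ultimately show ?thesis using Ss by (simp add: sets_restrict_space_iff sets.Int_space_eq2)
qed


section \<open>Preimages of null sets under submersions\<close>

lemma continuous_finite_uniform:
  assumes S: "openin (Rn n) S" and p: "p \<in> S" and "finite I" and e: "(e::real) > 0"
    and h: "\<And>i. i \<in> I \<Longrightarrow> continuous_map (subtopology (Rn n) S) euclideanreal (h i)"
  obtains d where "d > 0" "cube n p d \<subseteq> S" "\<And>x i. x \<in> cube n p d \<Longrightarrow> i \<in> I \<Longrightarrow> \<bar>h i x - h i p\<bar> < e"
proof -
  have "\<exists>d>0. cube n p d \<subseteq> S \<and> (\<forall>x\<in>cube n p d. \<forall>i\<in>I. \<bar>h i x - h i p\<bar> < e)"
    using \<open>finite I\<close> h
  proof (induction I)
    case empty
    then show ?case using open_Rn_contains_cube[OF S p] by (metis empty_iff)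
  next
    case (insert i I)
    then obtain d where d: "d > 0" "cube n p d \<subseteq> S" "\<forall>x\<in>cube n p d. \<forall>i\<in>I. \<bar>h i x - h i p\<bar> < e"
      by auto
    have "continuous_map (subtopology (Rn n) S) euclideanreal (h i)" using insert.prems by simp
    then obtain d' where d': "d' > 0" "\<forall>x\<in>cube n p d'. \<bar>h i x - h i p\<bar> < e"
      using continuous_map_Rn_real_iff[OF S, of "h i"] p e by blast
    have "cube n p (min d d') \<subseteq> cube n p d" "cube n p (min d d') \<subseteq> cube n p d'"
      by (rule cube_mono, simp)+
    then show ?case using d d' by (intro exI[of _ "min d d'"]) auto
  qed
  then show ?thesis using that by blast
qed

text \<open>Translations are isometries, so their preimages of null sets are covered by the expanding case.\<close>

lemma null_translate:
  assumes E: "E \<in> null_Rn n"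
  shows "{x \<in> topspace (Rn n). (\<lambda>i\<in>{..<n}. x i - a i) \<in> E} \<in> null_Rn n"
proof (rule null_preimage_of_expanding_map[where c = 1, OF _ _ _ _ E])
  fix A assume A: "A \<in> borel_Rn n"
  have "(\<lambda>x. \<lambda>i\<in>{..<n}. x i - a i) \<in> measurable (lborel_Rn n) (lborel_Rn n)"
    by (rule measurable_restrict) simp
  from measurable_sets[OF this A]
  have "(\<lambda>x. \<lambda>i\<in>{..<n}. x i - a i) -` A \<inter> space (lborel_Rn n) \<in> borel_Rn n" .
  also have "(\<lambda>x. \<lambda>i\<in>{..<n}. x i - a i) -` A \<inter> space (lborel_Rn n)
      = {x \<in> topspace (Rn n). (\<lambda>i\<in>{..<n}. x i - a i) \<in> A}"
    by (auto simp: space_lborel_Rn)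
  finally show "{x \<in> topspace (Rn n). (\<lambda>i\<in>{..<n}. x i - a i) \<in> A} \<in> borel_Rn n" .
next
  fix v w :: "nat \<Rightarrow> real" and s k
  assume *: "\<And>k. k < n \<Longrightarrow> \<bar>(\<lambda>i\<in>{..<n}. v i - a i) k - (\<lambda>i\<in>{..<n}. w i - a i) k\<bar> \<le> s" and k: "k < n"
  show "\<bar>v k - w k\<bar> \<le> 1 * s" using *[OF k] k by simp
qed auto

lemma differential_right_inverse:
  assumes "differential_at n m g p ` topspace (Rn n) = topspace (Rn m)"
  obtains b where "\<And>i k. i < m \<Longrightarrow> k < m \<Longrightarrow>
    (\<Sum>j<n. partial_deriv j (\<lambda>y. g y k) p * b i j) = (if k = i then 1 else 0)"
proof -
  define u where "u i = (\<lambda>k\<in>{..<m}. if k = i then 1 else 0 :: real)" for i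
  have "u i \<in> topspace (Rn m)" for i by (simp add: topspace_Rn u_def)
  then have "\<exists>b. u i = differential_at n m g p b" for i using assms by (metis imageE)
  then obtain b where b: "\<And>i. u i = differential_at n m g p (b i)" by metis
  have "(\<Sum>j<n. partial_deriv j (\<lambda>y. g y k) p * b i j) = (if k = i then 1 else 0)" if "k < m" for i k
    using fun_cong[OF b[of i], of k] that by (simp add: differential_at_def u_def)
  then show ?thesis using that by blast
qed

text \<open>In the maximum norm: at a coordinate where \<open>v - w\<close> is largest, at least half of it survives in
  \<open>F - G\<close>.\<close>

lemma near_identity_expanding:
  fixes v w F G :: "nat \<Rightarrow> real"
  assumes near: "\<And>k t. k < m \<Longrightarrow> (\<And>i. i < m \<Longrightarrow> \<bar>v i - w i\<bar> \<le> t) \<Longrightarrow> \<bar>F k - G k - (v k - w k)\<bar> \<le> t / 2"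
    and s: "\<And>k. k < m \<Longrightarrow> \<bar>F k - G k\<bar> \<le> s" and k: "k < m"
  shows "\<bar>v k - w k\<bar> \<le> 2 * s"
proof -
  define t where "t = Max ((\<lambda>i. \<bar>v i - w i\<bar>) ` {..<m})"
  have t: "\<bar>v i - w i\<bar> \<le> t" if "i < m" for i unfolding t_def using that by (intro Max_ge) auto
  have "t \<in> (\<lambda>i. \<bar>v i - w i\<bar>) ` {..<m}" unfolding t_def using k by (intro Max_in) auto
  then obtain i where i: "i < m" "t = \<bar>v i - w i\<bar>" by auto
  have "\<bar>F i - G i - (v i - w i)\<bar> \<le> t / 2" by (rule near[OF i(1) t])
  then have "t \<le> 2 * s" using s[OF i(1)] i(2) by linarith
  then show ?thesis using t[OF k] by linarith
qed

text \<open>With a right inverse \<open>b\<close> of the differential at \<open>p\<close>, the maps \<open>v \<mapsto> g (L x v)\<close>, where \<open>L x v = x + b v\<close>,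
  have differential close to the identity for \<open>x\<close> near \<open>p\<close> and \<open>v\<close> near 0. They pull \<open>E\<close> back to a null
  set for every \<open>x\<close>, hence by Fubini some translate by \<open>b v\<close> of the preimage of \<open>E\<close> under \<open>g\<close> is null.\<close>

lemma null_preimage_submersion_local:
  assumes S: "openin (Rn n) S" and g: "smooth_on n m S g" and gS: "g ` S \<subseteq> topspace (Rn m)"
    and p: "p \<in> S" and surj: "differential_at n m g p ` topspace (Rn n) = topspace (Rn m)"
  obtains d where "d > 0" "cube n p d \<subseteq> S"
    "\<And>E. E \<in> null_Rn m \<Longrightarrow> {x \<in> cube n p d. g x \<in> E} \<in> null_Rn n"
proof -
  obtain b where b: "\<And>i k. i < m \<Longrightarrow> k < m \<Longrightarrow>
      (\<Sum>j<n. partial_deriv j (\<lambda>y. g y k) p * b i j) = (if k = i then 1 else 0)"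
    using differential_right_inverse[OF surj] by blast
  \<comment> \<open>the size of \<open>b\<close>; the summand 1 keeps it positive even for \<open>m = 0\<close>\<close>
  define B where "B = (\<Sum>i<m. \<Sum>j<n. \<bar>b i j\<bar>) + 1"
  have B: "B > 0" unfolding B_def by (intro add_nonneg_pos sum_nonneg) auto
  have smooth1: "Ck_on (Suc 0) n S (\<lambda>y. g y k)" if "k < m" for k
    using g that unfolding smooth_on_def by blast
  obtain d where d: "d > 0" "cube n p d \<subseteq> S"
    and pd: "\<And>x i. x \<in> cube n p d \<Longrightarrow> i \<in> {..<n} \<times> {..<m} \<Longrightarrow>
      \<bar>partial_deriv (fst i) (\<lambda>y. g y (snd i)) x - partial_deriv (fst i) (\<lambda>y. g y (snd i)) p\<bar> < 1 / (2 * B)"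
  proof (rule continuous_finite_uniform[OF S p, of "{..<n} \<times> {..<m}" "1 / (2 * B)"
        "\<lambda>i. partial_deriv (fst i) (\<lambda>y. g y (snd i))"])
    show "continuous_map (subtopology (Rn n) S) euclideanreal (partial_deriv (fst i) (\<lambda>y. g y (snd i)))"
      if "i \<in> {..<n} \<times> {..<m}" for i
      using smooth1[of "snd i"] that by auto
  qed (use B in auto)
  define L where "L = (\<lambda>x v. \<lambda>j\<in>{..<n}. x j + (\<Sum>i<m. v i * b i j))"
  \<comment> \<open>so small that \<open>b v\<close> stays below \<open>d / 4\<close> for \<open>v\<close> in the cube \<open>V\<close> of radius \<open>r\<close>\<close>
  define r where "r = d / (4 * B)"
  have r: "r > 0" using d B by (simp add: r_def)
  define V where "V = cube m (\<lambda>_. 0) r"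
  have small: "\<bar>\<Sum>i<m. v i * b i j\<bar> < d / 4" if v: "v \<in> V" and j: "j < n" for v j
  proof -
    have "\<bar>v i\<bar> \<le> r" if "i < m" for i using v that by (simp add: V_def cube_def less_imp_le)
    then have "\<bar>\<Sum>i<m. v i * b i j\<bar> \<le> (\<Sum>i<m. r * \<bar>b i j\<bar>)"
      by (intro order_trans[OF sum_abs] sum_mono) (auto simp: abs_mult intro!: mult_right_mono)
    also have "\<dots> \<le> (\<Sum>i<m. r * (\<Sum>j<n. \<bar>b i j\<bar>))"
      using r j by (intro sum_mono mult_left_mono member_le_sum) auto
    also have "\<dots> = r * (B - 1)" by (simp add: B_def sum_distrib_left)
    also have "\<dots> < r * B" using r by simp
    also have "\<dots> = d / 4" using B by (simp add: r_def)
    finally show ?thesis .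
  qed
  have L_cube: "L x v \<in> cube n p d" if "x \<in> cube n p (d / 2)" "v \<in> V" for x v
  proof -
    have "\<bar>L x v j - p j\<bar> < d" if j: "j < n" for j
    proof -
      have "\<bar>x j - p j\<bar> < d / 2" using \<open>x \<in> cube n p (d / 2)\<close> j by (auto simp: cube_def)
      moreover have "L x v j = x j + (\<Sum>i<m. v i * b i j)" using j by (simp add: L_def)
      ultimately show ?thesis using small[OF \<open>v \<in> V\<close> j] d(1) by linarith
    qed
    then show ?thesis by (simp add: cube_def topspace_Rn L_def)
  qed
  have expanding: "\<bar>v k - w k\<bar> \<le> 2 * s"
    if x: "x \<in> cube n p (d / 2)" and v: "v \<in> V" and w: "w \<in> V"
      and s: "\<And>k. k < m \<Longrightarrow> \<bar>g (L x v) k - g (L x w) k\<bar> \<le> s" and k: "k < m" for x v w s k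
  proof (rule near_identity_expanding[OF _ s k])
    fix k t assume k: "k < m" and t: "\<And>i. i < m \<Longrightarrow> \<bar>v i - w i\<bar> \<le> t"
    have t0: "t \<ge> 0" using t[OF k] by linarith
    obtain \<xi> where \<xi>: "\<And>j. j < n \<Longrightarrow> \<xi> j \<in> cube n p d"
      and "\<And>i j. j < n \<Longrightarrow> i < n \<Longrightarrow> \<xi> j i \<in> closed_segment (L x w i) (L x v i)"
      and \<xi>_eq: "g (L x v) k - g (L x w) k = (\<Sum>j<n. partial_deriv j (\<lambda>y. g y k) (\<xi> j) * (L x v j - L x w j))"
      by (rule mean_value[OF smooth1[OF k] d(2) L_cube[OF x w] L_cube[OF x v]]) (rule that)
    have "L x v j - L x w j = (\<Sum>i<m. (v i - w i) * b i j)" if "j < n" for j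
      using that by (simp add: L_def left_diff_distrib sum_subtractf)
    with \<xi>_eq have "g (L x v) k - g (L x w) k = (\<Sum>j<n. partial_deriv j (\<lambda>y. g y k) (\<xi> j) * (\<Sum>i<m. (v i - w i) * b i j))"
      by simp
    moreover have "v k - w k = (\<Sum>j<n. partial_deriv j (\<lambda>y. g y k) p * (\<Sum>i<m. (v i - w i) * b i j))"
    proof -
      have "(\<Sum>j<n. partial_deriv j (\<lambda>y. g y k) p * (\<Sum>i<m. (v i - w i) * b i j))
          = (\<Sum>j<n. \<Sum>i<m. (v i - w i) * (partial_deriv j (\<lambda>y. g y k) p * b i j))"
        by (simp add: sum_distrib_left mult_ac)
      also have "\<dots> = (\<Sum>i<m. \<Sum>j<n. (v i - w i) * (partial_deriv j (\<lambda>y. g y k) p * b i j))"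
        by (rule sum.swap)
      also have "\<dots> = (\<Sum>i<m. (v i - w i) * (if k = i then 1 else 0))"
        using k by (simp add: b flip: sum_distrib_left)
      also have "\<dots> = v k - w k" using k by (simp add: if_distrib[of "\<lambda>c. _ * c"] cong: if_cong)
      finally show ?thesis by simp
    qed
    ultimately have "\<bar>g (L x v) k - g (L x w) k - (v k - w k)\<bar>
        = \<bar>\<Sum>j<n. (partial_deriv j (\<lambda>y. g y k) (\<xi> j) - partial_deriv j (\<lambda>y. g y k) p) * (\<Sum>i<m. (v i - w i) * b i j)\<bar>"
      by (simp add: left_diff_distrib sum_subtractf)
    also have "\<dots> \<le> (\<Sum>j<n. 1 / (2 * B) * (\<Sum>i<m. t * \<bar>b i j\<bar>))"
    proof (intro order_trans[OF sum_abs] sum_mono)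
      fix j assume "j \<in> {..<n}"
      then have "\<bar>partial_deriv j (\<lambda>y. g y k) (\<xi> j) - partial_deriv j (\<lambda>y. g y k) p\<bar> \<le> 1 / (2 * B)"
        using pd[OF \<xi>, of j "(j, k)"] k by simp
      moreover have "\<bar>\<Sum>i<m. (v i - w i) * b i j\<bar> \<le> (\<Sum>i<m. t * \<bar>b i j\<bar>)"
        using t by (intro order_trans[OF sum_abs] sum_mono) (auto simp: abs_mult intro!: mult_right_mono)
      ultimately show "\<bar>(partial_deriv j (\<lambda>y. g y k) (\<xi> j) - partial_deriv j (\<lambda>y. g y k) p) * (\<Sum>i<m. (v i - w i) * b i j)\<bar>
          \<le> 1 / (2 * B) * (\<Sum>i<m. t * \<bar>b i j\<bar>)"
        unfolding abs_mult using B by (intro mult_mono) auto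
    qed
    also have "\<dots> = 1 / (2 * B) * (t * (\<Sum>j<n. \<Sum>i<m. \<bar>b i j\<bar>))"
      by (simp add: sum_distrib_left)
    also have "(\<Sum>j<n. \<Sum>i<m. \<bar>b i j\<bar>) = B - 1" unfolding B_def by (subst sum.swap) simp
    also have "1 / (2 * B) * (t * (B - 1)) \<le> 1 / (2 * B) * (t * B)"
      using B t0 by (intro mult_left_mono) auto
    also have "\<dots> = t / 2" using B by simp
    finally show "\<bar>g (L x v) k - g (L x w) k - (v k - w k)\<bar> \<le> t / 2" .
  qed
  show ?thesis
  proof (rule that[of "d / 4"])
    show "d / 4 > 0" using d by simp
    have sub: "cube n p (d / 4) \<subseteq> cube n p d" using d(1) by (intro cube_mono) simp
    then show "cube n p (d / 4) \<subseteq> S" using d(2) by blast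
    fix E assume E: "E \<in> null_Rn m"
    define Y where "Y = {y \<in> cube n p d. g y \<in> E}"
    have gc: "continuous_map (subtopology (Rn n) (cube n p d')) (Rn m) g" if "cube n p d' \<subseteq> S" for d'
      using smooth_on_continuous_map[OF smooth_on_subset[OF g that]] gS that by blast
    have Y: "Y \<in> borel_Rn n"
      unfolding Y_def by (rule sets_preimage_Rn[OF openin_cube gc[OF d(2)]]) (use E in auto)
    interpret N: sigma_finite_measure "lborel_Rn n" by (rule sigma_finite_lborel_Rn)
    interpret M: sigma_finite_measure "lborel_Rn m" by (rule sigma_finite_lborel_Rn)
    interpret NM: pair_sigma_finite "lborel_Rn n" "lborel_Rn m" ..
    have L_meas: "(\<lambda>(x, v). L x v) \<in> measurable (lborel_Rn n \<Otimes>\<^sub>M lborel_Rn m) (lborel_Rn n)"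
      unfolding L_def split_beta by (rule measurable_restrict) simp
    define Q where "Q = cube n p (d / 2)"
    have Qs: "Q \<in> borel_Rn n" unfolding Q_def by (rule sets_lborel_Rn_open[OF openin_cube])
    have Vs: "V \<in> borel_Rn m" unfolding V_def by (rule sets_lborel_Rn_open[OF openin_cube])
    define H where "H = ((\<lambda>(x, v). L x v) -` Y \<inter> space (lborel_Rn n \<Otimes>\<^sub>M lborel_Rn m)) \<inter> Q \<times> V"
    have Hs: "H \<in> sets (lborel_Rn n \<Otimes>\<^sub>M lborel_Rn m)"
      unfolding H_def using Qs Vs by (intro sets.Int measurable_sets[OF L_meas Y] pair_measureI)
    have Hmem: "(x, v) \<in> H \<longleftrightarrow> x \<in> Q \<and> v \<in> V \<and> g (L x v) \<in> E" for x v
      using L_cube[of x v] sets.sets_into_space[OF Qs] sets.sets_into_space[OF Vs]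
      by (auto simp: H_def Y_def Q_def space_pair_measure)
    \<comment> \<open>the fibre over \<open>x\<close> is the preimage of \<open>E\<close> under a map close to the identity\<close>
    have slice: "leb m (Pair x -` H) = 0" for x
    proof (cases "x \<in> Q")
      case True
      have "{v \<in> V. g (L x v) \<in> E} \<in> null_Rn m"
      proof (rule null_preimage_of_expanding_map[where c = 2, OF _ _ _ _ E])
        show "V \<subseteq> topspace (Rn m)" by (auto simp: V_def cube_def)
        show "{v \<in> V. g (L x v) \<in> A} \<in> borel_Rn m" if A: "A \<in> borel_Rn m" for A
        proof -
          have xs: "x \<in> space (lborel_Rn n)" using True sets.sets_into_space[OF Qs] by auto
          have "{y \<in> cube n p d. g y \<in> A} \<in> borel_Rn n"
            by (rule sets_preimage_Rn[OF openin_cube gc[OF d(2)] A])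
          moreover have "(\<lambda>v. L x v) \<in> measurable (lborel_Rn m) (lborel_Rn n)"
            unfolding L_def by (rule measurable_restrict) simp
          ultimately have "(\<lambda>v. L x v) -` {y \<in> cube n p d. g y \<in> A} \<inter> space (lborel_Rn m) \<in> borel_Rn m"
            by (rule measurable_sets[rotated])
          then have "((\<lambda>v. L x v) -` {y \<in> cube n p d. g y \<in> A} \<inter> space (lborel_Rn m)) \<inter> V \<in> borel_Rn m"
            using Vs by blast
          also have "((\<lambda>v. L x v) -` {y \<in> cube n p d. g y \<in> A} \<inter> space (lborel_Rn m)) \<inter> V = {v \<in> V. g (L x v) \<in> A}"
            using L_cube[OF True[unfolded Q_def]] sets.sets_into_space[OF Vs] by auto
          finally show ?thesis .
        qed
        show "\<bar>v k - w k\<bar> \<le> 2 * s"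
          if "v \<in> V" "w \<in> V" "\<And>k. k < m \<Longrightarrow> \<bar>g (L x v) k - g (L x w) k\<bar> \<le> s" "k < m" for v w s k
          using expanding[OF True[unfolded Q_def] that] .
      qed simp
      moreover have "Pair x -` H = {v \<in> V. g (L x v) \<in> E}" using True Hmem by auto
      ultimately show ?thesis by auto
    next
      case False
      then have "Pair x -` H = {}" using Hmem by auto
      then show ?thesis by simp
    qed
    have "emeasure (lborel_Rn n \<Otimes>\<^sub>M lborel_Rn m) H = 0"
      using M.emeasure_pair_measure_alt[OF Hs] slice by simp
    then have "(\<integral>\<^sup>+ v. leb n ((\<lambda>x. (x, v)) -` H) \<partial>lborel_Rn m) = 0"
      using NM.emeasure_pair_measure_alt2[OF Hs] by simp
    then have AE: "AE v in lborel_Rn m. leb n ((\<lambda>x. (x, v)) -` H) = 0"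
      using NM.measurable_emeasure_Pair2[OF Hs] by (simp add: nn_integral_0_iff_AE)
    \<comment> \<open>almost every \<open>v\<close> has a null fibre, and \<open>V\<close> has positive measure\<close>
    obtain v where v: "v \<in> V" "leb n ((\<lambda>x. (x, v)) -` H) = 0"
    proof (rule ccontr)
      assume "\<not> thesis"
      then have "AE v in lborel_Rn m. v \<notin> V" using AE that by (auto elim!: eventually_mono)
      then have "leb m V = 0" using AE_iff_null_sets[OF Vs] by auto
      then show False using r by (simp add: V_def emeasure_cube)
    qed
    have "(\<lambda>x. (x, v)) -` H \<in> null_Rn n"
      using v(2) sets_Pair2[OF Hs, of v] by (simp add: null_sets_def)
    then have N0: "{x \<in> topspace (Rn n). (\<lambda>j\<in>{..<n}. x j - (\<Sum>i<m. v i * b i j)) \<in> (\<lambda>x. (x, v)) -` H} \<in> null_Rn n"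
      by (rule null_translate)
    have "{x \<in> cube n p (d / 4). g x \<in> E}
        \<subseteq> {x \<in> topspace (Rn n). (\<lambda>j\<in>{..<n}. x j - (\<Sum>i<m. v i * b i j)) \<in> (\<lambda>x. (x, v)) -` H}"
    proof
      fix y assume y: "y \<in> {x \<in> cube n p (d / 4). g x \<in> E}"
      define x where "x = (\<lambda>j\<in>{..<n}. y j - (\<Sum>i<m. v i * b i j))"
      have yt: "y \<in> topspace (Rn n)" using y by (auto simp: cube_def)
      have Lx: "L x v = y" using yt by (auto simp: L_def x_def topspace_Rn extensional_def fun_eq_iff)
      have "\<bar>x j - p j\<bar> < d / 2" if j: "j < n" for j
      proof -
        have "\<bar>y j - p j\<bar> < d / 4" using y j by (auto simp: cube_def)
        moreover have "x j = y j - (\<Sum>i<m. v i * b i j)" using j by (simp add: x_def)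
        ultimately show ?thesis using small[OF v(1) j] by linarith
      qed
      then have "x \<in> Q" by (simp add: Q_def cube_def topspace_Rn x_def)
      then have "(x, v) \<in> H" using v(1) y Lx by (simp add: Hmem)
      then show "y \<in> {x \<in> topspace (Rn n). (\<lambda>j\<in>{..<n}. x j - (\<Sum>i<m. v i * b i j)) \<in> (\<lambda>x. (x, v)) -` H}"
        using yt by (simp add: x_def)
    qed
    moreover have "{x \<in> cube n p (d / 4). g x \<in> E} \<in> borel_Rn n"
      by (rule sets_preimage_Rn[OF openin_cube gc]) (use sub d(2) E in auto)
    ultimately show "{x \<in> cube n p (d / 4). g x \<in> E} \<in> null_Rn n"
      by (rule null_sets_subset[OF N0, rotated])
  qed
qed

lemma null_preimage_submersion:
  assumes S: "openin (Rn n) S" and g: "smooth_on n m S g" and gS: "g ` S \<subseteq> topspace (Rn m)"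
    and surj: "\<And>p. p \<in> S \<Longrightarrow> differential_at n m g p ` topspace (Rn n) = topspace (Rn m)"
    and A: "compactin (Rn n) A" "A \<subseteq> S" and E: "E \<in> null_Rn m"
  shows "{x \<in> A. g x \<in> E} \<in> null_Rn n"
proof -
  have "\<exists>d. d > 0 \<and> {x \<in> cube n p d. g x \<in> E} \<in> null_Rn n" if pA: "p \<in> A" for p
  proof -
    have pS: "p \<in> S" using pA A(2) by blast
    obtain d where "d > 0" "cube n p d \<subseteq> S"
      "\<And>E. E \<in> null_Rn m \<Longrightarrow> {x \<in> cube n p d. g x \<in> E} \<in> null_Rn n"
      by (rule null_preimage_submersion_local[OF S g gS pS surj[OF pS]]) (rule that)
    then show ?thesis using E by (intro exI[of _ d]) simp
  qed
  then obtain d where d: "\<And>p. p \<in> A \<Longrightarrow> d p > 0 \<and> {x \<in> cube n p (d p). g x \<in> E} \<in> null_Rn n"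
    by metis
  define \<C> where "\<C> = (\<lambda>p. cube n p (d p)) ` A"
  have "A \<subseteq> \<Union>((\<lambda>p. cube n p (d p)) ` A)"
    using d centre_in_cube compactin_subset_topspace[OF A(1)] by blast
  then have cover: "A \<subseteq> \<Union>\<C>" by (simp add: \<C>_def)
  have "openin (Rn n) U" if "U \<in> \<C>" for U
    using that openin_cube by (auto simp: \<C>_def)
  from compactinD[OF A(1) this cover]
  obtain \<F> where F: "finite \<F>" "\<F> \<subseteq> \<C>" "A \<subseteq> \<Union>\<F>" by auto
  have "{x \<in> A. g x \<in> E} = A \<inter> (\<Union>C\<in>\<F>. {x \<in> C. g x \<in> E})" using F(3) by auto
  moreover have "(\<Union>C\<in>\<F>. {x \<in> C. g x \<in> E}) \<in> null_Rn n"
    using F d by (intro null_sets_UN' countable_finite) (auto simp: \<C>_def)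
  ultimately show ?thesis using sets_lborel_Rn_compact[OF A(1)] by (simp add: null_set_Int1)
qed


section \<open>Frames of sets ordered by inclusion\<close>

abbreviation subset_order :: "'a set set \<Rightarrow> 'a set gorder"
  where "subset_order C \<equiv> \<lparr>carrier = C, eq = (=), le = (\<subseteq>)\<rparr>"

lemma subset_order_sup_eqI:
  assumes g: "g \<in> C" "\<And>a. a \<in> A \<Longrightarrow> a \<subseteq> g" and least: "\<And>x. x \<in> C \<Longrightarrow> \<forall>a\<in>A. a \<subseteq> x \<Longrightarrow> g \<subseteq> x"
    and "A \<subseteq> C"
  shows "\<Squnion>\<^bsub>subset_order C\<^esub>A = g"
  unfolding sup_def
proof (rule some_equality)
  show *: "least (subset_order C) g (Upper (subset_order C) A)"
    unfolding least_def
  proof (intro conjI ballI)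
    show "Upper (subset_order C) A \<subseteq> carrier (subset_order C)" by (simp add: Upper_def)
    show "g \<in> Upper (subset_order C) A" using g by (simp add: Upper_def)
    show "g \<sqsubseteq>\<^bsub>subset_order C\<^esub> x" if "x \<in> Upper (subset_order C) A" for x
    proof -
      have "x \<in> C" "\<forall>a\<in>A. a \<subseteq> x" using that \<open>A \<subseteq> C\<close> by (auto simp: Upper_def)
      then show ?thesis using least[of x] by simp
    qed
  qed
  show "x = g" if "least (subset_order C) x (Upper (subset_order C) A)" for x
    using that * by (auto simp: least_def)
qed

lemma subset_order_inf_eqI:
  assumes g: "g \<in> C" "\<And>a. a \<in> A \<Longrightarrow> g \<subseteq> a" and greatest: "\<And>x. x \<in> C \<Longrightarrow> \<forall>a\<in>A. x \<subseteq> a \<Longrightarrow> x \<subseteq> g"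
    and "A \<subseteq> C"
  shows "\<Sqinter>\<^bsub>subset_order C\<^esub>A = g"
  unfolding inf_def
proof (rule some_equality)
  show *: "greatest (subset_order C) g (Lower (subset_order C) A)"
    unfolding greatest_def
  proof (intro conjI ballI)
    show "Lower (subset_order C) A \<subseteq> carrier (subset_order C)" by (simp add: Lower_def)
    show "g \<in> Lower (subset_order C) A" using g by (simp add: Lower_def)
    show "x \<sqsubseteq>\<^bsub>subset_order C\<^esub> g" if "x \<in> Lower (subset_order C) A" for x
    proof -
      have "x \<in> C" "\<forall>a\<in>A. x \<subseteq> a" using that \<open>A \<subseteq> C\<close> by (auto simp: Lower_def)
      then show ?thesis using greatest[of x] by simp
    qed
  qed
  show "x = g" if "greatest (subset_order C) x (Lower (subset_order C) A)" for x
    using that * by (auto simp: greatest_def)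
qed

lemma subset_order_meet:
  assumes "U \<in> C" "V \<in> C" "U \<inter> V \<in> C"
  shows "U \<sqinter>\<^bsub>subset_order C\<^esub> V = U \<inter> V"
  unfolding meet_def by (rule subset_order_inf_eqI) (use assms in auto)

lemma subset_order_top:
  assumes "T \<in> C" "\<And>x. x \<in> C \<Longrightarrow> x \<subseteq> T"
  shows "\<top>\<^bsub>subset_order C\<^esub> = T"
  unfolding top_def by (rule some_equality) (use assms in \<open>auto simp: greatest_def\<close>)

lemma subset_order_bottom:
  assumes "T \<in> C" "\<And>x. x \<in> C \<Longrightarrow> T \<subseteq> x"
  shows "\<bottom>\<^bsub>subset_order C\<^esub> = T"
  unfolding bottom_def by (rule some_equality) (use assms in \<open>auto simp: least_def\<close>)

lemma complete_lattice_subset_orderI: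
  assumes inter: "\<And>A. A \<subseteq> C \<Longrightarrow> A \<noteq> {} \<Longrightarrow> \<Inter>A \<in> C"
    and top: "T \<in> C" "\<And>x. x \<in> C \<Longrightarrow> x \<subseteq> T"
  shows "complete_lattice (subset_order C)"
proof -
  interpret partial_order "subset_order C"
    by unfold_locales auto
  show ?thesis
  proof (rule complete_lattice_criterion1)
    show "\<exists>g. greatest (subset_order C) g (carrier (subset_order C))"
      using top by (intro exI[of _ T]) (auto simp: greatest_def)
    fix A assume A: "A \<subseteq> carrier (subset_order C)" "A \<noteq> {}"
    then show "\<exists>i. greatest (subset_order C) i (Lower (subset_order C) A)"
      using inter[of A] by (intro exI[of _ "\<Inter>A"]) (auto simp: greatest_def Lower_def)
  qed
qed


section \<open>Ideals of compact sets orthogonal to a set of compact sets\<close>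

text \<open>This is the Heyting implication \<open>I \<rightarrow> N\<close> when \<open>I\<close> is an ideal; defining it for every set of compact
  sets makes it one half of a Galois connection, so that double \<open>perp\<close> is a closure operator.\<close>

definition perp :: "'a topology \<Rightarrow> 'a set set \<Rightarrow> 'a set set \<Rightarrow> 'a set set"
  where "perp X N I = {K \<in> compacts X. \<forall>K' \<in> I. K \<inter> K' \<in> N}"

definition regular_ideals :: "'a topology \<Rightarrow> 'a set set \<Rightarrow> 'a set set set"
  where "regular_ideals X N = perp X N ` compact_ideals X"

locale null_compacts =
  fixes X :: "'a topology" and N :: "'a set set"
  assumes Hausdorff: "Hausdorff_space X" and null_ideal: "N \<in> compact_ideals X"
begin

abbreviation "orth \<equiv> perp X N"
abbreviation "dperp I \<equiv> perp X N (perp X N I)"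
abbreviation "R \<equiv> subset_order (regular_ideals X N)"

lemma compacts_Int: "K \<in> compacts X \<Longrightarrow> K' \<in> compacts X \<Longrightarrow> K \<inter> K' \<in> compacts X"
  using Hausdorff by (simp add: compacts_def compactin_Int)

lemma null_down: "K \<in> N \<Longrightarrow> K' \<in> compacts X \<Longrightarrow> K' \<subseteq> K \<Longrightarrow> K' \<in> N"
  using null_ideal by (auto simp: compact_ideals_def)

lemma null_Un: "K \<in> N \<Longrightarrow> K' \<in> N \<Longrightarrow> K \<union> K' \<in> N"
  using null_ideal by (auto simp: compact_ideals_def)

lemma null_empty: "{} \<in> N"
  using null_ideal by (auto simp: compact_ideals_def)

lemma null_compact: "K \<in> N \<Longrightarrow> K \<in> compacts X"
  using null_ideal by (auto simp: compact_ideals_def)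

lemma ideal_down: "I \<in> compact_ideals X \<Longrightarrow> K \<in> I \<Longrightarrow> K' \<in> compacts X \<Longrightarrow> K' \<subseteq> K \<Longrightarrow> K' \<in> I"
  by (auto simp: compact_ideals_def)

lemma ideal_compact: "I \<in> compact_ideals X \<Longrightarrow> K \<in> I \<Longrightarrow> K \<in> compacts X"
  by (auto simp: compact_ideals_def)

lemma ideal_Un: "I \<in> compact_ideals X \<Longrightarrow> K \<in> I \<Longrightarrow> K' \<in> I \<Longrightarrow> K \<union> K' \<in> I"
  by (auto simp: compact_ideals_def)

lemma perp_ideal:
  assumes "I \<subseteq> compacts X" shows "orth I \<in> compact_ideals X"
  unfolding compact_ideals_def
proof (intro CollectI conjI ballI impI)
  show "orth I \<subseteq> compacts X" by (auto simp: perp_def)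
  show "{} \<in> orth I" using null_empty by (auto simp: perp_def compacts_def)
  show "K \<union> K' \<in> orth I" if "K \<in> orth I" "K' \<in> orth I" for K K'
    using that by (simp add: perp_def compacts_def compactin_Un Int_Un_distrib2 null_Un)
  show "K' \<in> orth I" if K: "K \<in> orth I" "K' \<in> compacts X" "K' \<subseteq> K" for K K'
  proof -
    have "K' \<inter> L \<in> N" if "L \<in> I" for L
    proof (rule null_down)
      show "K \<inter> L \<in> N" using K(1) that by (simp add: perp_def)
      show "K' \<inter> L \<in> compacts X" using K(2) that assms by (intro compacts_Int) auto
    qed (use K(3) in blast)
    then show ?thesis using K(2) by (simp add: perp_def)
  qed
qed

lemma perp_compacts: "orth I \<subseteq> compacts X"
  by (auto simp: perp_def)

lemma perp_antimono: "I \<subseteq> J \<Longrightarrow> orth J \<subseteq> orth I"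
  by (auto simp: perp_def)

lemma dperp_mono: "I \<subseteq> J \<Longrightarrow> dperp I \<subseteq> dperp J"
  by (intro perp_antimono)

lemma dperp_ext: "I \<subseteq> compacts X \<Longrightarrow> I \<subseteq> dperp I"
  by (auto simp: perp_def Int_commute)

lemma perp_dperp: "I \<subseteq> compacts X \<Longrightarrow> dperp (orth I) = orth I"
  by (intro antisym perp_antimono dperp_ext perp_compacts)

lemma regular_iff: "J \<in> regular_ideals X N \<longleftrightarrow> J \<subseteq> compacts X \<and> dperp J = J"
proof
  assume "J \<in> regular_ideals X N"
  then obtain I where "I \<in> compact_ideals X" and J: "J = orth I"
    by (auto simp: regular_ideals_def)
  then have "I \<subseteq> compacts X" using ideal_compact by blast
  then show "J \<subseteq> compacts X \<and> dperp J = J"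
    unfolding J by (simp add: perp_compacts perp_dperp)
next
  assume "J \<subseteq> compacts X \<and> dperp J = J"
  then have "orth J \<in> compact_ideals X" "J = dperp J" by (simp_all add: perp_ideal perp_compacts)
  then show "J \<in> regular_ideals X N"
    unfolding regular_ideals_def by (rule rev_image_eqI)
qed

lemma regular_compacts: "J \<in> regular_ideals X N \<Longrightarrow> J \<subseteq> compacts X"
  by (simp add: regular_iff)

lemma perp_regular: "I \<subseteq> compacts X \<Longrightarrow> orth I \<in> regular_ideals X N"
  by (simp add: regular_iff perp_dperp perp_compacts)

lemma dperp_regular: "dperp I \<in> regular_ideals X N"
  by (simp add: perp_regular perp_compacts)

lemma regular_ideal: "J \<in> regular_ideals X N \<Longrightarrow> J \<in> compact_ideals X"
  using perp_ideal[OF perp_compacts, of J] by (simp add: regular_iff)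

lemma dperp_least: "I \<subseteq> J \<Longrightarrow> J \<in> regular_ideals X N \<Longrightarrow> dperp I \<subseteq> J"
  using dperp_mono[of I J] by (simp add: regular_iff)

lemma perp_empty: "orth {} = compacts X"
  by (auto simp: perp_def)

lemma perp_all: "orth (compacts X) = N"
proof
  show "orth (compacts X) \<subseteq> N"
    by (force simp: perp_def)
  show "N \<subseteq> orth (compacts X)"
    unfolding perp_def using null_down compacts_Int null_compact Int_lower1 by blast
qed

lemma compacts_regular: "compacts X \<in> regular_ideals X N"
  using perp_regular[of "{}"] by (simp add: perp_empty)

lemma null_regular: "N \<in> regular_ideals X N"
  using perp_regular[of "compacts X"] by (simp add: perp_all)

lemma null_subset_regular: "J \<in> regular_ideals X N \<Longrightarrow> N \<subseteq> J"
  using perp_antimono[OF perp_compacts, of J] by (simp add: regular_iff perp_all)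

lemma regular_Inter:
  assumes "A \<subseteq> regular_ideals X N" "A \<noteq> {}" shows "\<Inter>A \<in> regular_ideals X N"
proof -
  have c: "\<Inter>A \<subseteq> compacts X" using assms regular_compacts by blast
  moreover have "dperp (\<Inter>A) \<subseteq> \<Inter>A"
    using assms(1) by (intro Inter_greatest dperp_least Inter_lower) auto
  ultimately show ?thesis using dperp_ext[OF c] by (simp add: regular_iff subset_antisym)
qed

lemma regular_Int: "U \<in> regular_ideals X N \<Longrightarrow> V \<in> regular_ideals X N \<Longrightarrow> U \<inter> V \<in> regular_ideals X N"
  using regular_Inter[of "{U, V}"] by simp

lemma R_complete_lattice: "complete_lattice R"
proof (rule complete_lattice_subset_orderI)
  show "\<Inter>A \<in> regular_ideals X N" if "A \<subseteq> regular_ideals X N" "A \<noteq> {}" for A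
    using that by (rule regular_Inter)
  show "compacts X \<in> regular_ideals X N" by (rule compacts_regular)
  show "J \<subseteq> compacts X" if "J \<in> regular_ideals X N" for J
    using that by (rule regular_compacts)
qed

lemma R_sup:
  assumes A: "A \<subseteq> regular_ideals X N" shows "\<Squnion>\<^bsub>R\<^esub>A = dperp (\<Union>A)"
proof (rule subset_order_sup_eqI)
  have "\<Union>A \<subseteq> compacts X" using A regular_compacts by blast
  then show "a \<subseteq> dperp (\<Union>A)" if "a \<in> A" for a
    using dperp_ext[of "\<Union>A"] that by blast
  show "dperp (\<Union>A) \<subseteq> x" if "x \<in> regular_ideals X N" "\<forall>a\<in>A. a \<subseteq> x" for x
    using that by (intro dperp_least Sup_least) auto
  show "dperp (\<Union>A) \<in> regular_ideals X N" by (rule dperp_regular)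
qed (rule A)

lemma R_join: "U \<in> regular_ideals X N \<Longrightarrow> V \<in> regular_ideals X N \<Longrightarrow> U \<squnion>\<^bsub>R\<^esub> V = dperp (U \<union> V)"
  by (simp add: join_def R_sup)

lemma R_meet: "U \<in> regular_ideals X N \<Longrightarrow> V \<in> regular_ideals X N \<Longrightarrow> U \<sqinter>\<^bsub>R\<^esub> V = U \<inter> V"
  by (simp add: subset_order_meet regular_Int)

lemma R_top: "\<top>\<^bsub>R\<^esub> = compacts X"
  by (rule subset_order_top[OF compacts_regular regular_compacts])

lemma R_bottom: "\<bottom>\<^bsub>R\<^esub> = N"
  by (rule subset_order_bottom[OF null_regular null_subset_regular])

text \<open>If \<open>K\<close> is in the left-hand side and \<open>Q\<close> is orthogonal to all \<open>V \<inter> U\<close>, then \<open>K \<inter> Q\<close> is orthogonal to every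
  \<open>U\<close>, since \<open>K\<close> meets the members of \<open>U\<close> in members of \<open>V \<inter> U\<close>. So \<open>K \<inter> (K \<inter> Q)\<close> is null. This is the
  frame distributive law.\<close>

lemma Int_dperp_Union:
  assumes V: "V \<in> compact_ideals X" and A: "\<And>U. U \<in> A \<Longrightarrow> U \<in> compact_ideals X"
  shows "V \<inter> dperp (\<Union>A) \<subseteq> dperp (\<Union>U\<in>A. V \<inter> U)"
proof
  fix K assume K: "K \<in> V \<inter> dperp (\<Union>A)"
  then have Kc: "K \<in> compacts X" by (auto simp: perp_def)
  have "K \<inter> Q \<in> N" if Q: "Q \<in> orth (\<Union>U\<in>A. V \<inter> U)" for Q
  proof -
    have Qc: "Q \<in> compacts X" using Q by (auto simp: perp_def)
    have "K \<inter> Q \<inter> K' \<in> N" if "U \<in> A" "K' \<in> U" for U K'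
    proof -
      have K'c: "K' \<in> compacts X" using A ideal_compact that by auto
      have "K \<inter> K' \<in> V \<inter> U"
        using ideal_down[OF V, of K "K \<inter> K'"] ideal_down[OF A[OF \<open>U \<in> A\<close>] \<open>K' \<in> U\<close>, of "K \<inter> K'"] K
          compacts_Int[OF Kc K'c] by auto
      then have "Q \<inter> (K \<inter> K') \<in> N" using Q \<open>U \<in> A\<close> by (auto simp: perp_def)
      then show ?thesis by (simp add: ac_simps)
    qed
    then have "K \<inter> Q \<in> orth (\<Union>A)"
      using compacts_Int[OF Kc Qc] by (auto simp: perp_def)
    then have "K \<inter> (K \<inter> Q) \<in> N" using K by (auto simp: perp_def)
    then show ?thesis by simp
  qed
  then show "K \<in> dperp (\<Union>U\<in>A. V \<inter> U)"
    using Kc by (auto simp: perp_def)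
qed

lemma R_frame: "frame R"
proof -
  interpret complete_lattice R by (rule R_complete_lattice)
  show ?thesis
  proof
    fix V A assume VA: "V \<in> carrier R" "A \<subseteq> carrier R"
    then have V: "V \<in> regular_ideals X N" and A: "A \<subseteq> regular_ideals X N" by auto
    have im: "(\<lambda>U. V \<sqinter>\<^bsub>R\<^esub> U) ` A = (\<lambda>U. V \<inter> U) ` A"
      using V A by (intro image_cong) (auto simp: R_meet)
    have sub: "(\<lambda>U. V \<inter> U) ` A \<subseteq> regular_ideals X N"
      using V A by (auto simp: regular_Int)
    have "V \<inter> dperp (\<Union>A) = dperp (\<Union>U\<in>A. V \<inter> U)"
    proof
      show "V \<inter> dperp (\<Union>A) \<subseteq> dperp (\<Union>U\<in>A. V \<inter> U)"
        by (rule Int_dperp_Union) (use V A regular_ideal in auto)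
      show "dperp (\<Union>U\<in>A. V \<inter> U) \<subseteq> V \<inter> dperp (\<Union>A)"
        using V dperp_least[of "\<Union>U\<in>A. V \<inter> U" V] dperp_mono[of "\<Union>U\<in>A. V \<inter> U" "\<Union>A"] by auto
    qed
    then show "V \<sqinter>\<^bsub>R\<^esub> \<Squnion>\<^bsub>R\<^esub>A = \<Squnion>\<^bsub>R\<^esub>((\<lambda>U. V \<sqinter>\<^bsub>R\<^esub> U) ` A)"
      unfolding im R_sup[OF sub] R_sup[OF A] R_meet[OF V dperp_regular] .
  qed
qed

lemma dperp_Int:
  assumes "A \<in> compact_ideals X" "B \<in> compact_ideals X"
  shows "dperp (A \<inter> B) = dperp A \<inter> dperp B"
proof
  show "dperp (A \<inter> B) \<subseteq> dperp A \<inter> dperp B"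
    using dperp_mono by simp
  have "A \<inter> dperp B \<subseteq> dperp (A \<inter> B)"
    using Int_dperp_Union[of A "{B}"] assms by simp
  moreover have "dperp B \<inter> dperp A \<subseteq> dperp (dperp B \<inter> A)"
    using Int_dperp_Union[of "dperp B" "{A}"] assms perp_ideal[OF perp_compacts] by simp
  moreover have "dperp (dperp B \<inter> A) \<subseteq> dperp (A \<inter> B)"
    using calculation(1) dperp_least[OF _ dperp_regular] by (simp add: Int_commute)
  ultimately show "dperp A \<inter> dperp B \<subseteq> dperp (A \<inter> B)" by blast
qed

lemma Int_perp_null: "J \<subseteq> compacts X \<Longrightarrow> J \<inter> orth J \<subseteq> N"
  by (auto simp: perp_def)

lemma R_boolean: "boolean_locale R"
proof -
  have "\<exists>V \<in> carrier R. U \<sqinter>\<^bsub>R\<^esub> V = \<bottom>\<^bsub>R\<^esub> \<and> U \<squnion>\<^bsub>R\<^esub> V = \<top>\<^bsub>R\<^esub>" if "U \<in> carrier R" for U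
  proof -
    from that have U: "U \<in> regular_ideals X N" by simp
    then have Uc: "U \<subseteq> compacts X" by (simp add: regular_iff)
    have U': "orth U \<in> regular_ideals X N" using Uc by (rule perp_regular)
    have *: "U \<inter> orth U = N"
      using Int_perp_null[OF Uc] null_subset_regular[OF U] null_subset_regular[OF U'] by blast
    have "orth (U \<union> orth U) = orth U \<inter> dperp U"
      by (auto simp: perp_def)
    also have "\<dots> = N" using * U by (auto simp: regular_iff)
    finally have "dperp (U \<union> orth U) = compacts X"
      using perp_dperp[of "{}"] by (simp add: perp_empty perp_all)
    then show ?thesis
      by (intro bexI[of _ "orth U"]) (use * U U' in \<open>simp_all add: R_meet R_join R_top R_bottom\<close>)
  qed
  then show ?thesis using R_frame by (simp add: boolean_locale_def)
qed

text \<open>The ideal \<open>W \<inter> U\<close> consists of the sets \<open>K \<inter> K'\<close> with \<open>K \<in> W\<close> and \<open>K' \<in> U\<close>. Such intersections are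
  compact because the space is Hausdorff.\<close>

lemma heyting_imp_compact_locale:
  assumes U: "U \<in> compact_ideals X"
  shows "heyting_imp (compact_locale X) U N = orth U"
proof -
  have Int: "W \<inter> V \<in> compact_ideals X" if "W \<in> compact_ideals X" "V \<in> compact_ideals X" for W V
    using that by (auto simp: compact_ideals_def)
  have iff: "W \<subseteq> orth U \<longleftrightarrow> W \<inter> U \<subseteq> N" if W: "W \<in> compact_ideals X" for W
  proof
    assume "W \<subseteq> orth U"
    then show "W \<inter> U \<subseteq> N" using Int_perp_null[of U] U ideal_compact by blast
  next
    assume *: "W \<inter> U \<subseteq> N"
    show "W \<subseteq> orth U"
    proof
      fix K assume K: "K \<in> W"
      have "K \<inter> K' \<in> N" if "K' \<in> U" for K'
        using * ideal_down[OF W K, of "K \<inter> K'"] ideal_down[OF U that, of "K \<inter> K'"]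
          compacts_Int[of K K'] ideal_compact[OF W K] ideal_compact[OF U that] by auto
      then show "K \<in> orth U" using ideal_compact[OF W K] by (auto simp: perp_def)
    qed
  qed
  have orth: "orth U \<in> compact_ideals X"
    using U ideal_compact by (intro perp_ideal) auto
  show ?thesis
    unfolding heyting_imp_def compact_locale_def
  proof (rule the_equality, goal_cases)
    case 1
    show ?case using iff orth Int U by (simp add: subset_order_meet)
  next
    case (2 Y)
    then have Y: "Y \<in> compact_ideals X" "\<And>W. W \<in> compact_ideals X \<Longrightarrow> W \<subseteq> Y \<longleftrightarrow> W \<inter> U \<subseteq> N"
      using Int U by (auto simp: subset_order_meet)
    show ?case
      using Y(2)[OF orth] Y(2)[OF Y(1)] iff[OF orth] iff[OF Y(1)] by blast
  qed
qed

lemma b_sublocale_compact_locale: "b_sublocale (compact_locale X) N = R"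
  unfolding b_sublocale_def regular_ideals_def
  by (simp add: compact_locale_def heyting_imp_compact_locale[unfolded compact_locale_def] cong: image_cong)

end


section \<open>Measures from contents on compact sets\<close>

lemma sum_SUP_directed_ennreal:
  fixes f :: "'i \<Rightarrow> 'k \<Rightarrow> ennreal"
  assumes "finite F" "I \<noteq> {}"
    and dir: "\<And>k l. k \<in> I \<Longrightarrow> l \<in> I \<Longrightarrow> \<exists>j\<in>I. \<forall>i\<in>F. f i k \<le> f i j \<and> f i l \<le> f i j"
  shows "(\<Sum>i\<in>F. SUP k\<in>I. f i k) = (SUP k\<in>I. \<Sum>i\<in>F. f i k)"
  using assms(1) dir
proof (induction F)
  case empty
  then show ?case using \<open>I \<noteq> {}\<close> by simp
next
  case (insert x F)
  have IH: "(\<Sum>i\<in>F. SUP k\<in>I. f i k) = (SUP k\<in>I. \<Sum>i\<in>F. f i k)"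
    by (rule insert.IH) (use insert.prems in fastforce)
  have "(SUP k\<in>I. f x k) + (SUP k\<in>I. \<Sum>i\<in>F. f i k) = (SUP k\<in>I. f x k + (\<Sum>i\<in>F. f i k))"
  proof (rule SUP_add_directed_ennreal[symmetric])
    fix k l assume "k \<in> I" "l \<in> I"
    from insert.prems[OF this] obtain j where j: "j \<in> I" "\<And>i. i \<in> insert x F \<Longrightarrow> f i k \<le> f i j \<and> f i l \<le> f i j"
      by auto
    then show "\<exists>j\<in>I. f x k + (\<Sum>i\<in>F. f i l) \<le> f x j + (\<Sum>i\<in>F. f i j)"
      by (intro bexI[of _ j] add_mono sum_mono) auto
  qed
  then show ?case using insert IH by simp
qed

context null_compacts begin

lemma ideal_generated_by_two:
  assumes U: "U \<in> compact_ideals X" and V: "V \<in> compact_ideals X"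
  shows "{K \<union> K' | K K'. K \<in> U \<and> K' \<in> V} \<in> compact_ideals X" (is "?W \<in> _")
  unfolding compact_ideals_def
proof (rule CollectI, intro conjI ballI impI)
  have "K \<union> K' \<in> compacts X" if "K \<in> U" "K' \<in> V" for K K'
    using that ideal_compact[OF U] ideal_compact[OF V] by (auto simp: compacts_def compactin_Un)
  then show "?W \<subseteq> compacts X" by blast
  have "{} \<in> U" "{} \<in> V" using U V by (auto simp: compact_ideals_def)
  then have "{} \<union> {} \<in> ?W" by blast
  then show "{} \<in> ?W" by simp
  show "P \<in> ?W" if Q: "Q \<in> ?W" and P: "P \<in> compacts X" "P \<subseteq> Q" for Q P
  proof -
    obtain K K' where K: "Q = K \<union> K'" "K \<in> U" "K' \<in> V" using Q by auto
    have "P \<inter> K \<in> U" "P \<inter> K' \<in> V"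
      using K P U V ideal_down[of U K "P \<inter> K"] ideal_down[of V K' "P \<inter> K'"]
        compacts_Int[of P K] compacts_Int[of P K'] ideal_compact by auto
    then have "P \<inter> K \<union> P \<inter> K' \<in> ?W" by blast
    moreover have "P \<inter> K \<union> P \<inter> K' = P" using K P by auto
    ultimately show ?thesis by simp
  qed
  show "P \<union> Q \<in> ?W" if P: "P \<in> ?W" and Q: "Q \<in> ?W" for P Q
  proof -
    obtain K K' where K: "P = K \<union> K'" "K \<in> U" "K' \<in> V" using P by auto
    obtain L L' where L: "Q = L \<union> L'" "L \<in> U" "L' \<in> V" using Q by auto
    have "K \<union> L \<in> U" "K' \<union> L' \<in> V" using K L ideal_Un[OF U] ideal_Un[OF V] by simp_all
    then have "(K \<union> L) \<union> (K' \<union> L') \<in> ?W" by blast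
    moreover have "(K \<union> L) \<union> (K' \<union> L') = P \<union> Q" using K L by auto
    ultimately show ?thesis by simp
  qed
qed

text \<open>The last clause says that suprema over ideals are insensitive to the double \<open>perp\<close>. It carries the
  continuity of the measure obtained by taking suprema over regular ideals.\<close>

definition compact_content :: "('a set \<Rightarrow> ennreal) \<Rightarrow> bool"
  where "compact_content m \<longleftrightarrow>
     (\<forall>K \<in> compacts X. \<forall>K' \<in> compacts X. K \<subseteq> K' \<longrightarrow> m K \<le> m K') \<and>
     (\<forall>K \<in> compacts X. \<forall>K' \<in> compacts X. m K + m K' = m (K \<union> K') + m (K \<inter> K')) \<and>
     (\<forall>K \<in> N. m K = 0) \<and>
     (\<forall>I \<in> compact_ideals X. \<forall>Q \<in> dperp I. m Q \<le> (SUP K\<in>I. m K))"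

lemma content_SUP_dperp:
  assumes "compact_content m" "I \<in> compact_ideals X"
  shows "(SUP K\<in>dperp I. m K) = (SUP K\<in>I. m K)"
proof (rule antisym)
  show "(SUP K\<in>dperp I. m K) \<le> (SUP K\<in>I. m K)"
    using assms by (intro SUP_least) (auto simp: compact_content_def)
  show "(SUP K\<in>I. m K) \<le> (SUP K\<in>dperp I. m K)"
    using dperp_ext[of I] ideal_compact[OF assms(2)] by (intro SUP_subset_mono) auto
qed

text \<open>A directed union of ideals is an ideal, so continuity reduces to the last property of a content.
  For modularity, the join is the double \<open>perp\<close> of the ideal of all \<open>K \<union> K'\<close>, and both inequalities follow
  from modularity of \<open>m\<close> on compact sets.\<close>

lemma locale_measure_of_content:
  assumes m: "compact_content m"
  shows "locale_measure R (\<lambda>J. SUP K\<in>J. m K)"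
proof -
  have mono: "m K \<le> m K'" if "K \<in> compacts X" "K' \<in> compacts X" "K \<subseteq> K'" for K K'
    using m that by (auto simp: compact_content_def)
  have modular: "m K + m K' = m (K \<union> K') + m (K \<inter> K')" if "K \<in> compacts X" "K' \<in> compacts X" for K K'
    using m that by (auto simp: compact_content_def)
  have null: "m K = 0" if "K \<in> N" for K using m that by (auto simp: compact_content_def)
  have 1: "(SUP K\<in>U. m K) + (SUP K\<in>V. m K) = (SUP K\<in>dperp (U \<union> V). m K) + (SUP K\<in>U \<inter> V. m K)"
    if U: "U \<in> regular_ideals X N" and V: "V \<in> regular_ideals X N" for U V
  proof -
    let ?W = "{K \<union> K' | K K'. K \<in> U \<and> K' \<in> V}"
    note Ui = regular_ideal[OF U] and Vi = regular_ideal[OF V]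
    note W = ideal_generated_by_two[OF Ui Vi]
    have e: "{} \<in> U" "{} \<in> V" using Ui Vi by (auto simp: compact_ideals_def)
    have Wd: "dperp (U \<union> V) = dperp ?W"
    proof
      show "dperp (U \<union> V) \<subseteq> dperp ?W" using e by (intro dperp_mono) auto
      have "?W \<subseteq> dperp (U \<union> V)"
      proof clarify
        fix K K' assume "K \<in> U" "K' \<in> V"
        moreover have "U \<union> V \<subseteq> dperp (U \<union> V)" using U V regular_compacts by (intro dperp_ext) blast
        ultimately show "K \<union> K' \<in> dperp (U \<union> V)"
          by (intro ideal_Un[OF regular_ideal[OF dperp_regular]]) blast+
      qed
      then show "dperp ?W \<subseteq> dperp (U \<union> V)" by (rule dperp_least) (rule dperp_regular)
    qed
    have "(SUP K\<in>U. m K) + (SUP K\<in>V. m K) = (SUP K\<in>?W. m K) + (SUP K\<in>U \<inter> V. m K)"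
    proof (rule antisym)
      have "m K + m K' \<le> (SUP K\<in>?W. m K) + (SUP K\<in>U \<inter> V. m K)" if K: "K \<in> U" "K' \<in> V" for K K'
      proof -
        have c: "K \<in> compacts X" "K' \<in> compacts X" using K Ui Vi ideal_compact by auto
        have "K \<inter> K' \<in> U \<inter> V"
          using K ideal_down[OF Ui K(1)] ideal_down[OF Vi K(2)] compacts_Int[OF c] by auto
        moreover have "K \<union> K' \<in> ?W" using K by auto
        ultimately show ?thesis
          unfolding modular[OF c] by (intro add_mono SUP_upper)
      qed
      then have "(SUP K'\<in>V. m K + m K') \<le> (SUP K\<in>?W. m K) + (SUP K\<in>U \<inter> V. m K)" if "K \<in> U" for K
        using that by (intro SUP_least) auto
      moreover have "(SUP K'\<in>V. m K + m K') = m K + (SUP K'\<in>V. m K')" for K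
        using e by (intro ennreal_SUP_add_right[symmetric]) auto
      ultimately have "(SUP K\<in>U. m K + (SUP K'\<in>V. m K')) \<le> (SUP K\<in>?W. m K) + (SUP K\<in>U \<inter> V. m K)"
        by (intro SUP_least) auto
      moreover have "(SUP K\<in>U. m K + (SUP K'\<in>V. m K')) = (SUP K\<in>U. m K) + (SUP K'\<in>V. m K')"
        using e by (intro ennreal_SUP_add_left) auto
      ultimately show "(SUP K\<in>U. m K) + (SUP K\<in>V. m K) \<le> (SUP K\<in>?W. m K) + (SUP K\<in>U \<inter> V. m K)"
        by simp
    next
      have "m P + m L \<le> (SUP K\<in>U. m K) + (SUP K\<in>V. m K)" if "P \<in> ?W" "L \<in> U \<inter> V" for P L
      proof -
        obtain K K' where P: "P = K \<union> K'" and K: "K \<in> U" "K' \<in> V" using \<open>P \<in> ?W\<close> by auto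
        have c: "K \<in> compacts X" "K' \<in> compacts X" "L \<in> compacts X"
          using K Ui Vi ideal_compact \<open>L \<in> U \<inter> V\<close> by auto
        \<comment> \<open>enlarging \<open>K\<close> and \<open>K'\<close> by \<open>L\<close> makes their intersection contain \<open>L\<close>\<close>
        let ?A = "K \<union> L" and ?B = "K' \<union> L"
        have AB: "?A \<in> U" "?B \<in> V" using K \<open>L \<in> U \<inter> V\<close> Ui Vi ideal_Un by auto
        have ABc: "?A \<in> compacts X" "?B \<in> compacts X" using AB Ui Vi ideal_compact by auto
        have "m P + m L \<le> m (?A \<union> ?B) + m (?A \<inter> ?B)"
          using compacts_Int[OF ABc] c ABc unfolding P
          by (intro add_mono mono) (auto simp: compacts_def compactin_Un)
        also have "\<dots> = m ?A + m ?B" using modular[OF ABc] by simp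
        also have "\<dots> \<le> (SUP K\<in>U. m K) + (SUP K\<in>V. m K)"
          using AB by (intro add_mono SUP_upper)
        finally show ?thesis .
      qed
      then have "(SUP L\<in>U \<inter> V. m P + m L) \<le> (SUP K\<in>U. m K) + (SUP K\<in>V. m K)" if "P \<in> ?W" for P
        using that by (intro SUP_least) auto
      moreover have "(SUP L\<in>U \<inter> V. m P + m L) = m P + (SUP L\<in>U \<inter> V. m L)" for P
        using e by (intro ennreal_SUP_add_right[symmetric]) auto
      ultimately have "(SUP P\<in>?W. m P + (SUP L\<in>U \<inter> V. m L)) \<le> (SUP K\<in>U. m K) + (SUP K\<in>V. m K)"
        by (intro SUP_least) auto
      moreover have "(SUP P\<in>?W. m P + (SUP L\<in>U \<inter> V. m L)) = (SUP P\<in>?W. m P) + (SUP L\<in>U \<inter> V. m L)"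
        using e by (intro ennreal_SUP_add_left) auto
      ultimately show "(SUP K\<in>?W. m K) + (SUP K\<in>U \<inter> V. m K) \<le> (SUP K\<in>U. m K) + (SUP K\<in>V. m K)"
        by simp
    qed
    then show ?thesis unfolding Wd content_SUP_dperp[OF m W] .
  qed
  have 2: "(SUP K\<in>dperp (\<Union>D). m K) = (SUP U\<in>D. SUP K\<in>U. m K)" if D: "directed_in R D" for D
  proof -
    have Dr: "D \<subseteq> regular_ideals X N" "D \<noteq> {}"
      and dir: "\<And>U V. U \<in> D \<Longrightarrow> V \<in> D \<Longrightarrow> \<exists>W\<in>D. U \<subseteq> W \<and> V \<subseteq> W"
      using D by (auto simp: directed_in_def)
    have Di: "\<And>U. U \<in> D \<Longrightarrow> U \<in> compact_ideals X" using Dr regular_ideal by auto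
    have "\<Union>D \<in> compact_ideals X"
      unfolding compact_ideals_def
    proof (intro CollectI conjI ballI impI)
      show "\<Union>D \<subseteq> compacts X" using Di ideal_compact by auto
      show "{} \<in> \<Union>D" using Dr(2) Di by (auto simp: compact_ideals_def)
      show "K' \<in> \<Union>D" if "K \<in> \<Union>D" "K' \<in> compacts X" "K' \<subseteq> K" for K K'
        using that Di ideal_down by blast
      show "K \<union> K' \<in> \<Union>D" if KK': "K \<in> \<Union>D" "K' \<in> \<Union>D" for K K'
      proof -
        obtain U V where UV: "U \<in> D" "K \<in> U" "V \<in> D" "K' \<in> V" using KK' by auto
        then obtain W where "W \<in> D" "U \<subseteq> W" "V \<subseteq> W" using dir by blast
        then show ?thesis using Di ideal_Un[of W K K'] UV by blast
      qed
    qed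
    then have "(SUP K\<in>dperp (\<Union>D). m K) = (SUP K\<in>\<Union>D. m K)"
      by (rule content_SUP_dperp[OF m])
    also have "\<dots> = (SUP U\<in>D. SUP K\<in>U. m K)" using SUP_UNION[of m "\<lambda>U. U" D] by simp
    finally show ?thesis .
  qed
  show ?thesis
    unfolding locale_measure_def
  proof (intro conjI ballI allI impI)
    fix U V assume UV: "U \<in> carrier R" "V \<in> carrier R"
    show "(SUP K\<in>U. m K) \<le> (SUP K\<in>V. m K)" if "U \<sqsubseteq>\<^bsub>R\<^esub> V"
      using that by (intro SUP_subset_mono) auto
    show "(SUP K\<in>U. m K) + (SUP K\<in>V. m K) = (SUP K\<in>U \<squnion>\<^bsub>R\<^esub> V. m K) + (SUP K\<in>U \<sqinter>\<^bsub>R\<^esub> V. m K)"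
      using UV 1[of U V] by (simp add: R_meet R_join)
  next
    show "(SUP K\<in>\<bottom>\<^bsub>R\<^esub>. m K) = 0"
      using null null_empty by (auto simp: R_bottom SUP_constant cong: SUP_cong)
    fix D assume D: "directed_in R D"
    then show "(SUP K\<in>\<Squnion>\<^bsub>R\<^esub>D. m K) = (SUP U\<in>D. SUP K\<in>U. m K)"
      using 2[OF D] by (simp add: directed_in_def R_sup)
  qed
qed

lemma content_infsum:
  assumes "\<And>i. i \<in> A \<Longrightarrow> compact_content (m i)"
  shows "compact_content (\<lambda>K. \<Sum>\<^sub>\<infinity>i\<in>A. m i K)"
  unfolding compact_content_def
proof (intro conjI ballI impI)
  note sm = nonneg_summable_on_complete
  fix K K' assume K: "K \<in> compacts X" "K' \<in> compacts X"
  show "(\<Sum>\<^sub>\<infinity>i\<in>A. m i K) \<le> (\<Sum>\<^sub>\<infinity>i\<in>A. m i K')" if "K \<subseteq> K'"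
    using assms K that by (intro infsum_mono sm) (auto simp: compact_content_def)
  show "(\<Sum>\<^sub>\<infinity>i\<in>A. m i K) + (\<Sum>\<^sub>\<infinity>i\<in>A. m i K') = (\<Sum>\<^sub>\<infinity>i\<in>A. m i (K \<union> K')) + (\<Sum>\<^sub>\<infinity>i\<in>A. m i (K \<inter> K'))"
    using assms K by (subst (1 2) infsum_add[symmetric]) (auto intro!: sm infsum_cong simp: compact_content_def)
next
  fix K assume "K \<in> N"
  then show "(\<Sum>\<^sub>\<infinity>i\<in>A. m i K) = 0"
    using assms by (intro infsum_0) (auto simp: compact_content_def)
next
  fix I Q assume I: "I \<in> compact_ideals X" and Q: "Q \<in> dperp I"
  have ne: "I \<noteq> {}" using I by (auto simp: compact_ideals_def)
  have "(\<Sum>i\<in>F. m i Q) \<le> (SUP K\<in>I. \<Sum>\<^sub>\<infinity>i\<in>A. m i K)" if F: "finite F" "F \<subseteq> A" for F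
  proof -
    have "(\<Sum>i\<in>F. m i Q) \<le> (\<Sum>i\<in>F. SUP K\<in>I. m i K)"
      using assms I Q F by (intro sum_mono) (auto simp: compact_content_def)
    also have "\<dots> = (SUP K\<in>I. \<Sum>i\<in>F. m i K)"
    proof (rule sum_SUP_directed_ennreal[OF F(1) ne])
      fix K L assume KL: "K \<in> I" "L \<in> I"
      then have "K \<in> compacts X" "L \<in> compacts X" "K \<union> L \<in> compacts X"
        using ideal_compact[OF I] ideal_Un[OF I] by auto
      then show "\<exists>J\<in>I. \<forall>i\<in>F. m i K \<le> m i J \<and> m i L \<le> m i J"
        using assms F ideal_Un[OF I KL] by (intro bexI[of _ "K \<union> L"]) (auto simp: compact_content_def)
    qed
    also have "\<dots> \<le> (SUP K\<in>I. \<Sum>\<^sub>\<infinity>i\<in>A. m i K)"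
      using F by (intro SUP_mono) (auto simp: nonneg_infsum_complete intro: SUP_upper)
    finally show ?thesis .
  qed
  then show "(\<Sum>\<^sub>\<infinity>i\<in>A. m i Q) \<le> (SUP K\<in>I. \<Sum>\<^sub>\<infinity>i\<in>A. m i K)"
    unfolding nonneg_infsum_complete[OF zero_le] by (intro SUP_least) auto
qed

text \<open>Zorn's lemma gives a maximal family \<open>A\<close> of nonnull sets of \<open>\<C>\<close> with pairwise null intersections; every
  nonnull compact set meets some \<open>C \<in> A\<close> in a nonnull set. The sum over \<open>A\<close> of the local contents yields
  the measure. It is finite on the open \<open>e C\<close> generated by \<open>C \<in> A\<close>, as only the content of \<open>C\<close> survives
  there, and these opens cover. If \<open>U \<le> V\<close> differ, then so do \<open>U \<inter> e C\<close> and \<open>V \<inter> e C\<close> for some \<open>C\<close>, and the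
  part of \<open>V \<inter> e C\<close> orthogonal to \<open>U\<close> has positive measure.\<close>

lemma measurable_of_local_contents:
  fixes \<C> :: "'a set set" and m :: "'a set \<Rightarrow> 'a set \<Rightarrow> ennreal"
  assumes compact: "\<And>C. C \<in> \<C> \<Longrightarrow> C \<in> compacts X"
    and cofinal: "\<And>K. K \<in> compacts X \<Longrightarrow> K \<notin> N \<Longrightarrow> \<exists>C\<in>\<C>. C \<subseteq> K \<and> C \<notin> N"
    and compact_content: "\<And>C. C \<in> \<C> \<Longrightarrow> compact_content (m C)"
    and finite: "\<And>C. C \<in> \<C> \<Longrightarrow> m C C < \<infinity>"
    and concentrated: "\<And>C K. C \<in> \<C> \<Longrightarrow> K \<in> compacts X \<Longrightarrow> m C K = m C (K \<inter> C)"
    and positive: "\<And>C K. C \<in> \<C> \<Longrightarrow> K \<in> compacts X \<Longrightarrow> K \<subseteq> C \<Longrightarrow> K \<notin> N \<Longrightarrow> m C K > 0"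
  shows "measurable_locale R"
proof -
  define \<D> where "\<D> = {A. A \<subseteq> \<C> - N \<and> pairwise (\<lambda>C C'. C \<inter> C' \<in> N) A}"
  have "\<exists>A\<in>\<D>. \<forall>B\<in>\<D>. A \<subseteq> B \<longrightarrow> B = A"
  proof (rule subset_Zorn')
    fix \<G> assume chain: "subset.chain \<D> \<G>"
    then have "\<Union>\<G> \<subseteq> \<C> - N"
      unfolding \<D>_def subset_chain_def by blast
    moreover have "pairwise (\<lambda>C C'. C \<inter> C' \<in> N) (\<Union>\<G>)"
    proof (rule pairwiseI)
      fix C C' assume "C \<in> \<Union>\<G>" "C' \<in> \<Union>\<G>" "C \<noteq> C'"
      then obtain A B where "A \<in> \<G>" "C \<in> A" "B \<in> \<G>" "C' \<in> B" by auto
      then have "\<exists>D\<in>\<G>. C \<in> D \<and> C' \<in> D"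
        using chain unfolding subset_chain_def by blast
      then obtain D where "D \<in> \<D>" "C \<in> D" "C' \<in> D" using chain unfolding subset_chain_def by blast
      then show "C \<inter> C' \<in> N" using \<open>C \<noteq> C'\<close> unfolding \<D>_def pairwise_def by auto
    qed
    ultimately show "\<Union>\<G> \<in> \<D>" by (simp add: \<D>_def)
  qed
  then obtain A where "A \<in> \<D>" and max: "\<And>B. B \<in> \<D> \<Longrightarrow> A \<subseteq> B \<Longrightarrow> B = A" by blast
  then have A: "A \<subseteq> \<C>" "A \<inter> N = {}" and disj: "\<And>C C'. C \<in> A \<Longrightarrow> C' \<in> A \<Longrightarrow> C \<noteq> C' \<Longrightarrow> C \<inter> C' \<in> N"
    by (auto simp: \<D>_def pairwise_def)
  \<comment> \<open>otherwise a nonnull member of \<open>\<C>\<close> inside \<open>K\<close> could be added to \<open>A\<close>\<close>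
  have exhaust: "\<exists>C\<in>A. K \<inter> C \<notin> N" if K: "K \<in> compacts X" "K \<notin> N" for K
  proof (rule ccontr)
    assume "\<not> ?thesis"
    then have *: "K \<inter> C \<in> N" if "C \<in> A" for C using that by auto
    obtain C0 where C0: "C0 \<in> \<C>" "C0 \<subseteq> K" "C0 \<notin> N" using cofinal[OF K] by auto
    have **: "C0 \<inter> C \<in> N" if "C \<in> A" for C
      using *[OF that] by (rule null_down) (use C0 compact[of C] compact[of C0] A that compacts_Int[of C0 C] in auto)
    then have "C \<inter> C0 \<in> N" if "C \<in> A" for C using that by (metis Int_commute)
    with ** disj C0 A have "insert C0 A \<in> \<D>"
      by (auto simp: \<D>_def pairwise_def)
    then have "C0 \<in> A" using max by blast
    then show False using **[of C0] C0 by simp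
  qed
  define M where "M = (\<lambda>K. \<Sum>\<^sub>\<infinity>C\<in>A. m C K)"
  define \<nu> where "\<nu> = (\<lambda>J. SUP K\<in>J. M K)"
  have contentM: "compact_content M"
    unfolding M_def using compact_content A by (intro content_infsum) auto
  have meas: "locale_measure R \<nu>"
    unfolding \<nu>_def by (rule locale_measure_of_content[OF contentM])
  have M_ge: "m C K \<le> M K" if "C \<in> A" for C K
    using that unfolding M_def nonneg_infsum_complete[OF zero_le]
    by (intro SUP_upper2[of "{C}"]) auto
  define e where "e C = dperp {C}" for C
  have e: "e C \<in> regular_ideals X N" for C
    by (simp add: e_def dperp_regular)
  have Ce: "C \<in> e C" if "C \<in> A" for C
    using dperp_ext[of "{C}"] that A compact by (auto simp: e_def)
  have e_finite: "\<nu> (e C) < \<infinity>" if C: "C \<in> A" for C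
  proof -
    have "M K \<le> m C C" if K: "K \<in> e C" for K
    proof -
      have Kc: "K \<in> compacts X" using K by (auto simp: e_def perp_def)
      have "m C' K = 0" if "C' \<in> A" "C' \<noteq> C" for C'
      proof -
        have "C' \<in> orth {C}" using that C disj A compact by (auto simp: perp_def)
        then have "K \<inter> C' \<in> N" using K by (auto simp: e_def perp_def)
        then show ?thesis
          using concentrated[of C' K] compact_content[of C'] that A Kc by (auto simp: compact_content_def)
      qed
      then have "M K = (\<Sum>\<^sub>\<infinity>C'\<in>{C}. m C' K)"
        unfolding M_def using C by (intro infsum_cong_neutral) auto
      also have "\<dots> = m C (K \<inter> C)" using concentrated[of C K] C A Kc by auto
      also have "\<dots> \<le> m C C"
        using compact_content[of C] C A compacts_Int[OF Kc, of C] compact[of C] by (auto simp: compact_content_def)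
      finally show ?thesis .
    qed
    then have "\<nu> (e C) \<le> m C C" unfolding \<nu>_def by (intro SUP_least)
    also have "\<dots> < \<infinity>" using finite C A by auto
    finally show ?thesis .
  qed
  have lf: "locally_finite_measure R \<nu>"
  proof -
    let ?F = "{U \<in> carrier R. \<nu> U < \<infinity>}"
    have "orth (\<Union>?F) \<subseteq> N"
    proof
      fix K assume K: "K \<in> orth (\<Union>?F)"
      then have "K \<inter> C \<in> N" if "C \<in> A" for C
        using e_finite[OF that] e[of C] Ce[OF that] by (auto simp: perp_def)
      then show "K \<in> N" using exhaust[of K] K by (auto simp: perp_def)
    qed
    then have "orth N \<subseteq> dperp (\<Union>?F)" by (rule perp_antimono)
    moreover have "orth N = compacts X"
      using perp_dperp[of "{}"] by (simp add: perp_empty perp_all)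
    ultimately have "dperp (\<Union>?F) = compacts X"
      using perp_compacts by (intro antisym) auto
    then show ?thesis
      unfolding locally_finite_measure_def R_top by (simp add: R_sup)
  qed
  have faithful: "faithful_measure R \<nu>"
    unfolding faithful_measure_def
  proof (intro ballI impI)
    fix U V assume "U \<in> carrier R" "V \<in> carrier R" and "U \<sqsubseteq>\<^bsub>R\<^esub> V"
      and eq: "\<forall>K\<in>carrier R. \<nu> K < \<infinity> \<longrightarrow> \<nu> (U \<sqinter>\<^bsub>R\<^esub> K) = \<nu> (V \<sqinter>\<^bsub>R\<^esub> K)"
    then have U: "U \<in> regular_ideals X N" and V: "V \<in> regular_ideals X N" and UV: "U \<subseteq> V" by auto
    have "V \<subseteq> U"
    proof (rule ccontr)
      assume "\<not> V \<subseteq> U"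
      then obtain Q where Q: "Q \<in> V" "Q \<notin> U" by auto
      have Qc: "Q \<in> compacts X" using Q regular_compacts[OF V] by auto
      have "Q \<notin> dperp U" using Q U by (auto simp: regular_iff)
      then obtain P where P: "P \<in> orth U" "Q \<inter> P \<notin> N" using Qc by (auto simp: perp_def)
      have Pc: "P \<in> compacts X" using P by (auto simp: perp_def)
      have U': "orth U \<in> regular_ideals X N" using regular_compacts[OF U] by (rule perp_regular)
      have QPc: "Q \<inter> P \<in> compacts X" using Qc Pc by (rule compacts_Int)
      obtain C where C: "C \<in> A" "Q \<inter> P \<inter> C \<notin> N" using exhaust[OF QPc P(2)] by auto
      have Cc: "C \<in> compacts X" using C A compact by auto
      let ?K = "Q \<inter> P \<inter> C"
      have Kc: "?K \<in> compacts X" using QPc Cc by (rule compacts_Int)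
      \<comment> \<open>the relative complement of \<open>U\<close> in \<open>V \<inter> e C\<close>\<close>
      define W where "W = orth U \<inter> (V \<inter> e C)"
      have "?K \<in> V" using ideal_down[OF regular_ideal[OF V] Q(1) Kc] by auto
      moreover have "?K \<in> orth U" using ideal_down[OF regular_ideal[OF U'] P(1) Kc] by auto
      moreover have "?K \<in> e C" using ideal_down[OF regular_ideal[OF e] Ce[OF C(1)] Kc] by auto
      ultimately have KW: "?K \<in> W" by (simp add: W_def)
      have W: "W \<in> regular_ideals X N" unfolding W_def using U' V e by (intro regular_Int)
      define U1 where "U1 = U \<inter> e C"
      define V1 where "V1 = V \<inter> e C"
      have U1: "U1 \<in> regular_ideals X N" and V1: "V1 \<in> regular_ideals X N"
        unfolding U1_def V1_def using U V e by (auto intro: regular_Int)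
      have "\<nu> U1 = \<nu> V1"
        using eq[rule_format, of "e C"] e_finite[OF C(1)] U V e by (simp add: R_meet U1_def V1_def)
      moreover have "\<nu> U1 < \<infinity>"
      proof -
        have "\<nu> U1 \<le> \<nu> (e C)" unfolding \<nu>_def U1_def by (intro SUP_subset_mono) auto
        then show ?thesis using e_finite[OF C(1)] by simp
      qed
      moreover have "\<nu> U1 + \<nu> W \<le> \<nu> V1"
      proof -
        have "U1 \<inter> W \<subseteq> N"
          using Int_perp_null[OF regular_compacts[OF U]] by (auto simp: U1_def W_def)
        then have "U1 \<inter> W = N"
          using null_subset_regular[OF U1] null_subset_regular[OF W] by blast
        moreover have "\<nu> N = 0" using meas by (simp add: locale_measure_def R_bottom)
        moreover have "\<nu> U1 + \<nu> W = \<nu> (dperp (U1 \<union> W)) + \<nu> (U1 \<inter> W)"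
          using meas U1 W by (auto simp: locale_measure_def R_meet R_join)
        ultimately have "\<nu> U1 + \<nu> W = \<nu> (dperp (U1 \<union> W))" by simp
        also have "\<dots> \<le> \<nu> V1"
        proof -
          have "dperp (U1 \<union> W) \<subseteq> V1"
            using UV V1 by (intro dperp_least) (auto simp: U1_def V1_def W_def)
          then show ?thesis unfolding \<nu>_def by (intro SUP_subset_mono) auto
        qed
        finally show ?thesis .
      qed
      moreover have "\<nu> W > 0"
      proof -
        have "0 < m C ?K" using C A Kc by (intro positive) auto
        also have "\<dots> \<le> M ?K" using C(1) by (rule M_ge)
        also have "\<dots> \<le> \<nu> W" unfolding \<nu>_def using KW by (rule SUP_upper)
        finally show ?thesis .
      qed
      ultimately show False
        using ennreal_add_left_cancel_le[of "\<nu> U1" "\<nu> W" 0] by auto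
    qed
    with UV show "U = V" by blast
  qed
  show ?thesis
    unfolding measurable_locale_def using R_boolean meas lf faithful by blast
qed

end


section \<open>Charts and submersions\<close>

locale smooth_manifold =
  fixes M :: "'a manifold"
  assumes manifold: "large_smooth_manifold M"
begin

abbreviation "X \<equiv> mtop M"
abbreviation "n \<equiv> mdim M"

lemma Hausdorff_M: "Hausdorff_space X"
  using manifold by (simp add: large_smooth_manifold_def)

lemma chart:
  assumes "(U, \<phi>) \<in> mcharts M"
  shows "openin X U" "openin (Rn n) (\<phi> ` U)"
    "homeomorphic_map (subtopology X U) (subtopology (Rn n) (\<phi> ` U)) \<phi>" "U \<subseteq> topspace X"
proof -
  show "openin X U" "openin (Rn n) (\<phi> ` U)"
    "homeomorphic_map (subtopology X U) (subtopology (Rn n) (\<phi> ` U)) \<phi>"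
    using manifold assms by (auto simp: large_smooth_manifold_def)
  then show "U \<subseteq> topspace X" by (simp add: openin_subset)
qed

lemma chart_inj: "(U, \<phi>) \<in> mcharts M \<Longrightarrow> inj_on \<phi> U"
  using chart[of U \<phi>] by (simp add: homeomorphic_eq_everything_map Int_absorb1)

lemma chart_inv: "(U, \<phi>) \<in> mcharts M \<Longrightarrow> p \<in> U \<Longrightarrow> inv_into U \<phi> (\<phi> p) = p"
  by (simp add: chart_inj)

lemma chart_at:
  assumes "p \<in> topspace X" obtains U \<phi> where "(U, \<phi>) \<in> mcharts M" "p \<in> U"
proof -
  have "p \<in> \<Union> (fst ` mcharts M)" using manifold assms by (simp add: large_smooth_manifold_def)
  then show ?thesis using that by auto
qed

lemma chart_open_image:
  assumes c: "(U, \<phi>) \<in> mcharts M" and W: "openin X W" "W \<subseteq> U"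
  shows "openin (Rn n) (\<phi> ` W)"
proof -
  have "openin (subtopology X U) W" using W chart[OF c] by (simp add: openin_open_subtopology)
  moreover have "open_map (subtopology X U) (subtopology (Rn n) (\<phi> ` U)) \<phi>"
    using chart(3)[OF c] by (rule homeomorphic_imp_open_map)
  ultimately have "openin (subtopology (Rn n) (\<phi> ` U)) (\<phi> ` W)" by (simp add: open_map_def)
  then show ?thesis using chart(2)[OF c] openin_open_subtopology by blast
qed

lemma chart_compact_image:
  assumes c: "(U, \<phi>) \<in> mcharts M" and K: "compactin X K" "K \<subseteq> U"
  shows "compactin (Rn n) (\<phi> ` K)"
proof -
  have "compactin (subtopology X U) K" using K by (simp add: compactin_subtopology)
  moreover have "continuous_map (subtopology X U) (subtopology (Rn n) (\<phi> ` U)) \<phi>"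
    using chart(3)[OF c] by (rule homeomorphic_imp_continuous_map)
  ultimately have "compactin (subtopology (Rn n) (\<phi> ` U)) (\<phi> ` K)" by (rule image_compactin)
  then show ?thesis by (simp add: compactin_subtopology)
qed

lemma chart_compact_preimage:
  assumes c: "(U, \<phi>) \<in> mcharts M" and R: "compactin (Rn n) R" "R \<subseteq> \<phi> ` U"
  shows "compactin X {x \<in> U. \<phi> x \<in> R}" "\<phi> ` {x \<in> U. \<phi> x \<in> R} = R"
proof -
  show eq: "\<phi> ` {x \<in> U. \<phi> x \<in> R} = R" using R(2) by blast
  have "compactin (subtopology (Rn n) (\<phi> ` U)) (\<phi> ` {x \<in> U. \<phi> x \<in> R})"
    using R by (simp add: eq compactin_subtopology)
  then have "compactin (subtopology X U) {x \<in> U. \<phi> x \<in> R}"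
    using homeomorphic_map_compactness[OF chart(3)[OF c], of "{x \<in> U. \<phi> x \<in> R}"] chart(4)[OF c] by auto
  then show "compactin X {x \<in> U. \<phi> x \<in> R}" by (simp add: compactin_subtopology)
qed

lemma transition_smooth:
  assumes "(U, \<phi>) \<in> mcharts M" "(V, \<psi>) \<in> mcharts M"
  shows "smooth_on n n (\<phi> ` (U \<inter> V)) (\<lambda>x. \<psi> (inv_into U \<phi> x))"
proof -
  have "\<forall>(U, \<phi>) \<in> mcharts M. \<forall>(V, \<psi>) \<in> mcharts M.
      smooth_on n n (\<phi> ` (U \<inter> V)) (\<lambda>x. \<psi> (inv_into U \<phi> x))"
    using manifold by (simp add: large_smooth_manifold_def comp_def)
  from bspec[OF this assms(1)]
  have "\<forall>(V, \<psi>) \<in> mcharts M. smooth_on n n (\<phi> ` (U \<inter> V)) (\<lambda>x. \<psi> (inv_into U \<phi> x))" by simp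
  from bspec[OF this assms(2)] show ?thesis by simp
qed

end

lemma submersion_iff:
  "submersion M M' f \<longleftrightarrow> continuous_map (mtop M) (mtop M') f \<and>
    (\<forall>U \<phi> V \<psi>. (U, \<phi>) \<in> mcharts M \<longrightarrow> (V, \<psi>) \<in> mcharts M' \<longrightarrow>
      smooth_on (mdim M) (mdim M') (\<phi> ` (U \<inter> f -` V)) (\<lambda>x. \<psi> (f (inv_into U \<phi> x))) \<and>
      (\<forall>p \<in> U \<inter> f -` V. differential_at (mdim M) (mdim M') (\<lambda>x. \<psi> (f (inv_into U \<phi> x))) (\<phi> p)
          ` topspace (Rn (mdim M)) = topspace (Rn (mdim M'))))"
  unfolding submersion_def smooth_map_def comp_def
  by (simp only: Ball_def split_paired_All prod.case) blast

lemma submersion_continuous: "submersion M M' f \<Longrightarrow> continuous_map (mtop M) (mtop M') f"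
  by (simp add: submersion_iff)

lemma submersion_smooth:
  "submersion M M' f \<Longrightarrow> (U, \<phi>) \<in> mcharts M \<Longrightarrow> (V, \<psi>) \<in> mcharts M' \<Longrightarrow>
    smooth_on (mdim M) (mdim M') (\<phi> ` (U \<inter> f -` V)) (\<lambda>x. \<psi> (f (inv_into U \<phi> x)))"
  by (simp add: submersion_iff)

lemma submersion_surjective:
  "submersion M M' f \<Longrightarrow> (U, \<phi>) \<in> mcharts M \<Longrightarrow> (V, \<psi>) \<in> mcharts M' \<Longrightarrow> p \<in> U \<Longrightarrow> f p \<in> V \<Longrightarrow>
    differential_at (mdim M) (mdim M') (\<lambda>x. \<psi> (f (inv_into U \<phi> x))) (\<phi> p)
      ` topspace (Rn (mdim M)) = topspace (Rn (mdim M'))"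
  by (simp add: submersion_iff)

lemma (in smooth_manifold) chart_domain_open:
  assumes "continuous_map X Y f" "(U, \<phi>) \<in> mcharts M" "openin Y V"
  shows "openin X (U \<inter> f -` V)" "openin (Rn n) (\<phi> ` (U \<inter> f -` V))"
proof -
  have "openin X {x \<in> topspace X. f x \<in> V}" by (rule openin_continuous_map_preimage[OF assms(1,3)])
  then have "openin X (U \<inter> {x \<in> topspace X. f x \<in> V})" using chart(1)[OF assms(2)] by (rule openin_Int[rotated])
  moreover have "U \<inter> {x \<in> topspace X. f x \<in> V} = U \<inter> f -` V" using chart(4)[OF assms(2)] by auto
  ultimately show "openin X (U \<inter> f -` V)" by simp
  then show "openin (Rn n) (\<phi> ` (U \<inter> f -` V))" by (rule chart_open_image[OF assms(2)]) auto
qed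

lemma (in smooth_manifold) submersion_cong:
  assumes M': "smooth_manifold M'" and fg: "\<And>x. x \<in> topspace X \<Longrightarrow> f x = g x" and f: "submersion M M' f"
  shows "submersion M M' g"
  unfolding submersion_iff
proof (intro conjI allI impI)
  interpret M': smooth_manifold M' by (rule M')
  show "continuous_map X M'.X g"
    using continuous_map_eq[OF submersion_continuous[OF f] fg] .
  fix U \<phi> V \<psi> assume c: "(U, \<phi>) \<in> mcharts M" and c': "(V, \<psi>) \<in> mcharts M'"
  have S: "U \<inter> g -` V = U \<inter> f -` V" using fg chart(4)[OF c] by auto
  have o: "openin (Rn n) (\<phi> ` (U \<inter> f -` V))"
    by (rule chart_domain_open(2)[OF submersion_continuous[OF f] c M'.chart(1)[OF c']])
  have eq: "\<psi> (f (inv_into U \<phi> x)) = \<psi> (g (inv_into U \<phi> x))" if "x \<in> \<phi> ` (U \<inter> f -` V)" for x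
    using that fg chart(4)[OF c] chart_inv[OF c] by auto
  show "smooth_on n M'.n (\<phi> ` (U \<inter> g -` V)) (\<lambda>x. \<psi> (g (inv_into U \<phi> x)))"
    unfolding S by (rule smooth_on_cong[OF o eq submersion_smooth[OF f c c']])
  show "\<forall>p\<in>U \<inter> g -` V. differential_at n M'.n (\<lambda>x. \<psi> (g (inv_into U \<phi> x))) (\<phi> p)
          ` topspace (Rn n) = topspace (Rn M'.n)"
    unfolding S
  proof
    fix p assume p: "p \<in> U \<inter> f -` V"
    then have "differential_at n M'.n (\<lambda>x. \<psi> (f (inv_into U \<phi> x))) (\<phi> p)
        = differential_at n M'.n (\<lambda>x. \<psi> (g (inv_into U \<phi> x))) (\<phi> p)"
      by (intro differential_at_cong[OF o eq]) auto
    then show "differential_at n M'.n (\<lambda>x. \<psi> (g (inv_into U \<phi> x))) (\<phi> p)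
          ` topspace (Rn n) = topspace (Rn M'.n)"
      using submersion_surjective[OF f c c', of p] p by simp
  qed
qed

text \<open>In charts the identity becomes a coordinate change, whose differential is invertible by the chain rule
  applied to the inverse coordinate change.\<close>

lemma (in smooth_manifold) submersion_id: "submersion M M (\<lambda>x. x)"
  unfolding submersion_iff
proof (intro conjI allI impI ballI)
  show "continuous_map X X (\<lambda>x. x)" by simp
  fix U \<phi> V \<psi> assume c: "(U, \<phi>) \<in> mcharts M" and c': "(V, \<psi>) \<in> mcharts M"
  have sm: "smooth_on n n (\<phi> ` (U \<inter> V)) (\<lambda>x. \<psi> (inv_into U \<phi> x))"
    by (rule transition_smooth[OF c c'])
  then show "smooth_on n n (\<phi> ` (U \<inter> (\<lambda>x. x) -` V)) (\<lambda>x. \<psi> (inv_into U \<phi> x))" by simp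
  fix p assume "p \<in> U \<inter> (\<lambda>x. x) -` V"
  then have p: "p \<in> U" "p \<in> V" by auto
  let ?\<tau> = "\<lambda>x. \<psi> (inv_into U \<phi> x)" and ?\<sigma> = "\<lambda>x. \<phi> (inv_into V \<psi> x)"
  have o: "openin (Rn n) (\<phi> ` (U \<inter> V))" "openin (Rn n) (\<psi> ` (V \<inter> U))"
    using chart(1)[OF c] chart(1)[OF c']
    by (auto intro!: chart_open_image[OF c] chart_open_image[OF c'] openin_Int)
  have \<sigma>: "?\<sigma> ` (\<psi> ` (V \<inter> U)) \<subseteq> \<phi> ` (U \<inter> V)"
    using chart_inv[OF c'] by auto
  have \<tau>\<sigma>: "?\<tau> (?\<sigma> x) = x" if "x \<in> \<psi> ` (V \<inter> U)" for x
    using that chart_inv[OF c] chart_inv[OF c'] by auto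
  show "differential_at n n ?\<tau> (\<phi> p) ` topspace (Rn n) = topspace (Rn n)"
  proof (intro equalityI subsetI)
    fix v assume v: "v \<in> topspace (Rn n)"
    have "differential_at n n ?\<tau> (?\<sigma> (\<psi> p)) (differential_at n n ?\<sigma> (\<psi> p) v) = differential_at n n (\<lambda>x. ?\<tau> (?\<sigma> x)) (\<psi> p) v"
      by (rule differential_at_compose[symmetric, OF o(2) o(1) \<sigma> transition_smooth[OF c' c] sm]) (use p in blast)
    also have "\<dots> = differential_at n n (\<lambda>x. x) (\<psi> p) v"
      using p by (subst differential_at_cong[OF o(2) \<tau>\<sigma>]) auto
    also have "\<dots> = v" by (rule differential_at_id[OF v])
    finally have "v = differential_at n n ?\<tau> (\<phi> p) (differential_at n n ?\<sigma> (\<psi> p) v)"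
      using chart_inv[OF c' p(2)] by simp
    then show "v \<in> differential_at n n ?\<tau> (\<phi> p) ` topspace (Rn n)"
      using differential_at_mem by blast
  qed (use differential_at_mem in auto)
qed

text \<open>Around a point \<open>p\<close>, a chart at \<open>f p\<close> factors the coordinate expression of the composite into those of
  \<open>f\<close> and \<open>g\<close>. The factorization holds on an open set \<open>T\<close> only, which suffices as smoothness is local.\<close>

lemma submersion_compose:
  assumes M: "smooth_manifold M" and M': "smooth_manifold M'" and L: "smooth_manifold L"
    and f: "submersion M M' f" and g: "submersion M' L g"
  shows "submersion M L (\<lambda>x. g (f x))"
proof -
  interpret M: smooth_manifold M by (rule M)
  interpret M': smooth_manifold M' by (rule M')
  interpret L: smooth_manifold L by (rule L)
  have fc: "continuous_map M.X M'.X f" and gc: "continuous_map M'.X L.X g"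
    using f g by (simp_all add: submersion_continuous)
  have gfc: "continuous_map M.X L.X (\<lambda>x. g (f x))"
    using continuous_map_compose[OF fc gc] by (simp add: comp_def)
  {
    fix U \<phi> W \<theta> p assume c: "(U, \<phi>) \<in> mcharts M" and c'': "(W, \<theta>) \<in> mcharts L"
      and p: "p \<in> U" "g (f p) \<in> W"
    let ?h = "\<lambda>x. \<theta> (g (f (inv_into U \<phi> x)))"
    have "f p \<in> topspace M'.X" using continuous_map_funspace[OF fc] M.chart(4)[OF c] p(1) by auto
    then obtain V \<psi> where c': "(V, \<psi>) \<in> mcharts M'" and fp: "f p \<in> V" by (rule M'.chart_at)
    define T where "T = \<phi> ` (U \<inter> f -` (V \<inter> g -` W))"
    define T' where "T' = \<psi> ` (V \<inter> g -` W)"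
    have Vo: "openin M'.X (V \<inter> g -` W)" and T'o: "openin (Rn M'.n) T'"
      using M'.chart_domain_open[OF gc c' L.chart(1)[OF c'']] by (auto simp: T'_def)
    have To: "openin (Rn M.n) T" unfolding T_def by (rule M.chart_domain_open(2)[OF fc c Vo])
    have pT: "\<phi> p \<in> T" using p fp by (auto simp: T_def)
    let ?h1 = "\<lambda>x. \<psi> (f (inv_into U \<phi> x))" and ?h2 = "\<lambda>x. \<theta> (g (inv_into V \<psi> x))"
    have h1: "smooth_on M.n M'.n T ?h1"
      by (rule smooth_on_subset[of _ _ "\<phi> ` (U \<inter> f -` V)"]) (use submersion_smooth[OF f c c'] in \<open>auto simp: T_def\<close>)
    have h2: "smooth_on M'.n L.n T' ?h2"
      unfolding T'_def by (rule submersion_smooth[OF g c' c''])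
    have h1T: "?h1 ` T \<subseteq> T'"
      using M.chart_inv[OF c] by (auto simp: T_def T'_def)
    have eq: "?h2 (?h1 x) = ?h x" if "x \<in> T" for x
      using that M.chart_inv[OF c] M'.chart_inv[OF c'] by (auto simp: T_def)
    have smooth: "smooth_on M.n L.n T ?h"
      by (rule smooth_on_cong[OF To eq smooth_on_compose[OF To T'o h1T h1 h2]])
    have "differential_at M.n L.n ?h (\<phi> p) = differential_at M.n L.n (\<lambda>x. ?h2 (?h1 x)) (\<phi> p)"
      by (rule differential_at_cong[OF To eq[symmetric] pT])
    also have "\<dots> = (\<lambda>v. differential_at M'.n L.n ?h2 (\<psi> (f p)) (differential_at M.n M'.n ?h1 (\<phi> p) v))"
      using differential_at_compose[OF To T'o h1T h1 h2 pT] M.chart_inv[OF c p(1)] by (auto simp: fun_eq_iff)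
    finally have d: "differential_at M.n L.n ?h (\<phi> p) ` topspace (Rn M.n)
        = differential_at M'.n L.n ?h2 (\<psi> (f p)) ` (differential_at M.n M'.n ?h1 (\<phi> p) ` topspace (Rn M.n))"
      by (simp add: image_image)
    have "differential_at M.n M'.n ?h1 (\<phi> p) ` topspace (Rn M.n) = topspace (Rn M'.n)"
      by (rule submersion_surjective[OF f c c' p(1) fp])
    moreover have "differential_at M'.n L.n ?h2 (\<psi> (f p)) ` topspace (Rn M'.n) = topspace (Rn L.n)"
      by (rule submersion_surjective[OF g c' c'' fp p(2)])
    ultimately have "differential_at M.n L.n ?h (\<phi> p) ` topspace (Rn M.n) = topspace (Rn L.n)"
      using d by simp
    moreover have "T \<subseteq> \<phi> ` (U \<inter> (\<lambda>x. g (f x)) -` W)" by (auto simp: T_def)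
    ultimately have "(\<exists>T. openin (Rn M.n) T \<and> \<phi> p \<in> T \<and> T \<subseteq> \<phi> ` (U \<inter> (\<lambda>x. g (f x)) -` W) \<and> smooth_on M.n L.n T ?h)
        \<and> differential_at M.n L.n ?h (\<phi> p) ` topspace (Rn M.n) = topspace (Rn L.n)"
      using To pT smooth by (intro conjI exI[of _ T])
  }
  note local = this
  show ?thesis
    unfolding submersion_iff
  proof (intro conjI allI impI ballI)
    show "continuous_map M.X L.X (\<lambda>x. g (f x))" by (rule gfc)
    fix U \<phi> W \<theta> assume c: "(U, \<phi>) \<in> mcharts M" and c'': "(W, \<theta>) \<in> mcharts L"
    show "smooth_on M.n L.n (\<phi> ` (U \<inter> (\<lambda>x. g (f x)) -` W)) (\<lambda>x. \<theta> (g (f (inv_into U \<phi> x))))"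
    proof (rule smooth_on_locally[OF M.chart_domain_open(2)[OF gfc c L.chart(1)[OF c'']]])
      fix q assume "q \<in> \<phi> ` (U \<inter> (\<lambda>x. g (f x)) -` W)"
      then obtain p where "q = \<phi> p" "p \<in> U" "g (f p) \<in> W" by auto
      then show "\<exists>T. openin (Rn M.n) T \<and> q \<in> T \<and> T \<subseteq> \<phi> ` (U \<inter> (\<lambda>x. g (f x)) -` W) \<and>
          smooth_on M.n L.n T (\<lambda>x. \<theta> (g (f (inv_into U \<phi> x))))"
        using local[OF c c'', of p] by simp
    qed
    fix p assume "p \<in> U \<inter> (\<lambda>x. g (f x)) -` W"
    then show "differential_at M.n L.n (\<lambda>x. \<theta> (g (f (inv_into U \<phi> x)))) (\<phi> p) ` topspace (Rn M.n) = topspace (Rn L.n)"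
      using local[OF c c'', of p] by simp
  qed
qed

lemma (in smooth_manifold) null_preimage_in_charts:
  assumes M': "smooth_manifold M'" and f: "submersion M M' f"
    and c: "(U, \<phi>) \<in> mcharts M" and c': "(V, \<psi>) \<in> mcharts M'"
    and K: "compactin X K" "K \<subseteq> U" "f ` K \<subseteq> V"
    and T: "T \<subseteq> V" "\<psi> ` T \<in> null_Rn (mdim M')"
  shows "\<phi> ` {x \<in> K. f x \<in> T} \<in> null_Rn n"
proof -
  interpret M': smooth_manifold M' by (rule M')
  let ?g = "\<lambda>x. \<psi> (f (inv_into U \<phi> x))" and ?S = "\<phi> ` (U \<inter> f -` V)"
  have fc: "continuous_map X M'.X f" by (rule submersion_continuous[OF f])
  have "{y \<in> \<phi> ` K. ?g y \<in> \<psi> ` T} \<in> null_Rn n"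
  proof (rule null_preimage_submersion[of n ?S M'.n ?g])
    show "openin (Rn n) ?S" by (rule chart_domain_open(2)[OF fc c M'.chart(1)[OF c']])
    show "smooth_on n M'.n ?S ?g" by (rule submersion_smooth[OF f c c'])
    show "?g ` ?S \<subseteq> topspace (Rn M'.n)"
      using chart_inv[OF c] open_Rn_subset[OF M'.chart(2)[OF c']] by auto
    show "differential_at n M'.n ?g p ` topspace (Rn n) = topspace (Rn M'.n)" if "p \<in> ?S" for p
      using that submersion_surjective[OF f c c'] by auto
    show "compactin (Rn n) (\<phi> ` K)" by (rule chart_compact_image[OF c K(1,2)])
    show "\<phi> ` K \<subseteq> ?S" using K(2,3) by (intro image_mono) blast
  qed (rule T(2))
  moreover have "{y \<in> \<phi> ` K. ?g y \<in> \<psi> ` T} = \<phi> ` {x \<in> K. f x \<in> T}"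
  proof -
    have "?g (\<phi> x) \<in> \<psi> ` T \<longleftrightarrow> f x \<in> T" if "x \<in> K" for x
    proof -
      have "f x \<in> V" "x \<in> U" using that K(2,3) by auto
      then have "?g (\<phi> x) = \<psi> (f x)" using chart_inv[OF c] by simp
      then show ?thesis using inj_on_image_mem_iff[OF M'.chart_inj[OF c'] \<open>f x \<in> V\<close> T(1)] by simp
    qed
    then show ?thesis by blast
  qed
  ultimately show ?thesis by simp
qed

section \<open>Null compact sets\<close>

context smooth_manifold begin

lemma chart_compact_sets:
  "(U, \<phi>) \<in> mcharts M \<Longrightarrow> compactin X K \<Longrightarrow> K \<subseteq> U \<Longrightarrow> \<phi> ` K \<in> borel_Rn n"
  by (intro sets_lborel_Rn_compact chart_compact_image)

lemma compact_null_unfold: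
  "compact_null M K \<longleftrightarrow> compactin X K \<and> (\<exists>P. finite P \<and> K = \<Union>(snd ` P) \<and>
     (\<forall>V \<psi> C. ((V, \<psi>), C) \<in> P \<longrightarrow> (V, \<psi>) \<in> mcharts M \<and> compactin X C \<and> C \<subseteq> V \<and> \<psi> ` C \<in> null_sets (lebesgue_Rn n)))"
  unfolding compact_null_def by (simp only: Ball_def split_paired_All prod.case) blast

text \<open>A null compact set may be presented in charts other than the given one. Since the identity is a
  submersion, null sets of one chart are preimages of null sets, hence null sets, of the other.\<close>

lemma compact_null_iff:
  assumes c: "(U, \<phi>) \<in> mcharts M" and K: "compactin X K" "K \<subseteq> U"
  shows "compact_null M K \<longleftrightarrow> \<phi> ` K \<in> null_Rn n"
proof
  assume "compact_null M K"
  then obtain P where P: "finite P" "K = \<Union>(snd ` P)"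
    and P': "\<And>V \<psi> C. ((V, \<psi>), C) \<in> P \<Longrightarrow> (V, \<psi>) \<in> mcharts M \<and> compactin X C \<and> C \<subseteq> V \<and> \<psi> ` C \<in> null_sets (lebesgue_Rn n)"
    unfolding compact_null_unfold by blast
  have "\<phi> ` C \<in> null_Rn n" if "((V, \<psi>), C) \<in> P" for V \<psi> C
  proof -
    note C = P'[OF that]
    have CU: "C \<subseteq> U" using that P(2) K(2) by force
    have "\<psi> ` C \<in> null_Rn n"
      using C chart_compact_sets[of V \<psi> C] by (simp add: lebesgue_Rn_def null_sets_completion_iff)
    then have "\<phi> ` {x \<in> C. x \<in> C} \<in> null_Rn n"
      using C CU smooth_manifold_axioms
      by (intro null_preimage_in_charts[OF _ submersion_id c, of V \<psi>]) auto
    then show ?thesis by simp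
  qed
  then have "(\<Union>Q\<in>P. \<phi> ` snd Q) \<in> null_Rn n"
    using P(1) by (intro null_sets_UN' countable_finite) auto
  moreover have "\<phi> ` K = (\<Union>Q\<in>P. \<phi> ` snd Q)" using P(2) by auto
  ultimately show "\<phi> ` K \<in> null_Rn n" by simp
next
  assume "\<phi> ` K \<in> null_Rn n"
  then have "\<phi> ` K \<in> null_sets (lebesgue_Rn n)"
    using chart_compact_sets[OF c K] by (simp add: lebesgue_Rn_def null_sets_completion_iff)
  then show "compact_null M K"
    unfolding compact_null_def using c K by (intro conjI exI[of _ "{((U, \<phi>), K)}"]) auto
qed

lemma null_ideal_is_ideal: "null_ideal M \<in> compact_ideals X"
  unfolding compact_ideals_def
proof (rule CollectI, intro conjI ballI impI)
  show "null_ideal M \<subseteq> compacts X" by (auto simp: null_ideal_def compacts_def compact_null_def)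
  show "{} \<in> null_ideal M"
    unfolding null_ideal_def compact_null_def by (intro CollectI conjI exI[of _ "{}"]) auto
next
  fix K K' assume K: "K \<in> null_ideal M" "K' \<in> compacts X" "K' \<subseteq> K"
  then obtain P where P: "finite P" "K = \<Union>(snd ` P)"
    and P': "\<And>V \<psi> C. ((V, \<psi>), C) \<in> P \<Longrightarrow> (V, \<psi>) \<in> mcharts M \<and> compactin X C \<and> C \<subseteq> V \<and> \<psi> ` C \<in> null_sets (lebesgue_Rn n)"
    unfolding null_ideal_def compact_null_unfold by blast
  let ?P = "(\<lambda>(c, C). (c, C \<inter> K')) ` P"
  have K'c: "compactin X K'" using K(2) by (simp add: compacts_def)
  have "(V, \<psi>) \<in> mcharts M \<and> compactin X (C \<inter> K') \<and> C \<inter> K' \<subseteq> V \<and> \<psi> ` (C \<inter> K') \<in> null_sets (lebesgue_Rn n)"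
    if "((V, \<psi>), C) \<in> P" for V \<psi> C
  proof -
    note C = P'[OF that]
    have c: "compactin X (C \<inter> K')" using C K'c Hausdorff_M compactin_Int by blast
    have "\<psi> ` (C \<inter> K') \<in> borel_Rn n" by (rule chart_compact_sets[OF _ c]) (use C in auto)
    then have "\<psi> ` (C \<inter> K') \<in> sets (lebesgue_Rn n)" by (simp add: lebesgue_Rn_def)
    moreover have "\<psi> ` C \<in> null_sets (lebesgue_Rn n)" "\<psi> ` (C \<inter> K') \<subseteq> \<psi> ` C" using C by auto
    ultimately have "\<psi> ` (C \<inter> K') \<in> null_sets (lebesgue_Rn n)"
      by (metis null_sets_subset)
    then show ?thesis using C c by auto
  qed
  moreover have "K' = \<Union>(snd ` ?P)" using K(3) P(2) by force
  ultimately show "K' \<in> null_ideal M"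
    unfolding null_ideal_def compact_null_unfold
    using P(1) K'c by (intro CollectI conjI exI[of _ ?P]) auto
next
  fix K K' assume K: "K \<in> null_ideal M" "K' \<in> null_ideal M"
  obtain P where P: "finite P" "K = \<Union>(snd ` P)"
    "\<forall>V \<psi> C. ((V, \<psi>), C) \<in> P \<longrightarrow> (V, \<psi>) \<in> mcharts M \<and> compactin X C \<and> C \<subseteq> V \<and> \<psi> ` C \<in> null_sets (lebesgue_Rn n)"
    using K(1) unfolding null_ideal_def compact_null_unfold by blast
  obtain P' where P': "finite P'" "K' = \<Union>(snd ` P')"
    "\<forall>V \<psi> C. ((V, \<psi>), C) \<in> P' \<longrightarrow> (V, \<psi>) \<in> mcharts M \<and> compactin X C \<and> C \<subseteq> V \<and> \<psi> ` C \<in> null_sets (lebesgue_Rn n)"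
    using K(2) unfolding null_ideal_def compact_null_unfold by blast
  have "compactin X (K \<union> K')" using K by (auto simp: null_ideal_def compact_null_def compactin_Un)
  then show "K \<union> K' \<in> null_ideal M"
    unfolding null_ideal_def compact_null_unfold
    using P P' by (intro CollectI conjI exI[of _ "P \<union> P'"]) auto
qed

end

sublocale smooth_manifold \<subseteq> null_compacts "mtop M" "null_ideal M"
  by (rule null_compacts.intro[OF Hausdorff_M null_ideal_is_ideal])

lemma (in smooth_manifold) lebesgue_locale_eq: "lebesgue_locale M = R"
  unfolding lebesgue_locale_def by (rule b_sublocale_compact_locale)


section \<open>Measurability\<close>

text \<open>A compact Hausdorff space is regular, so each point has a closed neighbourhood inside a member of
  the cover; finitely many of these neighbourhoods suffice.\<close>

lemma compact_pieces:
  assumes H: "Hausdorff_space X" and K: "compactin X K"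
    and O: "\<And>x. x \<in> K \<Longrightarrow> \<exists>U\<in>\<U>. openin X U \<and> x \<in> U"
  obtains \<F> where "finite \<F>" "K = \<Union>\<F>" "\<And>C. C \<in> \<F> \<Longrightarrow> compactin X C \<and> (\<exists>U\<in>\<U>. C \<subseteq> U)"
proof -
  let ?Y = "subtopology X K"
  have K': "K \<subseteq> topspace X" by (rule compactin_subset_topspace[OF K])
  have Yc: "compact_space ?Y" using K by (simp add: compact_space_subtopology)
  have "regular_space ?Y"
    using Yc H by (intro compact_Hausdorff_imp_regular_space Hausdorff_space_subtopology)
  then have nb: "neighbourhood_base_of (closedin ?Y) ?Y" by (simp add: neighbourhood_base_of_closedin)
  have "\<exists>W C. openin ?Y W \<and> closedin ?Y C \<and> x \<in> W \<and> W \<subseteq> C \<and> (\<exists>U\<in>\<U>. C \<subseteq> U)" if x: "x \<in> K" for x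
  proof -
    obtain U where U: "U \<in> \<U>" "openin X U" "x \<in> U" using O[OF x] by blast
    have "openin ?Y (K \<inter> U)" using U(2) by (rule openin_subtopology_Int2)
    then obtain W C where "openin ?Y W" "closedin ?Y C" "x \<in> W" "W \<subseteq> C" "C \<subseteq> K \<inter> U"
      using nb x U(3) unfolding neighbourhood_base_of by (metis IntI)
    then show ?thesis using U(1) by blast
  qed
  then obtain W C where WC: "\<And>x. x \<in> K \<Longrightarrow> openin ?Y (W x) \<and> closedin ?Y (C x) \<and> x \<in> W x \<and> W x \<subseteq> C x \<and> (\<exists>U\<in>\<U>. C x \<subseteq> U)"
    by metis
  have "\<And>U. U \<in> W ` K \<Longrightarrow> openin ?Y U" "topspace ?Y \<subseteq> \<Union>(W ` K)" using WC by auto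
  from compactinD[OF Yc[unfolded compact_space_def] this]
  obtain \<G> where G: "finite \<G>" "\<G> \<subseteq> W ` K" "topspace ?Y \<subseteq> \<Union>\<G>" by auto
  obtain A where A: "A \<subseteq> K" "finite A" "\<G> = W ` A" using finite_subset_image[OF G(1,2)] by blast
  have ts: "topspace ?Y = K" using K' by auto
  show ?thesis
  proof (rule that[of "C ` A"])
    show "finite (C ` A)" using A(2) by simp
    have "C x \<subseteq> K" if "x \<in> A" for x using WC[of x] A(1) that closedin_subset ts by blast
    moreover have "K \<subseteq> \<Union>(C ` A)"
    proof
      fix x assume "x \<in> K"
      then obtain a where a: "a \<in> A" "x \<in> W a" using G(3) unfolding ts A(3) by auto
      moreover have "W a \<subseteq> C a" using WC[of a] a(1) A(1) by auto
      ultimately show "x \<in> \<Union>(C ` A)" by auto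
    qed
    ultimately show "K = \<Union>(C ` A)" by blast
    fix D assume "D \<in> C ` A"
    then obtain x where x: "x \<in> K" "D = C x" using A(1) by auto
    have "compactin ?Y D" using closedin_compact_space[OF Yc] WC[OF x(1)] x(2) by simp
    then show "compactin X D \<and> (\<exists>U\<in>\<U>. D \<subseteq> U)"
      using WC[OF x(1)] x(2) by (simp add: compactin_subtopology)
  qed
qed

lemma emeasure_compact_finite:
  assumes A: "compactin (Rn n) A" shows "leb n A < \<infinity>"
proof -
  define \<C> where "\<C> = (\<lambda>p. cube n p 1) ` A"
  have "A \<subseteq> \<Union>\<C>"
    using centre_in_cube[of _ n 1] compactin_subset_topspace[OF A] by (auto simp: \<C>_def)
  moreover have "openin (Rn n) U" if "U \<in> \<C>" for U
    using that openin_cube by (auto simp: \<C>_def)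
  ultimately obtain \<F> where F: "finite \<F>" "\<F> \<subseteq> \<C>" "A \<subseteq> \<Union>\<F>" using compactinD[OF A, of \<C>] by auto
  have Fs: "\<F> \<subseteq> borel_Rn n" using F(2) sets_lborel_Rn_open openin_cube by (auto simp: \<C>_def)
  have "leb n A \<le> leb n (\<Union>C\<in>\<F>. C)"
    using F Fs by (intro emeasure_mono sets.finite_UN) auto
  also have "\<dots> \<le> (\<Sum>C\<in>\<F>. leb n C)"
    using F Fs by (intro emeasure_subadditive_finite) auto
  also have "\<dots> < \<infinity>"
    using F(1,2) by (auto simp: \<C>_def emeasure_cube)
  finally show ?thesis .
qed

context smooth_manifold begin

abbreviation "vol \<phi> K \<equiv> leb n (\<phi> ` K)"

text \<open>The sets \<open>K i\<close> are chosen so that their volumes tend to the supremum over the members of \<open>I\<close> inside \<open>D\<close>.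
  A compact set \<open>Q\<close> in the remainder is disjoint from all of them, so adding \<open>Q \<inter> T\<close> with \<open>T \<in> I\<close> to \<open>K i\<close>
  cannot raise that supremum. Thus \<open>Q\<close> is orthogonal to \<open>I\<close>, and it is null because it lies in \<open>D\<close>.\<close>

lemma exhaustion:
  assumes c: "(U, \<phi>) \<in> mcharts M" and D: "compactin X D" "D \<subseteq> U"
    and I: "I \<in> compact_ideals X" and DI: "D \<in> dperp I"
  obtains K :: "nat \<Rightarrow> 'a set" where "\<And>i. K i \<in> I" "\<And>i. K i \<subseteq> D"
    "\<phi> ` (D - (\<Union>i. K i)) \<in> null_Rn n"
proof -
  define J where "J = {T \<in> I. T \<subseteq> D}"
  have Jne: "J \<noteq> {}" using I by (auto simp: J_def compact_ideals_def)
  have JX: "compactin X T" "T \<subseteq> U" if "T \<in> J" for T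
    using that D(2) ideal_compact[OF I] by (auto simp: J_def compacts_def)
  obtain S :: "nat \<Rightarrow> ennreal" where S: "range S \<subseteq> vol \<phi> ` J" "(SUP T\<in>J. vol \<phi> T) = Sup (range S)"
    using ennreal_SUP_countable_SUP[OF Jne, of "vol \<phi>"] by auto
  have "\<exists>T. T \<in> J \<and> S i = vol \<phi> T" for i
    using S(1) by (auto simp: image_subset_iff image_iff)
  then obtain K where K: "\<And>i::nat. K i \<in> J" "\<And>i. S i = vol \<phi> (K i)" by metis
  have sup: "(SUP T\<in>J. vol \<phi> T) = (SUP i. vol \<phi> (K i))" using S(2) K(2) by (simp add: image_def)
  have Dvol: "vol \<phi> D < \<infinity>" by (rule emeasure_compact_finite[OF chart_compact_image[OF c D]])
  have Ds: "\<phi> ` D \<in> borel_Rn n" by (rule chart_compact_sets[OF c D])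
  have "(SUP T\<in>J. vol \<phi> T) \<le> vol \<phi> D"
    by (intro SUP_least emeasure_mono Ds) (auto simp: J_def)
  then have fin: "(SUP T\<in>J. vol \<phi> T) < \<infinity>" using Dvol by simp
  define Z where "Z = \<phi> ` (D - (\<Union>i. K i))"
  have Zeq: "Z = \<phi> ` D - (\<Union>i. \<phi> ` K i)"
  proof -
    have KD: "K i \<subseteq> D" for i using K(1)[of i] by (simp add: J_def)
    have "inj_on \<phi> D" using chart_inj[OF c] D(2) by (rule inj_on_subset)
    then have "\<phi> ` (D - (\<Union>i. K i)) = \<phi> ` D - \<phi> ` (\<Union>i. K i)"
      using KD by (intro inj_on_image_set_diff[of \<phi> D]) auto
    then show ?thesis by (simp add: Z_def image_UN)
  qed
  have Zs: "Z \<in> borel_Rn n"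
    unfolding Zeq using Ds chart_compact_sets[OF c JX[OF K(1)]] by (intro sets.Diff sets.countable_UN) auto
  have "leb n Z = 0"
  proof (rule ccontr)
    assume "leb n Z \<noteq> 0"
    then have pos: "leb n Z > 0" by (simp add: zero_less_iff_neq_zero)
    have "leb n Z \<le> vol \<phi> D" using Ds by (intro emeasure_mono) (auto simp: Zeq)
    then have "leb n Z < \<infinity>" using Dvol by simp
    then obtain R where R: "compactin (Rn n) R" "R \<subseteq> Z" "leb n R > 0"
      using inner_regular_lborel_Rn[OF Zs _ pos] by blast
    define Q where "Q = {x \<in> U. \<phi> x \<in> R}"
    have RU: "R \<subseteq> \<phi> ` U" using R(2) D(2) unfolding Z_def by blast
    have Qc: "compactin X Q" and QR: "\<phi> ` Q = R"
      unfolding Q_def by (rule chart_compact_preimage[OF c R(1) RU])+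
    have QD: "Q \<subseteq> D - (\<Union>i. K i)"
    proof
      fix x assume x: "x \<in> Q"
      then have "\<phi> x \<in> \<phi> ` (D - (\<Union>i. K i))" using R(2) by (auto simp: Q_def Z_def)
      then show "x \<in> D - (\<Union>i. K i)"
        using inj_on_image_mem_iff[OF chart_inj[OF c], of x "D - (\<Union>i. K i)"] x D(2)
        unfolding Q_def by blast
    qed
    have "Q \<inter> T \<in> null_ideal M" if T: "T \<in> I" for T
    proof -
      define T' where "T' = Q \<inter> T"
      have T'c: "T' \<in> compacts X"
        unfolding T'_def using Qc ideal_compact[OF I T] by (intro compacts_Int) (auto simp: compacts_def)
      have T'I: "T' \<in> I" by (rule ideal_down[OF I T T'c]) (simp add: T'_def)
      have T'U: "T' \<subseteq> U" using QD D(2) by (auto simp: T'_def)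
      have le: "vol \<phi> T' + vol \<phi> (K i) \<le> (SUP T\<in>J. vol \<phi> T)" for i
      proof -
        have "T' \<union> K i \<in> J"
          using ideal_Un[OF I T'I, of "K i"] K(1)[of i] QD by (auto simp: J_def T'_def)
        moreover have "\<phi> ` T' \<inter> \<phi> ` K i = {}"
        proof -
          have "T' \<inter> K i = {}" using QD by (auto simp: T'_def)
          then show ?thesis
            using inj_on_image_Int[OF chart_inj[OF c] T'U JX(2)[OF K(1)[of i]]] by simp
        qed
        then have "vol \<phi> T' + vol \<phi> (K i) = vol \<phi> (T' \<union> K i)"
          unfolding image_Un using T'c T'U JX[OF K(1)] by (intro plus_emeasure chart_compact_sets[OF c]) (auto simp: compacts_def)
        ultimately show ?thesis
          using SUP_upper[of "T' \<union> K i" J "\<lambda>T. vol \<phi> T"] by simp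
      qed
      have "vol \<phi> T' + (SUP T\<in>J. vol \<phi> T) = (SUP i. vol \<phi> T' + vol \<phi> (K i))"
        unfolding sup by (rule ennreal_SUP_add_right) simp
      also have "\<dots> \<le> (SUP T\<in>J. vol \<phi> T)" by (intro SUP_least le)
      finally have absorbed: "vol \<phi> T' + (SUP T\<in>J. vol \<phi> T) \<le> (SUP T\<in>J. vol \<phi> T)" .
      have "x = 0" if "x + s \<le> s" "s < \<infinity>" for x s :: ennreal
        using ennreal_add_left_cancel_le[of s x 0] that by (auto simp: add.commute)
      from this[OF absorbed fin] have "vol \<phi> T' = 0" .
      then have "\<phi> ` T' \<in> null_Rn n"
        using chart_compact_sets[OF c _ T'U] T'c by (simp add: null_sets_def compacts_def)
      then show ?thesis
        using compact_null_iff[OF c _ T'U] T'c by (simp add: null_ideal_def compacts_def T'_def)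
    qed
    then have "Q \<in> orth I" using Qc by (simp add: perp_def compacts_def)
    then have "D \<inter> Q \<in> null_ideal M" using DI by (simp add: perp_def)
    moreover have "D \<inter> Q = Q" using QD by auto
    ultimately have "compact_null M Q" by (simp add: null_ideal_def)
    then have "R \<in> null_Rn n"
      using compact_null_iff[OF c Qc] QR by (auto simp: Q_def)
    then show False using R(3) by auto
  qed
  then have "Z \<in> null_Rn n" using Zs by (simp add: null_sets_def)
  then show ?thesis using that[of K] K(1) by (auto simp: J_def Z_def)
qed

text \<open>The members of \<open>I\<close> that exhaust \<open>Q \<inter> C\<close> can be replaced by their finite unions, which again belong to
  \<open>I\<close>; the volumes of these increase to that of \<open>Q \<inter> C\<close>.\<close>

lemma content_vol:
  assumes c: "(U, \<phi>) \<in> mcharts M" and C: "compactin X C" "C \<subseteq> U"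
  shows "compact_content (\<lambda>K. vol \<phi> (K \<inter> C))"
proof -
  have Kc: "compactin X (K \<inter> C)" "K \<inter> C \<subseteq> U" if "K \<in> compacts X" for K
    using compacts_Int[OF that, of C] C by (auto simp: compacts_def)
  have Ks: "\<phi> ` (K \<inter> C) \<in> borel_Rn n" if "K \<in> compacts X" for K
    by (rule chart_compact_sets[OF c Kc[OF that]])
  show ?thesis
    unfolding compact_content_def
  proof (intro conjI ballI impI)
    fix K K' assume K: "K \<in> compacts X" "K' \<in> compacts X"
    show "vol \<phi> (K \<inter> C) \<le> vol \<phi> (K' \<inter> C)" if "K \<subseteq> K'"
      using that by (intro emeasure_mono Ks K) auto
    have "\<phi> ` ((K \<inter> C) \<inter> (K' \<inter> C)) = \<phi> ` (K \<inter> C) \<inter> \<phi> ` (K' \<inter> C)"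
      by (rule inj_on_image_Int[OF chart_inj[OF c]]) (use C(2) in auto)
    moreover have "(K \<inter> C) \<inter> (K' \<inter> C) = (K \<inter> K') \<inter> C" by auto
    moreover have "\<phi> ` ((K \<union> K') \<inter> C) = \<phi> ` (K \<inter> C) \<union> \<phi> ` (K' \<inter> C)" by auto
    ultimately show "vol \<phi> (K \<inter> C) + vol \<phi> (K' \<inter> C) = vol \<phi> ((K \<union> K') \<inter> C) + vol \<phi> ((K \<inter> K') \<inter> C)"
      using emeasure_Un_Int[OF Ks[OF K(1)] Ks[OF K(2)]] by simp
  next
    fix K assume K: "K \<in> null_ideal M"
    have Kcc: "K \<in> compacts X" by (rule null_compact[OF K])
    have "K \<inter> C \<in> null_ideal M"
      by (rule null_down[OF K]) (use Kc(1)[OF Kcc] in \<open>auto simp: compacts_def\<close>)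
    then have "compact_null M (K \<inter> C)" by (simp add: null_ideal_def)
    then show "vol \<phi> (K \<inter> C) = 0"
      using compact_null_iff[OF c Kc[OF Kcc]] by auto
  next
    fix I Q assume I: "I \<in> compact_ideals X" and Q: "Q \<in> dperp I"
    have Qc: "Q \<in> compacts X" using Q perp_compacts by blast
    have "Q \<inter> C \<in> dperp I"
      using Kc(1)[OF Qc] by (intro ideal_down[OF perp_ideal[OF perp_compacts] Q]) (auto simp: compacts_def)
    then obtain K :: "nat \<Rightarrow> 'a set" where K: "\<And>i. K i \<in> I" "\<And>i. K i \<subseteq> Q \<inter> C"
      and Z: "\<phi> ` (Q \<inter> C - (\<Union>i. K i)) \<in> null_Rn n"
      using exhaustion[OF c Kc[OF Qc] I] by blast
    define T where "T j = (\<Union>i\<le>j. K i)" for j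
    have T_Suc: "T (Suc j) = T j \<union> K (Suc j)" for j by (auto simp: T_def le_Suc_eq)
    have T: "T j \<in> I" for j
    proof (induction j)
      case 0
      show ?case using K(1)[of 0] by (simp add: T_def)
    next
      case (Suc j)
      then show ?case unfolding T_Suc by (rule ideal_Un[OF I _ K(1)])
    qed
    have TC: "T j \<inter> C = T j" for j using K(2) by (auto simp: T_def)
    have Ts: "\<phi> ` T j \<in> borel_Rn n" for j
      using Ks[OF ideal_compact[OF I T[of j]]] by (simp add: TC)
    have "(\<Union>i. K i) \<subseteq> (\<Union>j. T j)" by (auto simp: T_def)
    then have "\<phi> ` (Q \<inter> C) \<subseteq> (\<Union>j. \<phi> ` T j) \<union> \<phi> ` (Q \<inter> C - (\<Union>i. K i))" by blast
    then have "vol \<phi> (Q \<inter> C) \<le> leb n ((\<Union>j. \<phi> ` T j) \<union> \<phi> ` (Q \<inter> C - (\<Union>i. K i)))"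
      using Ts Z by (intro emeasure_mono) auto
    also have "\<dots> = leb n (\<Union>j. \<phi> ` T j)"
      using Ts Z by (intro emeasure_Un_null_set) auto
    also have "\<dots> = (SUP j. vol \<phi> (T j))"
      using Ts by (intro SUP_emeasure_incseq[symmetric]) (auto intro!: incseq_SucI simp: T_Suc)
    also have "\<dots> \<le> (SUP K\<in>I. vol \<phi> (K \<inter> C))"
      using T TC by (intro SUP_least SUP_upper2[of "T j" for j]) auto
    finally show "vol \<phi> (Q \<inter> C) \<le> (SUP K\<in>I. vol \<phi> (K \<inter> C))" .
  qed
qed

lemma finite_Union_null: "finite \<F> \<Longrightarrow> \<F> \<subseteq> null_ideal M \<Longrightarrow> \<Union>\<F> \<in> null_ideal M"
  by (induction \<F> rule: finite_induct) (auto simp: null_empty null_Un)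

lemma measurable_lebesgue_locale: "measurable_locale (lebesgue_locale M)"
proof -
  define \<C> where "\<C> = {C. compactin X C \<and> (\<exists>U \<phi>. (U, \<phi>) \<in> mcharts M \<and> C \<subseteq> U)}"
  \<comment> \<open>volumes depend on the chart, so one chart is fixed for each compact set\<close>
  define \<kappa> where "\<kappa> C = (SOME \<phi>. \<exists>U. (U, \<phi>) \<in> mcharts M \<and> C \<subseteq> U)" for C
  have \<kappa>: "\<exists>U. (U, \<kappa> C) \<in> mcharts M \<and> C \<subseteq> U" if "C \<in> \<C>" for C
    unfolding \<kappa>_def using that by (intro someI_ex[of "\<lambda>\<phi>. \<exists>U. (U, \<phi>) \<in> mcharts M \<and> C \<subseteq> U"]) (auto simp: \<C>_def)
  have "measurable_locale R"
  proof (rule measurable_of_local_contents[of \<C> "\<lambda>C K. vol (\<kappa> C) (K \<inter> C)"])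
    show "C \<in> compacts X" if "C \<in> \<C>" for C using that by (simp add: \<C>_def compacts_def)
    show "\<exists>C\<in>\<C>. C \<subseteq> K \<and> C \<notin> null_ideal M" if K: "K \<in> compacts X" "K \<notin> null_ideal M" for K
    proof -
      have "\<exists>U\<in>fst ` mcharts M. openin X U \<and> x \<in> U" if x: "x \<in> K" for x
      proof -
        have "x \<in> topspace X" using x K(1) compactin_subset_topspace by (auto simp: compacts_def)
        then obtain U \<phi> where "(U, \<phi>) \<in> mcharts M" "x \<in> U" by (rule chart_at)
        then show ?thesis using chart(1)[of U \<phi>] by force
      qed
      then obtain \<F> where F: "finite \<F>" "K = \<Union>\<F>" "\<And>C. C \<in> \<F> \<Longrightarrow> compactin X C \<and> (\<exists>U\<in>fst ` mcharts M. C \<subseteq> U)"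
        using compact_pieces[OF Hausdorff_M, of K "fst ` mcharts M"] K(1) by (auto simp: compacts_def)
      then obtain C where C: "C \<in> \<F>" "C \<notin> null_ideal M" using K(2) finite_Union_null[of \<F>] by blast
      then have "C \<in> \<C>" using F(3)[of C] by (force simp: \<C>_def)
      then show ?thesis using C F(2) by blast
    qed
    show "compact_content (\<lambda>K. vol (\<kappa> C) (K \<inter> C))" if "C \<in> \<C>" for C
    proof -
      obtain U where "(U, \<kappa> C) \<in> mcharts M" "C \<subseteq> U" using \<kappa>[OF \<open>C \<in> \<C>\<close>] by blast
      then show ?thesis using that by (intro content_vol) (auto simp: \<C>_def)
    qed
    show "vol (\<kappa> C) (C \<inter> C) < \<infinity>" if "C \<in> \<C>" for C
    proof -
      obtain U where U: "(U, \<kappa> C) \<in> mcharts M" "C \<subseteq> U" using \<kappa>[OF \<open>C \<in> \<C>\<close>] by blast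
      have "compactin X C" using that by (simp add: \<C>_def)
      from emeasure_compact_finite[OF chart_compact_image[OF U(1) this U(2)]] show ?thesis by simp
    qed
    show "vol (\<kappa> C) (K \<inter> C) = vol (\<kappa> C) (K \<inter> C \<inter> C)" for C K by (simp add: Int_assoc)
    show "vol (\<kappa> C) (K \<inter> C) > 0" if C: "C \<in> \<C>" and K: "K \<in> compacts X" "K \<subseteq> C" "K \<notin> null_ideal M" for C K
    proof -
      obtain U where U: "(U, \<kappa> C) \<in> mcharts M" "C \<subseteq> U" using \<kappa>[OF C] by blast
      have Kc: "compactin X K" "K \<subseteq> U" using K U(2) by (auto simp: compacts_def)
      have "\<not> compact_null M K" using K(3) by (simp add: null_ideal_def)
      then have "\<kappa> C ` K \<notin> null_Rn n" using compact_null_iff[OF U(1) Kc] by simp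
      then have "vol (\<kappa> C) K \<noteq> 0" using chart_compact_sets[OF U(1) Kc] by (simp add: null_sets_def)
      moreover have "K \<inter> C = K" using K(2) by auto
      ultimately show ?thesis by (simp add: zero_less_iff_neq_zero)
    qed
  qed
  then show ?thesis by (simp add: lebesgue_locale_eq)
qed

end

section \<open>The map of Lebesgue locales induced by a submersion\<close>

locale submersion_of_manifolds = source: smooth_manifold M + target: smooth_manifold M'
  for M :: "'a manifold" and M' :: "'b manifold" +
  fixes f :: "'a \<Rightarrow> 'b"
  assumes subm: "submersion M M' f"
begin

lemma f_continuous: "continuous_map source.X target.X f"
  by (rule submersion_continuous[OF subm])

lemma compacts_image: "K \<in> compacts source.X \<Longrightarrow> f ` K \<in> compacts target.X"
  using image_compactin[OF _ f_continuous] by (simp add: compacts_def)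

lemma compacts_Int_vimage:
  assumes S: "S \<in> compacts source.X" and T: "T \<in> compacts target.X"
  shows "S \<inter> f -` T \<in> compacts source.X"
proof -
  have "closedin target.X T"
    using T target.Hausdorff_M by (simp add: compacts_def compactin_imp_closedin)
  then have "closedin source.X {x \<in> topspace source.X. f x \<in> T}"
    by (rule closedin_continuous_map_preimage[OF f_continuous])
  then have "compactin source.X ({x \<in> topspace source.X. f x \<in> T} \<inter> S)"
    using S by (simp add: compacts_def closed_Int_compactin)
  moreover have "{x \<in> topspace source.X. f x \<in> T} \<inter> S = S \<inter> f -` T"
    using S compactin_subset_topspace by (auto simp: compacts_def)
  ultimately show ?thesis by (simp add: compacts_def)
qed

lemma ideal_of_null_preimages:
  assumes S: "S \<in> compacts source.X"
  shows "{T \<in> compacts target.X. S \<inter> f -` T \<in> null_ideal M} \<in> compact_ideals target.X" (is "?I \<in> _")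
  unfolding compact_ideals_def
proof (rule CollectI, intro conjI ballI impI)
  show "?I \<subseteq> compacts target.X" by auto
  show "{} \<in> ?I" using source.null_empty by (simp add: compacts_def)
  show "T' \<in> ?I" if "T \<in> ?I" "T' \<in> compacts target.X" "T' \<subseteq> T" for T T'
  proof -
    have "S \<inter> f -` T' \<in> null_ideal M"
      by (rule source.null_down[of "S \<inter> f -` T"]) (use that compacts_Int_vimage[OF S] in auto)
    then show ?thesis using that(2) by simp
  qed
  show "T \<union> T' \<in> ?I" if "T \<in> ?I" "T' \<in> ?I" for T T'
    using that source.null_Un[of "S \<inter> f -` T" "S \<inter> f -` T'"]
    by (simp add: compacts_def compactin_Un vimage_Un Int_Un_distrib)
qed

text \<open>Cut \<open>S\<close> into compact pieces \<open>A\<close> for which both \<open>A\<close> and \<open>f(A)\<close> lie in charts. Up to a null set, \<open>f(A)\<close> is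
  covered by countably many \<open>T\<close> with \<open>S \<inter> f\<inverse>(T)\<close> null, and the preimage of the exceptional null set
  is null because \<open>f\<close> is a submersion. So \<open>A\<close> is null.\<close>

lemma null_of_null_preimages:
  assumes S: "S \<in> compacts source.X"
    and fS: "f ` S \<in> target.dperp {T \<in> compacts target.X. S \<inter> f -` T \<in> null_ideal M}" (is "_ \<in> target.dperp ?I")
  shows "S \<in> null_ideal M"
proof -
  have I: "?I \<in> compact_ideals target.X" by (rule ideal_of_null_preimages[OF S])
  define \<U> where "\<U> = {U \<inter> f -` V | U V. (\<exists>\<phi>. (U, \<phi>) \<in> mcharts M) \<and> (\<exists>\<psi>. (V, \<psi>) \<in> mcharts M')}"
  have "\<exists>W\<in>\<U>. openin source.X W \<and> x \<in> W" if x: "x \<in> S" for x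
  proof -
    have xt: "x \<in> topspace source.X" using x S compactin_subset_topspace by (auto simp: compacts_def)
    then obtain U \<phi> where c: "(U, \<phi>) \<in> mcharts M" "x \<in> U" by (rule source.chart_at)
    have "f x \<in> topspace target.X" using continuous_map_funspace[OF f_continuous] xt by auto
    then obtain V \<psi> where c': "(V, \<psi>) \<in> mcharts M'" "f x \<in> V" by (rule target.chart_at)
    have "openin source.X (U \<inter> f -` V)"
      by (rule source.chart_domain_open(1)[OF f_continuous c(1) target.chart(1)[OF c'(1)]])
    moreover have "U \<inter> f -` V \<in> \<U>" using c c' by (auto simp: \<U>_def)
    ultimately show ?thesis using c(2) c'(2) by blast
  qed
  then obtain \<F> where F: "finite \<F>" "S = \<Union>\<F>" "\<And>A. A \<in> \<F> \<Longrightarrow> compactin source.X A \<and> (\<exists>W\<in>\<U>. A \<subseteq> W)"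
    using compact_pieces[OF source.Hausdorff_M, of S \<U>] S by (auto simp: compacts_def)
  have "A \<in> null_ideal M" if A: "A \<in> \<F>" for A
  proof -
    have Ac: "compactin source.X A" "A \<in> compacts source.X" using F(3)[OF A] by (auto simp: compacts_def)
    obtain U \<phi> V \<psi> where c: "(U, \<phi>) \<in> mcharts M" and c': "(V, \<psi>) \<in> mcharts M'" and AUV: "A \<subseteq> U \<inter> f -` V"
      using F(3)[OF A] by (auto simp: \<U>_def)
    have AU: "A \<subseteq> U" and fAV: "f ` A \<subseteq> V" using AUV by auto
    have fAc: "f ` A \<in> compacts target.X" by (rule compacts_image[OF Ac(2)])
    have "f ` A \<in> target.dperp ?I"
      by (rule target.ideal_down[OF target.perp_ideal[OF target.perp_compacts] fS fAc]) (use A F(2) in auto)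
    then obtain K :: "nat \<Rightarrow> 'b set" where K: "\<And>i. K i \<in> ?I" "\<And>i. K i \<subseteq> f ` A"
      and Z: "\<psi> ` (f ` A - (\<Union>i. K i)) \<in> null_Rn target.n"
      using target.exhaustion[OF c' _ fAV I] fAc by (auto simp: compacts_def)
    have piece: "\<phi> ` (A \<inter> f -` K i) \<in> null_Rn source.n" for i
    proof -
      have Kc: "A \<inter> f -` K i \<in> compacts source.X"
        using K(1)[of i] by (intro compacts_Int_vimage[OF Ac(2)]) auto
      have "S \<inter> f -` K i \<in> null_ideal M" using K(1)[of i] by simp
      then have "A \<inter> f -` K i \<in> null_ideal M"
        by (rule source.null_down[OF _ Kc]) (use A F(2) in auto)
      then have "compact_null M (A \<inter> f -` K i)" by (simp add: null_ideal_def)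
      then show ?thesis
        using source.compact_null_iff[OF c, of "A \<inter> f -` K i"] Kc AU by (auto simp: compacts_def)
    qed
    have "\<phi> ` {x \<in> A. f x \<in> f ` A - (\<Union>i. K i)} \<in> null_Rn source.n"
      by (rule source.null_preimage_in_charts[OF target.smooth_manifold_axioms subm c c' Ac(1) AU fAV _ Z])
        (use fAV in auto)
    moreover have "(\<Union>i. \<phi> ` (A \<inter> f -` K i)) \<in> null_Rn source.n"
      by (rule null_sets_UN[OF piece])
    ultimately have "(\<Union>i. \<phi> ` (A \<inter> f -` K i)) \<union> \<phi> ` {x \<in> A. f x \<in> f ` A - (\<Union>i. K i)} \<in> null_Rn source.n"
      by (intro null_sets.Un)
    moreover have "(\<Union>i. \<phi> ` (A \<inter> f -` K i)) \<union> \<phi> ` {x \<in> A. f x \<in> f ` A - (\<Union>i. K i)} = \<phi> ` A" by blast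
    ultimately show ?thesis
      using source.compact_null_iff[OF c Ac(1) AU] by (simp add: null_ideal_def)
  qed
  then show ?thesis using source.finite_Union_null[OF F(1)] F(2) by blast
qed

definition pullback :: "'b set set \<Rightarrow> 'a set set"
  where "pullback J = {K \<in> compacts source.X. f ` K \<in> J}"

lemma pullback_compacts: "pullback J \<subseteq> compacts source.X"
  by (auto simp: pullback_def)

text \<open>Let \<open>f(Q)\<close> be in the double \<open>perp\<close> of \<open>J\<close>, let \<open>P\<close> be orthogonal to the pullback of \<open>J\<close>, and put
  \<open>S = Q \<inter> P\<close>. For \<open>T \<in> J\<close> the set \<open>S \<inter> f\<inverse>(T)\<close> belongs to the pullback of \<open>J\<close> and is contained in \<open>P\<close>,
  so it is null. Hence \<open>S\<close> is null by \<open>null_of_null_preimages\<close>.\<close>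

lemma pullback_dperp:
  assumes J: "J \<subseteq> compacts target.X" and down: "\<And>T T'. T \<in> J \<Longrightarrow> T' \<in> compacts target.X \<Longrightarrow> T' \<subseteq> T \<Longrightarrow> T' \<in> J"
  shows "pullback (target.dperp J) \<subseteq> source.dperp (pullback J)"
proof
  fix Q assume Q: "Q \<in> pullback (target.dperp J)"
  then have Qc: "Q \<in> compacts source.X" and fQ: "f ` Q \<in> target.dperp J" by (auto simp: pullback_def)
  have "Q \<inter> P \<in> null_ideal M" if P: "P \<in> source.orth (pullback J)" for P
  proof (rule null_of_null_preimages)
    let ?S = "Q \<inter> P"
    have Pc: "P \<in> compacts source.X" using P source.perp_compacts by blast
    show Sc: "?S \<in> compacts source.X" by (rule source.compacts_Int[OF Qc Pc])
    let ?I = "{T \<in> compacts target.X. ?S \<inter> f -` T \<in> null_ideal M}"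
    have "J \<subseteq> ?I"
    proof
      fix T assume T: "T \<in> J"
      have Kc: "?S \<inter> f -` T \<in> compacts source.X" using T J by (intro compacts_Int_vimage[OF Sc]) auto
      have "f ` (?S \<inter> f -` T) \<in> J" by (rule down[OF T compacts_image[OF Kc]]) auto
      then have "?S \<inter> f -` T \<in> pullback J" using Kc by (simp add: pullback_def)
      then have "P \<inter> (?S \<inter> f -` T) \<in> null_ideal M" using P by (simp add: perp_def)
      moreover have "P \<inter> (?S \<inter> f -` T) = ?S \<inter> f -` T" by auto
      ultimately show "T \<in> ?I" using T J by auto
    qed
    then have "f ` Q \<in> target.dperp ?I" using fQ target.dperp_mono by blast
    then show "f ` ?S \<in> target.dperp ?I"
      by (rule target.ideal_down[OF target.perp_ideal[OF target.perp_compacts] _ compacts_image[OF Sc]]) auto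
  qed
  then show "Q \<in> source.dperp (pullback J)" using Qc by (simp add: perp_def)
qed

lemma pullback_mono: "J \<subseteq> J' \<Longrightarrow> pullback J \<subseteq> pullback J'"
  by (auto simp: pullback_def)

lemma pullback_ideal:
  assumes J: "J \<in> compact_ideals target.X" shows "pullback J \<in> compact_ideals source.X"
  unfolding compact_ideals_def
proof (rule CollectI, intro conjI ballI impI)
  show "pullback J \<subseteq> compacts source.X" by (rule pullback_compacts)
  show "{} \<in> pullback J" using J by (simp add: pullback_def compacts_def compact_ideals_def)
  show "K' \<in> pullback J" if "K \<in> pullback J" "K' \<in> compacts source.X" "K' \<subseteq> K" for K K'
  proof -
    have "f ` K' \<in> J"
      by (rule target.ideal_down[OF J _ compacts_image[OF that(2)], of "f ` K"])
        (use that in \<open>auto simp: pullback_def\<close>)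
    then show ?thesis using that(2) by (simp add: pullback_def)
  qed
  show "K \<union> K' \<in> pullback J" if "K \<in> pullback J" "K' \<in> pullback J" for K K'
    using that target.ideal_Un[OF J, of "f ` K" "f ` K'"]
    by (simp add: pullback_def compacts_def compactin_Un image_Un)
qed

end

text \<open>The compact sets that \<open>f\<close> maps into a regular ideal form an ideal that need not be regular: a null
  compact set can have an image of positive measure. The double \<open>perp\<close> restores regularity.\<close>

definition lebesgue_map :: "'a manifold \<Rightarrow> 'b manifold \<Rightarrow> ('a \<Rightarrow> 'b) \<Rightarrow> 'b set set \<Rightarrow> 'a set set"
  where "lebesgue_map M M' f = (\<lambda>J\<in>carrier (lebesgue_locale M').
     perp (mtop M) (null_ideal M) (perp (mtop M) (null_ideal M) {K \<in> compacts (mtop M). f ` K \<in> J}))"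

context submersion_of_manifolds begin

lemma lebesgue_map_eq:
  "lebesgue_map M M' f = (\<lambda>J\<in>regular_ideals target.X (null_ideal M'). source.dperp (pullback J))"
  by (simp add: lebesgue_map_def target.lebesgue_locale_eq pullback_def)

lemma lebesgue_map_frame_hom: "lebesgue_map M M' f \<in> frame_hom (lebesgue_locale M') (lebesgue_locale M)"
proof -
  let ?h = "\<lambda>J\<in>regular_ideals target.X (null_ideal M'). source.dperp (pullback J)"
  let ?A = "regular_ideals target.X (null_ideal M')" and ?B = "regular_ideals source.X (null_ideal M)"
  have sup: "?h (\<Squnion>\<^bsub>target.R\<^esub>S) = \<Squnion>\<^bsub>source.R\<^esub>(?h ` S)" if S: "S \<subseteq> ?A" for S
  proof -
    have hS: "?h ` S \<subseteq> ?B" using S source.dperp_regular by auto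
    have im: "?h ` S = (\<lambda>J. source.dperp (pullback J)) ` S" using S by (intro image_cong) auto
    have Sc: "\<Union>S \<subseteq> compacts target.X" using S target.regular_compacts by blast
    have "source.dperp (pullback (target.dperp (\<Union>S))) = source.dperp (\<Union>J\<in>S. source.dperp (pullback J))"
    proof
      have "pullback (target.dperp (\<Union>S)) \<subseteq> source.dperp (pullback (\<Union>S))"
      proof (rule pullback_dperp[OF Sc])
        fix T T' assume T: "T \<in> \<Union>S" "T' \<in> compacts target.X" "T' \<subseteq> T"
        then obtain J where J: "J \<in> S" "T \<in> J" by auto
        have "T' \<in> J"
          by (rule target.ideal_down[OF target.regular_ideal J(2) T(2,3)]) (use S J in auto)
        then show "T' \<in> \<Union>S" using J by auto
      qed
      then have "source.dperp (pullback (target.dperp (\<Union>S))) \<subseteq> source.dperp (pullback (\<Union>S))"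
        by (rule source.dperp_least[OF _ source.dperp_regular])
      also have "\<dots> \<subseteq> source.dperp (\<Union>J\<in>S. source.dperp (pullback J))"
      proof (rule source.dperp_mono, rule subsetI)
        fix K assume "K \<in> pullback (\<Union>S)"
        then obtain J where "J \<in> S" "K \<in> pullback J" by (auto simp: pullback_def)
        then show "K \<in> (\<Union>J\<in>S. source.dperp (pullback J))"
          using source.dperp_ext[OF pullback_compacts] by blast
      qed
      finally show "source.dperp (pullback (target.dperp (\<Union>S))) \<subseteq> source.dperp (\<Union>J\<in>S. source.dperp (pullback J))" .
      show "source.dperp (\<Union>J\<in>S. source.dperp (pullback J)) \<subseteq> source.dperp (pullback (target.dperp (\<Union>S)))"
      proof (rule source.dperp_least[OF UN_least source.dperp_regular])
        fix J assume "J \<in> S"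
        then have "J \<subseteq> target.dperp (\<Union>S)" using target.dperp_ext[OF Sc] by blast
        then show "source.dperp (pullback J) \<subseteq> source.dperp (pullback (target.dperp (\<Union>S)))"
          by (intro source.dperp_mono pullback_mono)
      qed
    qed
    then show ?thesis
      unfolding target.R_sup[OF S] im source.R_sup[OF hS[unfolded im]] using target.dperp_regular[of "\<Union>S"] by simp
  qed
  have top: "?h \<top>\<^bsub>target.R\<^esub> = \<top>\<^bsub>source.R\<^esub>"
  proof -
    have "pullback (compacts target.X) = compacts source.X"
      using compacts_image by (auto simp: pullback_def)
    moreover have "source.dperp (compacts source.X) = compacts source.X"
      using source.compacts_regular by (simp add: source.regular_iff)
    ultimately show ?thesis
      by (simp add: target.R_top source.R_top target.compacts_regular)
  qed
  have meet: "?h (U \<sqinter>\<^bsub>target.R\<^esub> V) = ?h U \<sqinter>\<^bsub>source.R\<^esub> ?h V" if U: "U \<in> ?A" and V: "V \<in> ?A" for U V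
  proof -
    have "pullback (U \<inter> V) = pullback U \<inter> pullback V" by (auto simp: pullback_def)
    then have "source.dperp (pullback (U \<inter> V)) = source.dperp (pullback U) \<inter> source.dperp (pullback V)"
      using source.dperp_Int[OF pullback_ideal pullback_ideal] U V target.regular_ideal by simp
    then show ?thesis
      using U V by (simp add: target.R_meet source.R_meet target.regular_Int source.dperp_regular)
  qed
  have "?h \<in> ?A \<rightarrow>\<^sub>E ?B" using source.dperp_regular by auto
  then show ?thesis
    unfolding lebesgue_map_eq frame_hom_def target.lebesgue_locale_eq source.lebesgue_locale_eq
    using sup top meet by (intro CollectI conjI allI impI ballI) auto
qed

end

text \<open>The double \<open>perp\<close> between the two pullbacks is absorbed by the outer one, by \<open>pullback_dperp\<close>.\<close>

lemma lebesgue_map_compose: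
  assumes f: "submersion_of_manifolds M M' f" and g: "submersion_of_manifolds M' L g"
  shows "lebesgue_map M L (compose (topspace (mtop M)) g f)
    = compose (carrier (lebesgue_locale L)) (lebesgue_map M M' f) (lebesgue_map M' L g)"
proof -
  interpret f: submersion_of_manifolds M M' f by (rule f)
  interpret g: submersion_of_manifolds M' L g by (rule g)
  show ?thesis
  proof (rule ext)
    fix J
    show "lebesgue_map M L (compose (topspace (mtop M)) g f) J
      = compose (carrier (lebesgue_locale L)) (lebesgue_map M M' f) (lebesgue_map M' L g) J"
    proof (cases "J \<in> regular_ideals g.target.X (null_ideal L)")
      case True
      have image: "compose (topspace (mtop M)) g f ` K = g ` f ` K" if "K \<in> compacts f.source.X" for K
        using that compactin_subset_topspace[of f.source.X K]
        by (auto simp: compacts_def compose_def image_image subset_iff intro!: image_cong)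
      have "{K \<in> compacts f.source.X. compose (topspace (mtop M)) g f ` K \<in> J} = f.pullback (g.pullback J)"
        using image f.compacts_image by (auto simp: f.pullback_def g.pullback_def)
      then have "lebesgue_map M L (compose (topspace (mtop M)) g f) J = f.source.dperp (f.pullback (g.pullback J))"
        using True by (simp add: lebesgue_map_def g.target.lebesgue_locale_eq)
      moreover have "f.source.dperp (f.pullback (f.target.dperp (g.pullback J))) = f.source.dperp (f.pullback (g.pullback J))"
      proof
        show "f.source.dperp (f.pullback (f.target.dperp (g.pullback J))) \<subseteq> f.source.dperp (f.pullback (g.pullback J))"
          using f.target.ideal_down[OF g.pullback_ideal[OF g.target.regular_ideal[OF True]]]
          by (intro f.source.dperp_least[OF f.pullback_dperp f.source.dperp_regular] g.pullback_compacts) blast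
        show "f.source.dperp (f.pullback (g.pullback J)) \<subseteq> f.source.dperp (f.pullback (f.target.dperp (g.pullback J)))"
          by (intro f.source.dperp_mono f.pullback_mono f.target.dperp_ext g.pullback_compacts)
      qed
      ultimately show ?thesis
        using True f.target.dperp_regular[of "g.pullback J"]
        by (simp add: compose_def f.lebesgue_map_eq g.lebesgue_map_eq g.target.lebesgue_locale_eq)
    next
      case False
      then show ?thesis
        by (simp add: compose_def lebesgue_map_def g.target.lebesgue_locale_eq)
    qed
  qed
qed

lemma (in smooth_manifold) lebesgue_map_id:
  "lebesgue_map M M (\<lambda>x\<in>topspace X. x) = (\<lambda>J\<in>carrier (lebesgue_locale M). J)"
proof (rule ext)
  fix J
  have "{K \<in> compacts X. (\<lambda>x\<in>topspace X. x) ` K \<in> J} = J" if J: "J \<in> regular_ideals X (null_ideal M)"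
  proof -
    have "(\<lambda>x\<in>topspace X. x) ` K = K" if "K \<in> compacts X" for K
      using that compactin_subset_topspace[of X K] by (force simp: compacts_def)
    then show ?thesis using regular_compacts[OF J] by auto
  qed
  then show "lebesgue_map M M (\<lambda>x\<in>topspace X. x) J = (\<lambda>J\<in>carrier (lebesgue_locale M). J) J"
    by (auto simp: lebesgue_map_def lebesgue_locale_eq regular_iff)
qed

section \<open>The categories and the functor\<close>

lemma Man_subm_category: "category Man_subm"
proof
  note Man_subm_def [simp]
  {
    fix X :: "'a manifold" assume "X \<in> Ob Man_subm"
    then interpret smooth_manifold X by unfold_locales simp
    have "submersion X X (\<lambda>x\<in>topspace (mtop X). x)"
      by (rule submersion_cong[OF smooth_manifold_axioms _ submersion_id]) simp
    then show "Idm Man_subm X \<in> Hom Man_subm X X" by auto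
  next
    fix X Y Z :: "'a manifold" and f g
    assume "X \<in> Ob Man_subm" "Y \<in> Ob Man_subm" "Z \<in> Ob Man_subm"
      and f: "f \<in> Hom Man_subm X Y" and g: "g \<in> Hom Man_subm Y Z"
    then have m: "smooth_manifold X" "smooth_manifold Y" "smooth_manifold Z" by (auto intro: smooth_manifold.intro)
    have "submersion X Z (\<lambda>x. g (f x))"
      by (rule submersion_compose[OF m]) (use f g in auto)
    then have "submersion X Z (compose (topspace (mtop X)) g f)"
      by (rule smooth_manifold.submersion_cong[OF m(1,3), rotated]) (simp add: compose_def)
    then show "Comp Man_subm X Y Z g f \<in> Hom Man_subm X Z"
      using f g by (auto simp: compose_def PiE_def Pi_def)
  next
    fix X Y :: "'a manifold" and f
    assume "f \<in> Hom Man_subm X Y"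
    then have f: "f \<in> topspace (mtop X) \<rightarrow>\<^sub>E topspace (mtop Y)" by simp
    show "Comp Man_subm X X Y f (Idm Man_subm X) = f" "Comp Man_subm X Y Y (Idm Man_subm Y) f = f"
      using f by (auto simp: compose_def fun_eq_iff PiE_def Pi_def extensional_def)
  next
    fix W X Y Z :: "'a manifold" and f g h
    assume "f \<in> Hom Man_subm W X"
    then show "Comp Man_subm W X Z (Comp Man_subm X Y Z h g) f = Comp Man_subm W Y Z h (Comp Man_subm W X Y g f)"
      by (auto simp: compose_def fun_eq_iff PiE_def Pi_def)
  }
qed

lemma MblLoc_category: "category MblLoc"
proof
  have Ob: "L \<in> Ob MblLoc \<longleftrightarrow> frame L \<and> measurable_locale L" for L :: "'a gorder"
    by (simp add: MblLoc_def full_subcategory_def Loc_def)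
  have Hom: "Hom MblLoc L L' = frame_hom L' L" for L L' :: "'a gorder"
    by (simp add: MblLoc_def full_subcategory_def Loc_def)
  have Idm: "Idm MblLoc L = (\<lambda>U\<in>carrier L. U)" for L :: "'a gorder"
    by (simp add: MblLoc_def full_subcategory_def Loc_def)
  have Comp: "Comp MblLoc L L' L'' g f = compose (carrier L'') f g" for L L' L'' :: "'a gorder" and f g
    by (simp add: MblLoc_def full_subcategory_def Loc_def)
  {
    fix L :: "'a gorder" assume "L \<in> Ob MblLoc"
    then interpret frame L by (simp add: Ob)
    have "(\<lambda>U\<in>carrier L. U) ` S = S" if "S \<subseteq> carrier L" for S using that by force
    then show "Idm MblLoc L \<in> Hom MblLoc L L" by (simp add: Idm Hom frame_hom_def)
  next
    fix A B C :: "'a gorder" and f g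
    assume obj: "A \<in> Ob MblLoc" "B \<in> Ob MblLoc" "C \<in> Ob MblLoc"
      and f: "f \<in> Hom MblLoc A B" and g: "g \<in> Hom MblLoc B C"
    interpret B: frame B using obj by (simp add: Ob)
    interpret C: frame C using obj by (simp add: Ob)
    have fm: "f U \<in> carrier A" if "U \<in> carrier B" for U using f that by (auto simp: Hom frame_hom_def)
    have gm: "g U \<in> carrier B" if "U \<in> carrier C" for U using g that by (auto simp: Hom frame_hom_def)
    have "compose (carrier C) f g (\<Squnion>\<^bsub>C\<^esub>S) = \<Squnion>\<^bsub>A\<^esub>(compose (carrier C) f g ` S)" if S: "S \<subseteq> carrier C" for S
    proof -
      have "compose (carrier C) f g ` S = f ` g ` S" using S by (auto simp: compose_def image_image intro!: image_cong)
      moreover have "g ` S \<subseteq> carrier B" using gm S by auto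
      ultimately show ?thesis using S f g by (simp add: Hom frame_hom_def compose_def)
    qed
    moreover have "compose (carrier C) f g \<top>\<^bsub>C\<^esub> = \<top>\<^bsub>A\<^esub>"
      using f g by (simp add: Hom frame_hom_def compose_def)
    moreover have "compose (carrier C) f g (U \<sqinter>\<^bsub>C\<^esub> V) = compose (carrier C) f g U \<sqinter>\<^bsub>A\<^esub> compose (carrier C) f g V"
      if "U \<in> carrier C" "V \<in> carrier C" for U V
      using f g gm that by (simp add: Hom frame_hom_def compose_def)
    ultimately show "Comp MblLoc A B C g f \<in> Hom MblLoc A C"
      using fm gm by (simp add: Hom Comp frame_hom_def) (auto simp: compose_def)
  next
    fix A B :: "'a gorder" and f
    assume "f \<in> Hom MblLoc A B"
    then have "f \<in> carrier B \<rightarrow>\<^sub>E carrier A" by (simp add: Hom frame_hom_def)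
    then show "Comp MblLoc A A B f (Idm MblLoc A) = f" "Comp MblLoc A B B (Idm MblLoc B) f = f"
      by (auto simp: Comp Idm compose_def fun_eq_iff PiE_def Pi_def extensional_def)
  next
    fix A B C D :: "'a gorder" and f g h
    assume "h \<in> Hom MblLoc C D"
    then have "h \<in> carrier D \<rightarrow>\<^sub>E carrier C" by (simp add: Hom frame_hom_def)
    then show "Comp MblLoc A B D (Comp MblLoc B C D h g) f = Comp MblLoc A C D h (Comp MblLoc A B C g f)"
      by (auto simp: Comp compose_def fun_eq_iff PiE_def Pi_def)
  }
qed

theorem theorem1p17:
  shows "\<exists>Leb_mor :: 'a manifold \<Rightarrow> 'a manifold \<Rightarrow> ('a \<Rightarrow> 'a) \<Rightarrow> ('a set set \<Rightarrow> 'a set set).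
           cat_functor Man_subm MblLoc lebesgue_locale Leb_mor"
proof
  have sm: "submersion_of_manifolds X Y f"
    if "X \<in> Ob Man_subm" "Y \<in> Ob Man_subm" "f \<in> Hom Man_subm X Y" for X Y :: "'a manifold" and f
    using that by (simp add: Man_subm_def submersion_of_manifolds_def submersion_of_manifolds_axioms_def smooth_manifold_def)
  have mfd: "smooth_manifold X" if "X \<in> Ob Man_subm" for X :: "'a manifold"
    using that by (simp add: Man_subm_def smooth_manifold_def)
  show "cat_functor Man_subm MblLoc lebesgue_locale (lebesgue_map :: 'a manifold \<Rightarrow> 'a manifold \<Rightarrow> ('a \<Rightarrow> 'a) \<Rightarrow> _)"
  proof (intro cat_functor.intro cat_functor_axioms.intro Man_subm_category MblLoc_category)
    fix X :: "'a manifold" assume X: "X \<in> Ob Man_subm"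
    interpret X: smooth_manifold X by (rule mfd[OF X])
    show "lebesgue_locale X \<in> Ob MblLoc"
      using X.measurable_lebesgue_locale
      by (simp add: MblLoc_def full_subcategory_def Loc_def measurable_locale_def boolean_locale_def)
    show "lebesgue_map X X (Idm Man_subm X) = Idm MblLoc (lebesgue_locale X)"
      using X.lebesgue_map_id by (simp add: Man_subm_def MblLoc_def full_subcategory_def Loc_def)
  next
    fix X Y :: "'a manifold" and f
    assume "X \<in> Ob Man_subm" "Y \<in> Ob Man_subm" "f \<in> Hom Man_subm X Y"
    from submersion_of_manifolds.lebesgue_map_frame_hom[OF sm[OF this]]
    show "lebesgue_map X Y f \<in> Hom MblLoc (lebesgue_locale X) (lebesgue_locale Y)"
      by (simp add: MblLoc_def full_subcategory_def Loc_def)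
  next
    fix X Y Z :: "'a manifold" and f g
    assume "X \<in> Ob Man_subm" "Y \<in> Ob Man_subm" "Z \<in> Ob Man_subm" "f \<in> Hom Man_subm X Y" "g \<in> Hom Man_subm Y Z"
    from lebesgue_map_compose[OF sm[OF this(1,2,4)] sm[OF this(2,3,5)]]
    show "lebesgue_map X Z (Comp Man_subm X Y Z g f)
        = Comp MblLoc (lebesgue_locale X) (lebesgue_locale Y) (lebesgue_locale Z) (lebesgue_map Y Z g) (lebesgue_map X Y f)"
      by (simp add: Man_subm_def MblLoc_def full_subcategory_def Loc_def)
  qed
qed

end
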